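(* Subset Sum $\in \mathsf{AM}\left[n/4,\ O^*(2^{n/4})\right]$: there is an Arthur–Merlin protocol for Subset Sum on $n$ integers in which the proof has length at most $n/4$ bits and the deterministic verification takes time $O^*(2^{n/4})$, with the acceptance guarantees of the class $\mathsf{AM}$ (yes-instances accepted with probability at least $2/3$ for a suitable proof, no-instances rejected with probability $1$ for every proof).
   Context: Subset Sum: given a set $I$ of $n$ integers, each of absolute value at most $2^{O(n)}$, and a target integer $t$, decide whether some subset $S\subseteq I$ satisfies $\sum_{a\in S}a=t$. A language $L$ belongs to $\mathsf{AM}[s(n),t(n)]$ if there is an Arthur–Merlin protocol (shared public random string; the prover, after seeing it, sends a proof; the verifier is deterministic) such that for inputs of length parameter $n$ the proof length is at most $s(n)$, the verification time is at most $t(n)$, every $x\in L$ is accepted (for a suitable proof) with probability at least $2/3$ over the shared randomness, and every $x\notin L$ is rejected for every proof with probability $1$. $O^*(\cdot)$ hides factors polynomial in the input size. *)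

theory Defs
  imports Complex_Main
begin

text \<open>Memory cells are indexed by naturals and hold integers.  Every instruction
is charged 1 plus the binary length of all values (and addresses) it touches
(the standard logarithmic-cost RAM, polynomially equivalent to Turing machines).\<close>

type_synonym mem = "nat \<Rightarrow> int"

datatype com =
    Const nat int            (* m[i] := k *)
  | Add nat nat nat          (* m[i] := m[j] + m[l] *)
  | Sub nat nat nat          (* m[i] := m[j] - m[l] *)
  | Load nat nat             (* m[i] := m[ m[j] ] *)
  | Store nat nat            (* m[ m[i] ] := m[j] *)
  | Seq com com
  | If nat com com           (* if m[i] > 0 then c1 else c2 *)
  | While nat com            (* while m[i] > 0 do c *)

definition bitlen :: "int \<Rightarrow> nat" where
  "bitlen x = (if x = 0 then 1 else nat \<lfloor>log 2 \<bar>x\<bar>\<rfloor> + 1)"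

inductive exec :: "com \<Rightarrow> mem \<Rightarrow> nat \<Rightarrow> mem \<Rightarrow> bool" where
  ConstE: "exec (Const i k) m (1 + bitlen k) (m(i := k))"
| AddE: "exec (Add i j l) m (1 + bitlen (m j) + bitlen (m l) + bitlen (m j + m l))
           (m(i := m j + m l))"
| SubE: "exec (Sub i j l) m (1 + bitlen (m j) + bitlen (m l) + bitlen (m j - m l))
           (m(i := m j - m l))"
| LoadE: "exec (Load i j) m (1 + bitlen (m j) + bitlen (m (nat (m j))))
           (m(i := m (nat (m j))))"
| StoreE: "exec (Store i j) m (1 + bitlen (m i) + bitlen (m j))
           (m(nat (m i) := m j))"
| SeqE: "exec c1 m T1 m1 \<Longrightarrow> exec c2 m1 T2 m2 \<Longrightarrow> exec (Seq c1 c2) m (T1 + T2) m2"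
| IfTE: "m i > 0 \<Longrightarrow> exec c1 m T m' \<Longrightarrow> exec (If i c1 c2) m (1 + bitlen (m i) + T) m'"
| IfFE: "\<not> m i > 0 \<Longrightarrow> exec c2 m T m' \<Longrightarrow> exec (If i c1 c2) m (1 + bitlen (m i) + T) m'"
| WhileFE: "\<not> m i > 0 \<Longrightarrow> exec (While i c) m (1 + bitlen (m i)) m"
| WhileTE: "m i > 0 \<Longrightarrow> exec c m T1 m1 \<Longrightarrow> exec (While i c) m1 T2 m2 \<Longrightarrow>
            exec (While i c) m (1 + bitlen (m i) + T1 + T2) m2"

text \<open>On instance (as, t), shared random string rho and proof prf, the initial memory is:
m[0] = n, m[1] = t, m[2] = |rho|, m[3] = |prf|, m[4+i] = as!i (i < n),
m[4+n+j] = rho!j (as 0/1), m[4+n+|rho|+k] = prf!k (as 0/1), all other cells 0.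
The verifier accepts iff it halts with m[0] > 0.\<close>

definition init_mem :: "int list \<Rightarrow> int \<Rightarrow> bool list \<Rightarrow> bool list \<Rightarrow> mem" where
  "init_mem as t rho prf = (\<lambda>x.
     let n = length as; r = length rho; p = length prf in
     if x = 0 then int n
     else if x = 1 then t
     else if x = 2 then int r
     else if x = 3 then int p
     else if x < 4 + n then as ! (x - 4)
     else if x < 4 + n + r then (if rho ! (x - 4 - n) then 1 else 0)
     else if x < 4 + n + r + p then (if prf ! (x - 4 - n - r) then 1 else 0)
     else 0)"

definition inst_size :: "int list \<Rightarrow> int \<Rightarrow> nat" where
  "inst_size as t = length as + bitlen t + (\<Sum>a\<leftarrow>as. bitlen a)"

definition subset_sum_yes :: "int list \<Rightarrow> int \<Rightarrow> bool" where
  "subset_sum_yes as t \<longleftrightarrow> (\<exists>S \<subseteq> {..<length as}. (\<Sum>i\<in>S. as ! i) = t)"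

end

theory Submission
  imports Defs "HOL-Library.Nat_Bijection"
begin

text \<open>
Split the input into four blocks of about \<open>n/4\<close> integers and let \<open>L\<^sub>1, \<dots>, L\<^sub>4\<close> be the sets of
subset sums of the blocks, shifted by \<open>OFF\<close> to be positive; a solution is a choice
\<open>x\<^sub>j \<in> L\<^sub>j\<close> with \<open>x\<^sub>1 + x\<^sub>2 + x\<^sub>3 + x\<^sub>4 = \<tau> = t + 4 OFF\<close>.  The random string is a number \<open>A\<close>, which
hashes \<open>x\<close> to the leading \<open>q = \<lfloor>n/4\<rfloor>\<close> bits of \<open>A x mod Q M\<close>, that is to \<open>\<lfloor>A x / M\<rfloor> mod Q\<close> with
\<open>Q = 2^q\<close>; this is additive up to a rounding error below 4.  Merlin sends
\<open>\<sigma> = hash x\<^sub>1 + hash x\<^sub>2 mod Q\<close>.  Arthur enumerates the pairs of \<open>L\<^sub>1 \<times> L\<^sub>2\<close> with hash \<open>\<sigma>\<close> and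
marks their sums, enumerates the pairs of \<open>L\<^sub>3 \<times> L\<^sub>4\<close> with hash \<open>hash \<tau> - \<sigma>\<close>, and accepts if some
sum of the latter completes a marked one to \<open>\<tau>\<close>.

Since one table of each pair holds distinct values, at most \<open>O(2^q)\<close> enumerated pairs have the
same sum as the solution; every other pair collides with it with probability \<open>O(1/Q)\<close>, so by
Markov's inequality both enumerations have length \<open>O(2^q)\<close> with probability at least \<open>2/3\<close>.  A
fuel counter stops them otherwise, which makes the time bound unconditional.

On the logarithmic-cost RAM an address of \<open>O(n)\<close> bits costs \<open>O(n)\<close>, so the sparse memory serves
as a dictionary: dictionary \<open>k\<close> keeps key \<open>z \<in> [0, M)\<close> in cell \<open>k M + z\<close>, and no sorting or
clearing is needed.
\<close>

text \<open>The machine cannot multiply or divide, so \<open>A x\<close> is built by doubling and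
  adding, with carries from the residue modulo \<open>M\<close> into the hash. Leading bits need no
  prime modulus: if \<open>0 < |D| < M\<close>, the multiples \<open>A D\<close> move around a
  circle of length \<open>Q M\<close> in steps shorter than the window of length \<open>10 M\<close>
  that contains all collisions, so a fraction of order \<open>1/Q\<close> of the \<open>A\<close>
  collide. The price is a rounding error, so each outer element searches four neighbouring buckets.
  Soundness relies neither on the hash nor on the fuel: only true sums of table entries are marked
  or tested, so these can only cause sums to be missed. One program serves every \<open>c\<close>:
  it learns the size of the integers from the length of the random string, through
  \<open>OFF = 2^(r - n)\<close>. Blocks have \<open>q + 1\<close> integers, missing ones counting
  as 0, so that four blocks cover the input while the proof has only \<open>q\<close> bits. The main
  formal obstacle is the logarithmic cost: time bounds require all values and addresses to stay
  below \<open>2^B\<close>, so the loop invariants carry \<open>bnd B\<close>, mostly through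
  \<open>env\<close>.\<close>

text \<open>Soundness speaks of all runs of the verifier, whereas the analysis constructs one;
  determinism identifies them.\<close>

lemma exec_deterministic:
  "exec c m T m' \<Longrightarrow> exec c m T2 m2 \<Longrightarrow> T2 = T \<and> m2 = m'"
proof (induction arbitrary: T2 m2 rule: exec.induct)
  case (SeqE c1 m T1 m1 c2 T2' m2')
  from SeqE.prems show ?case by (cases) (use SeqE.IH in blast)
next
  case (WhileTE m i c T1 m1 T2' m2')
  from WhileTE.prems show ?case
  proof cases
    case WhileFE then show ?thesis using WhileTE.hyps by simp
  next
    case (WhileTE T1a m1a T2a)
    then show ?thesis using WhileTE.IH by blast
  qed
next
  case (IfTE m i c1 T m' c2)
  from IfTE.prems show ?case
  proof cases
    case (IfTE T)
    then show ?thesis using IfTE.IH by blast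
  qed (use IfTE.hyps in simp)
next
  case (IfFE m i c2 T m' c1)
  from IfFE.prems show ?case
  proof cases
    case (IfFE T)
    then show ?thesis using IfFE.IH by blast
  qed (use IfFE.hyps in simp)
next
  case (WhileFE m i c)
  from WhileFE.prems show ?case by cases (use WhileFE.hyps in simp_all)
next
  case (ConstE i k m)
  from ConstE.prems show ?case by cases auto
next
  case (AddE i j l m)
  from AddE.prems show ?case by cases auto
next
  case (SubE i j l m)
  from SubE.prems show ?case by cases auto
next
  case (LoadE i j m)
  from LoadE.prems show ?case by cases auto
next
  case (StoreE i j m)
  from StoreE.prems show ?case by cases auto
qed

section \<open>Straight-line code and time accounting\<close>

text \<open>One bound on all cells covers values and addresses alike, since addresses are themselves
  cell contents.\<close>

definition bnd :: "nat \<Rightarrow> mem \<Rightarrow> bool" where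
  "bnd b m \<longleftrightarrow> (\<forall>x. \<bar>m x\<bar> < 2 ^ b)"

lemma bndD: "bnd b m \<Longrightarrow> \<bar>m x\<bar> < 2 ^ b"
  by (simp add: bnd_def)

lemma bnd_upd: "bnd b m \<Longrightarrow> \<bar>v\<bar> < 2 ^ b \<Longrightarrow> bnd b (m(i := v))"
  by (simp add: bnd_def)

lemma bnd_mono: "bnd b m \<Longrightarrow> b \<le> b' \<Longrightarrow> bnd b' m"
  unfolding bnd_def by (meson less_le_trans one_le_numeral power_increasing)

lemma bitlen_le:
  assumes "\<bar>x\<bar> < 2 ^ b" "1 \<le> b"
  shows "bitlen x \<le> b"
proof (cases "x = 0")
  case False
  then have 1: "1 \<le> real_of_int \<bar>x\<bar>" by linarith
  have "real_of_int \<bar>x\<bar> < 2 ^ b" using assms(1)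
    by (metis of_int_less_iff of_int_numeral of_int_power)
  then have "log 2 \<bar>x\<bar> < b"
    using 1 by (simp add: log_less_iff powr_realpow)
  then have "\<lfloor>log 2 \<bar>x\<bar>\<rfloor> < int b"
    by (simp add: floor_less_iff)
  moreover have "0 \<le> \<lfloor>log 2 \<bar>x\<bar>\<rfloor>" using 1 by simp
  ultimately have "nat \<lfloor>log 2 \<bar>x\<bar>\<rfloor> < b" by linarith
  then show ?thesis using False by (simp add: bitlen_def)
qed (use assms in \<open>simp add: bitlen_def\<close>)

lemma less_two_power_bitlen: "\<bar>x\<bar> < 2 ^ bitlen x"
proof (cases "x = 0")
  case False
  then have 1: "1 \<le> real_of_int \<bar>x\<bar>" by linarith
  have "log 2 \<bar>x\<bar> < real (bitlen x)"
    using False 1 by (simp add: bitlen_def) linarith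
  then have "real_of_int \<bar>x\<bar> < 2 ^ bitlen x"
    using 1 by (simp add: log_less_iff powr_realpow)
  then show ?thesis
    by (metis of_int_less_iff of_int_numeral of_int_power)
qed (simp add: bitlen_def)

text \<open>Execution as a function, so that fragments can be evaluated by rewriting;
  \<open>loopfree\<close> describes the domain on which it is related to
  \<open>exec\<close>.\<close>

primrec ev :: "com \<Rightarrow> mem \<Rightarrow> mem" where
  "ev (Const i k) m = m(i := k)"
| "ev (Add i j l) m = m(i := m j + m l)"
| "ev (Sub i j l) m = m(i := m j - m l)"
| "ev (Load i j) m = m(i := m (nat (m j)))"
| "ev (Store i j) m = m(nat (m i) := m j)"
| "ev (Seq c1 c2) m = ev c2 (ev c1 m)"
| "ev (If i c1 c2) m = (if m i > 0 then ev c1 m else ev c2 m)"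
| "ev (While i c) m = m"

text \<open>The bound 16 on constants fits the condition \<open>4 \<le> b\<close> below: such
  constants stay under \<open>2 ^ b\<close>.\<close>

primrec loopfree :: "com \<Rightarrow> bool" where
  "loopfree (Const i k) = (\<bar>k\<bar> < 16)"
| "loopfree (Add i j l) = True"
| "loopfree (Sub i j l) = True"
| "loopfree (Load i j) = True"
| "loopfree (Store i j) = True"
| "loopfree (Seq c1 c2) = (loopfree c1 \<and> loopfree c2)"
| "loopfree (If i c1 c2) = (loopfree c1 \<and> loopfree c2)"
| "loopfree (While i c) = False"

primrec csz :: "com \<Rightarrow> nat" where
  "csz (Const i k) = 1"
| "csz (Add i j l) = 1"
| "csz (Sub i j l) = 1"
| "csz (Load i j) = 1"
| "csz (Store i j) = 1"
| "csz (Seq c1 c2) = csz c1 + csz c2"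
| "csz (If i c1 c2) = 1 + csz c1 + csz c2"
| "csz (While i c) = 1"

lemma exec_boundI: "exec c m T m' \<Longrightarrow> T \<le> K \<Longrightarrow> R \<Longrightarrow> \<exists>T. exec c m T m' \<and> T \<le> K \<and> R"
  by blast

text \<open>An addition or subtraction lengthens the longest value by at most one bit, so
  \<open>csz c\<close> instructions stay within \<open>b + csz c\<close> bits. The factor 3 is the
  largest number of values charged to one instruction.\<close>

lemma loopfree_exec:
  "loopfree c \<Longrightarrow> bnd b m \<Longrightarrow> 4 \<le> b \<Longrightarrow>
   \<exists>T. exec c m T (ev c m) \<and> T \<le> csz c * (1 + 3 * (b + csz c)) \<and> bnd (b + csz c) (ev c m)"
proof (induction c arbitrary: m b)
  case (Const i k)
  then have "\<bar>k\<bar> < 2 ^ 4" by simp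
  then have k: "\<bar>k\<bar> < 2 ^ b"
    using Const.prems(3) by (meson less_le_trans one_le_numeral power_increasing)
  then have "bitlen k \<le> b" using Const.prems by (intro bitlen_le) auto
  moreover have "bnd (b + 1) (m(i := k))"
    using k Const.prems by (meson bnd_mono bnd_upd le_add1)
  ultimately show ?case using exec.ConstE[of i k m]
    by (simp only: ev.simps csz.simps) (erule exec_boundI, auto simp del: fun_upd_apply)
next
  case (Add i j l)
  note b = bndD[OF Add.prems(2)]
  have s: "\<bar>m j + m l\<bar> < 2 ^ (b + 1)" using b[of j] b[of l] by simp
  have "bitlen (m j) \<le> b" "bitlen (m l) \<le> b" "bitlen (m j + m l) \<le> b + 1"
    using b[of j] b[of l] s Add.prems by (auto intro!: bitlen_le)
  moreover have "bnd (b + 1) (m(i := m j + m l))"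
    using s Add.prems by (meson bnd_mono bnd_upd le_add1)
  ultimately show ?case using exec.AddE[of i j l m]
    by (simp only: ev.simps csz.simps) (erule exec_boundI, auto simp del: fun_upd_apply)
next
  case (Sub i j l)
  note b = bndD[OF Sub.prems(2)]
  have s: "\<bar>m j - m l\<bar> < 2 ^ (b + 1)" using b[of j] b[of l] by simp
  have "bitlen (m j) \<le> b" "bitlen (m l) \<le> b" "bitlen (m j - m l) \<le> b + 1"
    using b[of j] b[of l] s Sub.prems by (auto intro!: bitlen_le)
  moreover have "bnd (b + 1) (m(i := m j - m l))"
    using s Sub.prems by (meson bnd_mono bnd_upd le_add1)
  ultimately show ?case using exec.SubE[of i j l m]
    by (simp only: ev.simps csz.simps) (erule exec_boundI, auto simp del: fun_upd_apply)
next
  case (Load i j)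
  note b = bndD[OF Load.prems(2)]
  have "bitlen (m j) \<le> b" "bitlen (m (nat (m j))) \<le> b"
    using b Load.prems by (auto intro!: bitlen_le)
  moreover have "bnd (b + 1) (m(i := m (nat (m j))))"
    using b Load.prems by (meson bnd_mono bnd_upd le_add1)
  ultimately show ?case using exec.LoadE[of i j m]
    by (simp only: ev.simps csz.simps) (erule exec_boundI, auto simp del: fun_upd_apply)
next
  case (Store i j)
  note b = bndD[OF Store.prems(2)]
  have "bitlen (m j) \<le> b" "bitlen (m i) \<le> b"
    using b Store.prems by (auto intro!: bitlen_le)
  moreover have "bnd (b + 1) (m(nat (m i) := m j))"
    using b Store.prems by (meson bnd_mono bnd_upd le_add1)
  ultimately show ?case using exec.StoreE[of i j m]
    by (simp only: ev.simps csz.simps) (erule exec_boundI, auto simp del: fun_upd_apply)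
next
  case (Seq c1 c2)
  obtain T1 where 1: "exec c1 m T1 (ev c1 m)" "T1 \<le> csz c1 * (1 + 3 * (b + csz c1))"
    "bnd (b + csz c1) (ev c1 m)" using Seq.IH(1)[of b m] Seq.prems by auto
  obtain T2 where 2: "exec c2 (ev c1 m) T2 (ev c2 (ev c1 m))"
    "T2 \<le> csz c2 * (1 + 3 * (b + csz c1 + csz c2))"
    "bnd (b + csz c1 + csz c2) (ev c2 (ev c1 m))"
    using Seq.IH(2)[OF _ 1(3)] Seq.prems by auto
  have "T1 \<le> csz c1 * (1 + 3 * (b + csz c1 + csz c2))"
    using 1(2) by (rule order_trans) simp
  then have "T1 + T2 \<le> (csz c1 + csz c2) * (1 + 3 * (b + (csz c1 + csz c2)))"
    using 2(2) by (simp add: algebra_simps)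
  then show ?case using exec.SeqE[OF 1(1) 2(1)] 2(3) by (auto simp: add.assoc)
next
  case (If i c1 c2)
  have bi: "bitlen (m i) \<le> b"
    using bndD[OF If.prems(2)] If.prems by (auto intro!: bitlen_le)
  have fin: "1 + bitlen (m i) + T \<le> (1 + s1 + s2) * (1 + 3 * (b + (1 + s1 + s2)))"
    if "T \<le> s * (1 + 3 * (b + s))" "s \<le> s1 + s2" for T s s1 s2
  proof -
    have "T \<le> (s1 + s2) * (1 + 3 * (b + (1 + s1 + s2)))"
      by (rule order_trans[OF that(1)], rule mult_le_mono) (use that(2) in auto)
    then show ?thesis using bi by (simp add: algebra_simps)
  qed
  show ?case
  proof (cases "m i > 0")
    case True
    obtain T where 1: "exec c1 m T (ev c1 m)" "T \<le> csz c1 * (1 + 3 * (b + csz c1))"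
      "bnd (b + csz c1) (ev c1 m)" using If.IH(1)[of b m] If.prems by auto
    have "bnd (b + csz (If i c1 c2)) (ev c1 m)"
      using bnd_mono[OF 1(3)] by simp
    then show ?thesis
      using exec.IfTE[of m i, OF True 1(1), of c2] fin[OF 1(2), of "csz c1" "csz c2"] True by auto
  next
    case False
    obtain T where 1: "exec c2 m T (ev c2 m)" "T \<le> csz c2 * (1 + 3 * (b + csz c2))"
      "bnd (b + csz c2) (ev c2 m)" using If.IH(2)[of b m] If.prems by auto
    have "bnd (b + csz (If i c1 c2)) (ev c2 m)"
      using bnd_mono[OF 1(3)] by simp
    then show ?thesis
      using exec.IfFE[of m i, OF False 1(1), of c1] fin[OF 1(2), of "csz c1" "csz c2"] False by auto
  qed
qed simp

text \<open>The time unit is the price of an instruction within a fragment of size at most 100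
  started under \<open>bnd B\<close>. Inside a fragment values may exceed \<open>2 ^ B\<close>; the
  invariants restore the bound at its end.\<close>

definition runs :: "nat \<Rightarrow> com \<Rightarrow> mem \<Rightarrow> nat \<Rightarrow> mem \<Rightarrow> bool" where
  "runs B c m k m' \<longleftrightarrow> (\<exists>T. exec c m T m' \<and> T \<le> k * (1 + 3 * (B + 100)))"

lemma runs_loopfree:
  assumes "loopfree c" "csz c \<le> 100" "bnd B m" "4 \<le> B"
  shows "runs B c m (csz c) (ev c m)"
proof -
  obtain T where "exec c m T (ev c m)" "T \<le> csz c * (1 + 3 * (B + csz c))"
    using loopfree_exec assms by blast
  moreover have "csz c * (1 + 3 * (B + csz c)) \<le> csz c * (1 + 3 * (B + 100))"
    using assms by (intro mult_le_mono) auto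
  ultimately show ?thesis unfolding runs_def by (meson order_trans)
qed

lemma runs_mono: "runs B c m k m' \<Longrightarrow> k \<le> k' \<Longrightarrow> runs B c m k' m'"
  unfolding runs_def by (meson mult_le_mono1 order_trans)

lemma runs_seq: "runs B c1 m k1 m1 \<Longrightarrow> runs B c2 m1 k2 m2 \<Longrightarrow> runs B (Seq c1 c2) m (k1 + k2) m2"
  unfolding runs_def by (fastforce simp: add_mult_distrib intro: exec.SeqE)

lemma runs_while_end:
  assumes "\<not> m i > 0" "bnd B m" "1 \<le> B"
  shows "runs B (While i c) m 1 m"
proof -
  have "bitlen (m i) \<le> B" using bndD[OF assms(2)] assms by (auto intro!: bitlen_le)
  then show ?thesis unfolding runs_def using exec.WhileFE[of m i c, OF assms(1)]
    by (intro exI[of _ "1 + bitlen (m i)"]) auto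
qed

lemma runs_while_step:
  assumes "m i > 0" "bnd B m" "1 \<le> B" "runs B c m k1 m1" "runs B (While i c) m1 k2 m2"
  shows "runs B (While i c) m (1 + k1 + k2) m2"
proof -
  have b: "bitlen (m i) \<le> B" using bndD[OF assms(2)] assms by (auto intro!: bitlen_le)
  obtain T1 T2 where "exec c m T1 m1" "T1 \<le> k1 * (1 + 3 * (B + 100))"
    "exec (While i c) m1 T2 m2" "T2 \<le> k2 * (1 + 3 * (B + 100))"
    using assms unfolding runs_def by blast
  then show ?thesis unfolding runs_def using b exec.WhileTE[of m i, OF assms(1)]
    by (intro exI[of _ "1 + bitlen (m i) + T1 + T2"]) (auto simp: algebra_simps)
qed

text \<open>The potential \<open>\<mu>\<close> pays for the running time as well as for termination.\<close>

lemma runs_loop: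
  assumes step: "\<And>m. I m \<Longrightarrow> m i > 0 \<Longrightarrow>
      \<exists>k m1. runs B c m k m1 \<and> I m1 \<and> \<mu> m1 + k + 1 \<le> \<mu> m"
    and b: "\<And>m. I m \<Longrightarrow> bnd B m" "1 \<le> B"
    and "I m"
  shows "\<exists>k m'. runs B (While i c) m k m' \<and> I m' \<and> \<not> m' i > 0 \<and> k + \<mu> m' \<le> \<mu> m + 1"
  using \<open>I m\<close>
proof (induction "\<mu> m" arbitrary: m rule: less_induct)
  case less
  show ?case
  proof (cases "m i > 0")
    case True
    obtain k m1 where 1: "runs B c m k m1" "I m1" "\<mu> m1 + k + 1 \<le> \<mu> m"
      using step[OF less.prems True] by blast
    obtain k' m' where 2: "runs B (While i c) m1 k' m'" "I m'" "\<not> m' i > 0" "k' + \<mu> m' \<le> \<mu> m1 + 1"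
      using less.hyps[OF _ 1(2)] 1(3) by auto
    show ?thesis
      using runs_while_step[OF True b(1)[OF less.prems] b(2) 1(1) 2(1)] 1 2
      by (intro exI[of _ "1 + k + k'"] exI[of _ m']) auto
  next
    case False
    then show ?thesis using runs_while_end[OF False b(1)[OF less.prems] b(2)] less.prems
      by (intro exI[of _ 1] exI[of _ m]) auto
  qed
qed

text \<open>For loops whose number of rounds is known beforehand. Where it depends on the fuel,
  which all buckets share, \<open>runs_loop\<close> is applied instead.\<close>

lemma runs_count_loop:
  assumes step: "\<And>j m. I j m \<Longrightarrow> j < N \<Longrightarrow> \<exists>m1. runs B c m K m1 \<and> I (Suc j) m1"
    and guard: "\<And>j m. I j m \<Longrightarrow> j \<le> N \<Longrightarrow> bnd B m \<and> (m i > 0 \<longleftrightarrow> j < N)"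
    and B: "4 \<le> B" and I0: "I 0 m"
  shows "\<exists>m'. runs B (While i c) m ((K + 1) * N + 1) m' \<and> I N m'"
proof -
  have "\<exists>m'. runs B (While i c) m ((K + 1) * d + 1) m' \<and> I N m'" if "I j m" "j + d = N" for j d m
    using that
  proof (induction d arbitrary: j m)
    case 0
    then show ?case using guard[OF 0(1)] runs_while_end[of m i B c] B by auto
  next
    case (Suc d)
    then obtain m1 where 1: "runs B c m K m1" "I (Suc j) m1" using step[of j m] by auto
    obtain m' where 2: "runs B (While i c) m1 ((K + 1) * d + 1) m'" "I N m'"
      using Suc.IH[OF 1(2)] Suc.prems by auto
    have "runs B (While i c) m (1 + K + ((K + 1) * d + 1)) m'"
      using guard[OF Suc.prems(1)] Suc.prems(2) B by (intro runs_while_step[OF _ _ _ 1(1) 2(1)]) auto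
    then show ?case using 2(2) by (auto elim!: runs_mono)
  qed
  from this[OF I0, of N] show ?thesis by simp
qed

section \<open>The program\<close>

text \<open>
Cells below 64 serve as registers: \<open>rX\<close>, \<open>rHX\<close>, \<open>rY\<close> hold an element, its hash and the remainder;
\<open>rWP\<close>, \<open>rRem\<close> the address of the next input integer and the number of those left;
\<open>rBH\<close>, \<open>rBN\<close>, \<open>rBW\<close>, \<open>rBR\<close> the base addresses of the bucket heads, of the bucket successors, of the
marks being set and of the marks being tested; \<open>rF\<close> the fuel, \<open>rS\<close> the hash target, \<open>rBk\<close> the
current bucket and \<open>rP\<close> the current table entry.  In the enumeration of a block, entry
\<open>rD = rPW + rSI\<close> is entry \<open>rSI\<close> plus the weight \<open>rW\<close>, where \<open>rPW\<close> is a power of two.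
\<close>

abbreviation (input) rH :: nat where "rH \<equiv> 1"
abbreviation (input) rR :: nat where "rR \<equiv> 2"
abbreviation (input) rT :: nat where "rT \<equiv> 3"
abbreviation (input) rOne :: nat where "rOne \<equiv> 4"
abbreviation (input) rZero :: nat where "rZero \<equiv> 5"
abbreviation (input) rQ :: nat where "rQ \<equiv> 6"
abbreviation (input) rM :: nat where "rM \<equiv> 7"
abbreviation (input) rOff :: nat where "rOff \<equiv> 8"
abbreviation (input) rq :: nat where "rq \<equiv> 9"
abbreviation (input) rF :: nat where "rF \<equiv> 10"
abbreviation (input) rS :: nat where "rS \<equiv> 11"
abbreviation (input) rFound :: nat where "rFound \<equiv> 12"
abbreviation (input) rX :: nat where "rX \<equiv> 13"
abbreviation (input) rHX :: nat where "rHX \<equiv> 14"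
abbreviation (input) rY :: nat where "rY \<equiv> 15"
abbreviation (input) rCnt :: nat where "rCnt \<equiv> 16"
abbreviation (input) rA :: nat where "rA \<equiv> 17"
abbreviation (input) rB :: nat where "rB \<equiv> 18"
abbreviation (input) rWP :: nat where "rWP \<equiv> 19"
abbreviation (input) rRem :: nat where "rRem \<equiv> 20"
abbreviation (input) rBH :: nat where "rBH \<equiv> 21"
abbreviation (input) rBN :: nat where "rBN \<equiv> 22"
abbreviation (input) rBW :: nat where "rBW \<equiv> 23"
abbreviation (input) rBR :: nat where "rBR \<equiv> 24"
abbreviation (input) rD :: nat where "rD \<equiv> 25"
abbreviation (input) rPW :: nat where "rPW \<equiv> 26"
abbreviation (input) rSI :: nat where "rSI \<equiv> 27"
abbreviation (input) rW :: nat where "rW \<equiv> 28"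
abbreviation (input) rI :: nat where "rI \<equiv> 29"
abbreviation (input) rBk :: nat where "rBk \<equiv> 30"
abbreviation (input) rP :: nat where "rP \<equiv> 31"

abbreviation (input) seq :: "com \<Rightarrow> com \<Rightarrow> com" (infixr ";;" 60) where "c1 ;; c2 \<equiv> Seq c1 c2"
abbreviation (input) Mov :: "nat \<Rightarrow> nat \<Rightarrow> com" where "Mov i j \<equiv> Add i j rZero"
abbreviation (input) Skip :: com where "Skip \<equiv> Const rA 0"

text \<open>After a doubling or an addition both parts are below twice their modulus, so one
  conditional subtraction each suffices; subtracting \<open>M\<close> carries 1 into the hash. The
  machine only tests positivity, hence the differences in \<open>rA\<close>.\<close>

definition cNorm :: com where
  "cNorm = Sub rA rM rY ;; If rA Skip (Sub rY rY rM ;; Add rHX rHX rOne) ;;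
           Sub rA rQ rHX ;; If rA Skip (Sub rHX rHX rQ)"

text \<open>One Horner step for \<open>A x\<close>, most significant bit of \<open>A\<close> first.
  The closing \<open>Skip\<close> sets \<open>rA\<close> to 0, which makes its bound
  immediate.\<close>

definition cHashBody :: com where
  "cHashBody = Add rY rY rY ;; Add rHX rHX rHX ;; cNorm ;; Load rA rCnt ;;
     If rA (Add rY rY rX ;; cNorm) Skip ;; Add rCnt rCnt rOne ;; Sub rB rB rOne ;; Skip"

definition cHash :: com where
  "cHash = (Const rHX 0 ;; Const rY 0 ;; Add rCnt rH 0 ;; Const rA 4 ;; Add rCnt rCnt rA ;; Mov rB rR) ;;
           While rB cHashBody"

definition cInsert :: com where
  "cInsert = cHash ;;
     (Add rA rBN rX ;; Load rB rA ;;
      If rB Skip (Add rCnt rBH rHX ;; Load rB rCnt ;; Add rB rB rOne ;; Store rA rB ;; Store rCnt rX))"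

definition cGenBody :: com where
  "cGenBody = Sub rA rPW rSI ;;
     If rA Skip (Mov rPW rD ;; Const rSI 0 ;;
       If rRem (Load rW rWP ;; Sub rRem rRem rOne ;; Add rWP rWP rOne) (Const rW 0)) ;;
     Add rA rM rSI ;; Load rA rA ;; Add rA rA rW ;; Add rB rM rD ;; Store rB rA ;;
     Add rD rD rOne ;; Add rSI rSI rOne ;; Sub rCnt rCnt rOne"

definition cGen :: com where
  "cGen = (Store rM rOff ;; Mov rD rOne ;; Const rPW 0 ;; Mov rSI rOne ;; Add rCnt rQ rQ ;; Sub rCnt rCnt rD) ;;
     While rCnt cGenBody"

definition cForall :: "com \<Rightarrow> com" where
  "cForall act = Add rI rQ rQ ;;
     While rI ((Sub rI rI rOne ;; Add rA rM rI ;; Load rX rA) ;; act)"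

text \<open>One body serves both phases: a sum is marked relative to \<open>rBW\<close> and its
  complement to the target is tested relative to \<open>rBR\<close>. Between the phases
  \<open>cMid\<close> exchanges the two bases. When the fuel is gone, \<open>rP\<close> becomes 0
  and the walk ends.\<close>

definition cWalkBody :: com where
  "cWalkBody = If rF
     (Sub rF rF rOne ;; Add rB rX rP ;; Add rA rBW rB ;; Store rA rOne ;;
      Add rA rBR rT ;; Sub rA rA rB ;; Load rA rA ;; If rA (Const rFound 1) Skip ;;
      Add rA rBN rP ;; Load rP rA ;; Sub rP rP rOne)
     (Const rP 0)"

text \<open>The bucket number goes down by one cyclically, so four calls of \<open>cStep\<close>
  cover the rounding errors 0 to 3.\<close>

definition cStep :: com where
  "cStep = (Add rA rBH rBk ;; Load rP rA) ;; While rP cWalkBody ;;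
     (Sub rBk rBk rOne ;; Sub rA rZero rBk ;; If rA (Add rBk rBk rQ) Skip)"

definition cJoin :: com where
  "cJoin = cHash ;; (Sub rBk rS rHX ;; Sub rA rZero rBk ;; If rA (Add rBk rBk rQ) Skip) ;;
     cStep ;; cStep ;; cStep ;; cStep"

definition cPhase :: com where
  "cPhase = cGen ;; cForall cInsert ;; cGen ;; cForall cJoin"

section \<open>Hashing\<close>

definition bval :: "bool list \<Rightarrow> int" where
  "bval = foldl (\<lambda>a b. 2 * a + of_bool b) 0"

lemma bval_Nil [simp]: "bval [] = 0"
  by (simp add: bval_def)

lemma bval_snoc [simp]: "bval (bs @ [b]) = 2 * bval bs + of_bool b"
  by (simp add: bval_def)

lemma bval_nonneg: "0 \<le> bval bs"
  by (induction bs rule: rev_induct) auto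

text \<open>Memory is divided into regions of length \<open>M\<close>. Region 0 contains the
  registers and the input copied to \<open>H + 4\<close>, for which \<open>3 * H < M\<close> leaves
  room; \<open>16 * M \<le> 2 ^ B\<close> leaves room for addresses in the regions up to 14. In
  \<open>small\<close>, positions beyond the input weigh 0.\<close>

locale verifier =
  fixes as :: "int list" and n r q B :: nat and M Q OFF H \<tau> :: int and rho :: "bool list"
  assumes n_def: "n = length as" and r_def: "r = length rho"
    and Q_def: "Q = 2 ^ q" and M_def: "M = 16 * OFF"
    and H64: "64 \<le> H" and HM: "3 * H < M" and inpH: "4 + int n + int r + int q < H"
    and QM: "2 * Q < M" and tau: "0 \<le> \<tau>" "\<tau> < M"
    and MB: "16 * M \<le> 2 ^ B" "B \<ge> 4"
    and small: "\<And>u I. finite I \<Longrightarrow> \<bar>\<Sum>k\<in>I. (if u + k < n then as ! (u + k) else 0)\<bar> < OFF"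
begin

section \<open>Memory regions and frame conditions\<close>

definition wt :: "nat \<Rightarrow> int" where
  "wt i = (if i < n then as ! i else 0)"

definition hash :: "int \<Rightarrow> int" where
  "hash x = (bval rho * x div M) mod Q"

definition cell :: "int \<Rightarrow> int \<Rightarrow> nat" where
  "cell k z = nat (k * M + z)"

definition region :: "int \<Rightarrow> nat set" where
  "region k = {i. k * M \<le> int i \<and> int i < (k + 1) * M}"

definition same :: "nat set \<Rightarrow> mem \<Rightarrow> mem \<Rightarrow> bool" where
  "same X m m' \<longleftrightarrow> (\<forall>i. i \<notin> X \<longrightarrow> m' i = m i)"

definition env :: "mem \<Rightarrow> bool" where
  "env m \<longleftrightarrow> bnd B m \<and> m 0 = int n \<and> m rH = H \<and> m rR = int r \<and> m rT = \<tau> \<and> m rOne = 1 \<and> m rZero = 0 \<and>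
     m rQ = Q \<and> m rM = M \<and> m rOff = OFF \<and>
     (\<forall>i<n. m (nat (H + 4 + int i)) = as ! i) \<and>
     (\<forall>j<r. m (nat (H + 4 + int n + int j)) = of_bool (rho ! j))"

text \<open>Cells that may change without disturbing \<open>env\<close>: the working registers and
  all regions from 1 on. The fixed registers lie below 9 and the copied input lies between 64 and
  \<open>M\<close>.\<close>

definition safe :: "nat set \<Rightarrow> bool" where
  "safe X \<longleftrightarrow> (\<forall>i\<in>X. 9 \<le> i \<and> i < 64 \<or> M \<le> int i)"

lemma Qpos: "1 \<le> Q" and Mpos: "192 < M" and OFFpos: "12 < OFF"
  using Q_def H64 HM M_def by auto

lemma cell_inj:
  assumes "0 \<le> z" "z < M" "0 \<le> z'" "z' < M" "0 \<le> k" "0 \<le> k'"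
  shows "cell k z = cell k' z' \<longleftrightarrow> k = k' \<and> z = z'"
proof
  assume "cell k z = cell k' z'"
  then have e: "k * M + z = k' * M + z'"
    using assms Mpos unfolding cell_def by (subst (asm) eq_nat_nat_iff) auto
  have "(k * M + z) div M = k" "(k' * M + z') div M = k'"
    using assms Mpos by (simp_all add: div_pos_pos_trivial)
  then have "k = k'" using e by simp
  then show "k = k' \<and> z = z'" using e by simp
qed auto

lemma cell_region:
  assumes "0 \<le> z" "z < M" "0 \<le> k"
  shows "cell k z \<in> region k"
proof -
  have "0 \<le> k * M" using assms Mpos by simp
  then show ?thesis using assms unfolding cell_def region_def by (auto simp: algebra_simps)
qed

lemma regionE:
  assumes "i \<in> region k" "0 \<le> k"
  obtains z where "i = cell k z" "0 \<le> z" "z < M"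
proof
  show "i = cell k (int i - k * M)" "0 \<le> int i - k * M" "int i - k * M < M"
    using assms unfolding cell_def region_def by (auto simp: algebra_simps)
qed

lemma cell_in_region_iff:
  assumes "0 \<le> z" "z < M" "0 \<le> k" "0 \<le> k'"
  shows "cell k z \<in> region k' \<longleftrightarrow> k = k'"
  using assms by (metis cell_inj cell_region regionE)

lemma region_disjoint: "0 \<le> k \<Longrightarrow> 0 \<le> k' \<Longrightarrow> k \<noteq> k' \<Longrightarrow> i \<in> region k \<Longrightarrow> i \<notin> region k'"
  by (metis cell_in_region_iff regionE)

lemma region_ge: "i \<in> region k \<Longrightarrow> 1 \<le> k \<Longrightarrow> M \<le> int i"
proof -
  assume a: "i \<in> region k" "1 \<le> k"
  have "1 * M \<le> k * M" using a Mpos by (intro mult_right_mono) auto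
  then show ?thesis using a unfolding region_def by auto
qed

lemma reg_notin_region [simp]: "1 \<le> k \<Longrightarrow> i < 64 \<Longrightarrow> i \<notin> region k"
  using region_ge[of i k] Mpos by auto

lemma same_refl [simp]: "same X m m"
  by (simp add: same_def)

lemma same_trans: "same X m m' \<Longrightarrow> same Y m' m'' \<Longrightarrow> X \<subseteq> Z \<Longrightarrow> Y \<subseteq> Z \<Longrightarrow> same Z m m''"
  unfolding same_def by (metis subsetD)

lemma same_mono: "same X m m' \<Longrightarrow> X \<subseteq> Y \<Longrightarrow> same Y m m'"
  unfolding same_def by blast

lemma sameD: "same X m m' \<Longrightarrow> i \<notin> X \<Longrightarrow> m' i = m i"
  by (simp add: same_def)

lemma safe_Un [simp]: "safe (X \<union> Y) \<longleftrightarrow> safe X \<and> safe Y"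
  unfolding safe_def by blast

lemma safe_empty [simp]: "safe {}"
  by (simp add: safe_def)

lemma safe_insert [simp]: "safe (insert i X) \<longleftrightarrow> (9 \<le> i \<and> i < 64 \<or> M \<le> int i) \<and> safe X"
  by (auto simp: safe_def)

lemma safe_region [simp]: "1 \<le> k \<Longrightarrow> safe (region k)"
  using region_ge unfolding safe_def by blast

lemma env_same:
  assumes "env m" "same X m m'" "safe X" "bnd B m'"
  shows "env m'"
proof -
  have lo: "i \<notin> X" if "i < 9" for i
    using that assms(3) Mpos unfolding safe_def by force
  have mid: "nat (H + x) \<notin> X" if "4 \<le> x" "x < 4 + int n + int r" for x
    using that assms(3) inpH HM H64 unfolding safe_def by force
  have "m' (nat (H + 4 + int i)) = m (nat (H + 4 + int i))" if "i < n" for i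
    using mid[of "4 + int i"] that sameD[OF assms(2)] by (simp add: algebra_simps)
  moreover have "m' (nat (H + 4 + int n + int j)) = m (nat (H + 4 + int n + int j))" if "j < r" for j
    using mid[of "4 + int n + int j"] that sameD[OF assms(2)] by (simp add: algebra_simps)
  moreover have "m' i = m i" if "i < 9" for i using lo that sameD[OF assms(2)] by blast
  ultimately show ?thesis using assms(1,4) unfolding env_def by simp
qed

lemma env_bnd: "env m \<Longrightarrow> bnd B m"
  by (simp add: env_def)

lemma envD:
  assumes "env m"
  shows "m 0 = int n" "m (Suc 0) = H" "m 2 = int r" "m 3 = \<tau>" "m 4 = 1" "m 5 = 0" "m 6 = Q" "m 7 = M" "m 8 = OFF"
  using assms unfolding env_def by auto

lemma env_upd:
  assumes "env m" "9 \<le> i \<and> i < 64 \<or> M \<le> int i" "\<bar>v\<bar> < 2 ^ B"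
  shows "env (m(i := v))"
  by (rule env_same[OF assms(1), of "{i}"]) (use assms env_bnd[OF assms(1)] in \<open>auto simp: same_def intro!: bnd_upd\<close>)

lemma less_2B: "\<bar>x\<bar> < 16 * M \<Longrightarrow> \<bar>x\<bar> < 2 ^ B"
  using MB by linarith

lemma runs_lf: "env m \<Longrightarrow> loopfree c \<Longrightarrow> csz c \<le> 100 \<Longrightarrow> ev c m = m' \<Longrightarrow> csz c \<le> k \<Longrightarrow> runs B c m k m'"
  using runs_loopfree[of c B m] env_bnd MB runs_mono by blast

section \<open>Evaluating the hash by shifting and adding\<close>

lemma ev_norm:
  assumes "m rM = M" "m rQ = Q" "m rOne = 1"
    and "0 \<le> m rY" "m rY < 2 * M" "0 \<le> m rHX" "m rHX + m rY div M < 2 * Q"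
  shows "ev cNorm m rY = m rY mod M \<and> ev cNorm m rHX = (m rHX + m rY div M) mod Q \<and>
         (\<forall>i. i \<notin> {rY, rHX, rA} \<longrightarrow> ev cNorm m i = m i)"
proof -
  have red: "x mod N = x - N \<and> x div N = 1" if "N \<le> x" "x < 2 * N" for x N :: int
  proof -
    have "x = (x - N) + N * 1" by simp
    then have "x div N = 1" "x mod N = x - N"
      using that by (auto intro!: int_div_pos_eq[where r="x - N"] int_mod_pos_eq[where q=1])
    then show ?thesis by simp
  qed
  show ?thesis
  proof (cases "m rY < M")
    case True
    then have Y: "m rY mod M = m rY" "m rY div M = 0" using assms by auto
    show ?thesis
      using assms Y True red[of Q "m rHX"]
      by (cases "m rHX < Q") (auto simp: cNorm_def)
  next
    case False
    then have Y: "m rY mod M = m rY - M" "m rY div M = 1" using assms red[of M "m rY"] by auto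
    show ?thesis
      using assms Y False red[of Q "m rHX + 1"]
      by (cases "m rHX + 1 < Q") (auto simp: cNorm_def algebra_simps)
  qed
qed

text \<open>Residue and hash of \<open>z\<close> determine those of \<open>z + x\<close>: the
  quotient changes by the carry \<open>(z mod M + x) div M\<close>. \<open>mod_div_double\<close> is
  the same for doubling.\<close>

lemma mod_div_add:
  fixes z x :: int
  assumes "0 \<le> x"
  shows "(z mod M + x) mod M = (z + x) mod M"
    and "((z div M) mod Q + (z mod M + x) div M) mod Q = ((z + x) div M) mod Q"
proof -
  show "(z mod M + x) mod M = (z + x) mod M" by (simp add: mod_simps)
  have "(z + x) div M = z div M + (z mod M + x) div M"
  proof -
    have e: "z + x = (z mod M + x) + (z div M) * M" by simp
    have "((z mod M + x) + (z div M) * M) div M = z div M + (z mod M + x) div M"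
      using Mpos by (intro div_mult_self1) simp
    then show ?thesis by (subst e)
  qed
  then show "((z div M) mod Q + (z mod M + x) div M) mod Q = ((z + x) div M) mod Q"
    by (simp add: mod_simps)
qed

lemma mod_div_double:
  fixes z :: int
  shows "(2 * (z mod M)) mod M = (2 * z) mod M"
    and "(2 * ((z div M) mod Q) + (2 * (z mod M)) div M) mod Q = ((2 * z) div M) mod Q"
proof -
  show "(2 * (z mod M)) mod M = (2 * z) mod M" by (simp add: mod_simps)
  have "(2 * z) div M = 2 * (z div M) + (2 * (z mod M)) div M"
  proof -
    have e: "2 * z = 2 * (z mod M) + 2 * (z div M) * M" using mod_div_mult_eq[of z M] by linarith
    have "(2 * (z mod M) + 2 * (z div M) * M) div M = 2 * (z div M) + (2 * (z mod M)) div M"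
      using Mpos by (intro div_mult_self1) simp
    then show ?thesis by (subst e)
  qed
  then show "(2 * ((z div M) mod Q) + (2 * (z mod M)) div M) mod Q = ((2 * z) div M) mod Q"
    by (metis mod_add_left_eq mod_mult_right_eq)
qed

lemma div_less_2: "0 \<le> y \<Longrightarrow> y < 2 * M \<Longrightarrow> y div M \<le> 1"
proof -
  assume "0 \<le> y" "y < 2 * M"
  then have "(y div M) * M < 2 * M"
    using mod_div_mult_eq[of y M] pos_mod_sign[of M y] Mpos by linarith
  then have "y div M < 2" using Mpos by (simp add: mult_less_cancel_right)
  then show ?thesis by simp
qed

definition hashes :: "mem \<Rightarrow> int \<Rightarrow> bool" where
  "hashes m z \<longleftrightarrow> m rY = z mod M \<and> m rHX = (z div M) mod Q"

lemma hashes_double: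
  assumes "env m" "hashes m z"
  shows "hashes (ev (Add rY rY rY ;; Add rHX rHX rHX ;; cNorm) m) (2 * z) \<and>
     same {rY, rHX, rA} m (ev (Add rY rY rY ;; Add rHX rHX rHX ;; cNorm) m)"
proof -
  let ?m = "m(rY := 2 * m rY, rHX := 2 * m rHX)"
  have r: "0 \<le> z mod M" "z mod M < M" "0 \<le> (z div M) mod Q" "(z div M) mod Q < Q"
    using Mpos Qpos by auto
  have "(2 * (z mod M)) div M \<le> 1" using div_less_2 r by auto
  then have "2 * ((z div M) mod Q) + (2 * (z mod M)) div M < 2 * Q" using r by linarith
  then have "ev cNorm ?m rY = ?m rY mod M \<and> ev cNorm ?m rHX = (?m rHX + ?m rY div M) mod Q \<and>
         (\<forall>i. i \<notin> {rY, rHX, rA} \<longrightarrow> ev cNorm ?m i = ?m i)"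
    using assms r by (intro ev_norm) (auto simp: envD hashes_def)
  moreover have "ev (Add rY rY rY ;; Add rHX rHX rHX ;; cNorm) m = ev cNorm ?m"
    by (simp flip: mult_2)
  ultimately show ?thesis using assms(2)
    by (simp add: hashes_def mod_div_double same_def)
qed

lemma hashes_add:
  assumes "env m" "hashes m z" "m rX = x" "0 \<le> x" "x < M"
  shows "hashes (ev (Add rY rY rX ;; cNorm) m) (z + x) \<and>
     same {rY, rHX, rA} m (ev (Add rY rY rX ;; cNorm) m)"
proof -
  let ?m = "m(rY := m rY + x)"
  have r: "0 \<le> z mod M" "z mod M < M" "0 \<le> (z div M) mod Q" "(z div M) mod Q < Q"
    using Mpos Qpos by auto
  have "z mod M + x < 2 * M" using r assms by linarith
  have "(z mod M + x) div M \<le> 1" using div_less_2[of "z mod M + x"] r assms by linarith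
  then have "(z div M) mod Q + (z mod M + x) div M < 2 * Q" using r by linarith
  then have "ev cNorm ?m rY = ?m rY mod M \<and> ev cNorm ?m rHX = (?m rHX + ?m rY div M) mod Q \<and>
         (\<forall>i. i \<notin> {rY, rHX, rA} \<longrightarrow> ev cNorm ?m i = ?m i)"
    using assms r \<open>z mod M + x < 2 * M\<close> by (intro ev_norm) (auto simp: envD hashes_def)
  moreover have "ev (Add rY rY rX ;; cNorm) m = ev cNorm ?m"
    using assms by simp
  ultimately show ?thesis using assms(2) mod_div_add[OF assms(4)]
    by (simp add: hashes_def same_def)
qed

lemma hash_body:
  assumes "env m" "hashes m (bval (take j rho) * x)" "m rX = x" "0 \<le> x" "x < M"
    "m rCnt = H + 4 + int n + int j" "m rB = int (r - j)" "j < r"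
  shows "hashes (ev cHashBody m) (bval (take (Suc j) rho) * x) \<and>
     same {rY, rHX, rA, rCnt, rB} m (ev cHashBody m) \<and>
     ev cHashBody m rA = 0 \<and> ev cHashBody m rCnt = H + 4 + int n + int (Suc j) \<and> ev cHashBody m rB = int (r - Suc j)"
proof -
  let ?z = "bval (take j rho) * x"
  define m1 where "m1 = ev (Add rY rY rY ;; Add rHX rHX rHX ;; cNorm) m"
  have m1: "hashes m1 (2 * ?z)" "same {rY, rHX, rA} m m1"
    using hashes_double[OF assms(1,2)] unfolding m1_def by auto
  define b where "b = rho ! j"
  have a64: "nat (H + 4 + int n + int j) \<ge> 64" using H64 by linarith
  have "m1 (nat (m1 rCnt)) = m (nat (H + 4 + int n + int j))"
    using m1(2) assms H64 a64 by (auto simp: same_def)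
  also have "\<dots> = of_bool b" using assms(1,8) by (simp add: env_def b_def)
  finally have ld: "m1 (nat (m1 rCnt)) = of_bool b" .
  define m2 where "m2 = m1(rA := of_bool b)"
  have m2: "hashes m2 (2 * ?z)" "same {rY, rHX, rA} m m2"
    using m1 by (auto simp: m2_def hashes_def same_def)
  have r: "0 \<le> w mod M" "w mod M < M" "0 \<le> (w div M) mod Q" "(w div M) mod Q < Q" for w
    using Mpos Qpos by auto
  have "\<bar>m2 i\<bar> < 2 ^ B" for i
  proof (cases "i \<in> {rY, rHX, rA}")
    case True
    have "\<bar>m2 i\<bar> < M"
      using True m2(1) r[of "2 * ?z"] Mpos QM by (auto simp: hashes_def m2_def)
    then show ?thesis using less_2B[of "m2 i"] Mpos by linarith
  next
    case False
    then show ?thesis using bndD[OF env_bnd[OF assms(1)], of i] m2(2) by (simp add: same_def)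
  qed
  then have "bnd B m2" by (simp add: bnd_def)
  then have e2: "env m2" using env_same[OF assms(1) m2(2)] by simp
  define m3 where "m3 = (if b then ev (Add rY rY rX ;; cNorm) m2 else m2(rA := 0))"
  have tk: "bval (take (Suc j) rho) * x = 2 * ?z + (if b then x else 0)"
    using assms(8) r_def by (simp add: take_Suc_conv_app_nth b_def algebra_simps)
  have "m2 rX = x" using m2(2) assms(3) by (simp add: same_def)
  then have m3: "hashes m3 (bval (take (Suc j) rho) * x)" "same {rY, rHX, rA} m m3"
    using hashes_add[OF e2 m2(1)] m2 assms unfolding tk m3_def
    by (auto simp: same_def hashes_def)
  have "ev cHashBody m = m3(rCnt := m3 rCnt + m3 rOne, rB := m3 rB - m3 rOne, rA := 0)"
    using ld unfolding cHashBody_def m3_def m2_def by (simp add: m1_def)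
  moreover have "m3 rCnt = m rCnt" "m3 rOne = 1" "m3 rB = m rB"
    using m3(2) assms(1) by (auto simp: same_def envD)
  ultimately show ?thesis using m3 assms by (auto simp: same_def hashes_def)
qed

lemma loopfree_hash: "loopfree cHashBody" "csz cHashBody \<le> 30"
  by (simp_all add: cHashBody_def cNorm_def)

lemma hash_runs:
  assumes "env m" "m rX = x" "0 \<le> x" "x < M"
  shows "\<exists>m'. runs B cHash m (31 * r + 7) m' \<and> env m' \<and> m' rHX = hash x \<and> same {rY, rHX, rA, rCnt, rB} m m'"
proof -
  let ?X = "{rY, rHX, rA, rCnt, rB}"
  define m0 where "m0 = m(rHX := 0, rY := 0, rCnt := H + int n + 4, rA := 4, rB := int r)"
  have small: "\<bar>v\<bar> < 2 ^ B" if "0 \<le> v" "v < M" for v using less_2B[of v] that Mpos by simp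
  have e0: "env m0" unfolding m0_def
    using assms(1) inpH HM H64 Mpos by (intro env_upd small) auto
  have r1: "runs B (Const rHX 0 ;; Const rY 0 ;; Add rCnt rH 0 ;; Const rA 4 ;; Add rCnt rCnt rA ;; Mov rB rR) m 6 m0"
    using assms(1) by (intro runs_lf) (auto simp: m0_def envD fun_eq_iff)
  let ?I = "\<lambda>j m'. env m' \<and> same ?X m m' \<and> hashes m' (bval (take j rho) * x) \<and>
       m' rCnt = H + 4 + int n + int j \<and> m' rB = int (r - j)"
  have "\<exists>m'. runs B (While rB cHashBody) m0 ((30 + 1) * r + 1) m' \<and> ?I r m'"
  proof (rule runs_count_loop[where I="?I"])
    fix j m1 assume I: "?I j m1" and jr: "j < r"
    then have eI: "env m1" and X: "m1 rX = x" using assms(2) by (auto simp: same_def)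
    define m2 where "m2 = ev cHashBody m1"
    have m2: "hashes m2 (bval (take (Suc j) rho) * x)" "same ?X m1 m2"
      "m2 rA = 0" "m2 rCnt = H + 4 + int n + int (Suc j)" "m2 rB = int (r - Suc j)"
      using hash_body[of m1 j x] I X jr assms unfolding m2_def by auto
    have zM: "0 \<le> z mod M" "z mod M < M" for z using Mpos by auto
    have zQ: "0 \<le> z mod Q" "z mod Q < M" for z
      using Qpos QM pos_mod_sign[of Q z] pos_mod_bound[of Q z] by linarith+
    have "\<bar>m2 i\<bar> < 2 ^ B" for i
    proof (cases "i \<in> {rY, rHX, rCnt, rB}")
      case True
      have v: "m2 rY = (bval (take (Suc j) rho) * x) mod M"
        "m2 rHX = (bval (take (Suc j) rho) * x div M) mod Q"
        using m2(1) unfolding hashes_def by auto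
      have "0 \<le> m2 rY" "m2 rY < M" "0 \<le> m2 rHX" "m2 rHX < M" unfolding v by (rule zM zQ)+
      moreover have "0 \<le> m2 rCnt" "m2 rCnt < M" "0 \<le> m2 rB" "m2 rB < M"
        unfolding m2(4,5) using jr inpH HM H64 by linarith+
      ultimately have "\<bar>m2 i\<bar> < M" using True by auto
      then show ?thesis using less_2B[of "m2 i"] Mpos by linarith
    next
      case False
      then show ?thesis using bndD[OF env_bnd[OF eI], of i] m2(2) \<open>m2 rA = 0\<close>
        by (cases "i = rA") (auto simp: same_def)
    qed
    then have "env m2" using m2(2) by (intro env_same[OF eI]) (auto simp: bnd_def)
    moreover have "same ?X m m2" using I m2(2) by (auto simp: same_def)
    moreover have "runs B cHashBody m1 30 m2"
      using loopfree_hash by (intro runs_lf[OF eI]) (auto simp: m2_def)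
    ultimately show "\<exists>m2. runs B cHashBody m1 30 m2 \<and> ?I (Suc j) m2" using m2 by blast
  next
    show "?I 0 m0" using e0 by (auto simp: m0_def same_def hashes_def)
  qed (use MB env_bnd in auto)
  then obtain m' where l: "runs B (While rB cHashBody) m0 ((30 + 1) * r + 1) m'" "?I r m'" by blast
  have "m' rHX = hash x" using l(2) r_def by (simp add: hashes_def hash_def)
  moreover have "runs B cHash m (31 * r + 7) m'"
    unfolding cHash_def using runs_mono[OF runs_seq[OF r1 l(1)]] by simp
  ultimately show ?thesis using l(2) by blast
qed

end

section \<open>Bucket tables\<close>

text \<open>All keys are positive, so 0 can end a list. The \<open>- 1\<close> undoes the shift by
  which successors are stored: the last element of a bucket stores 1, which still marks it as a
  member.\<close>

fun chain :: "(int \<Rightarrow> int) \<Rightarrow> int \<Rightarrow> int list \<Rightarrow> bool" where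
  "chain nx p [] \<longleftrightarrow> p = 0"
| "chain nx p (y # ys) \<longleftrightarrow> p = y \<and> chain nx (nx y - 1) ys"

lemma chain_cong: "(\<And>y. y \<in> set ys \<Longrightarrow> nx y = nx' y) \<Longrightarrow> chain nx p ys = chain nx' p ys"
  by (induction ys arbitrary: p) auto

context verifier
begin

text \<open>A cell of region \<open>nb\<close> holds the successor plus one, so that a positive value marks membership.\<close>

definition tab :: "mem \<Rightarrow> int \<Rightarrow> int \<Rightarrow> int list \<Rightarrow> bool" where
  "tab m hb nb ys \<longleftrightarrow> distinct ys \<and> (\<forall>y\<in>set ys. 0 < y \<and> y < 2 * OFF) \<and>
     (\<forall>y. 0 \<le> y \<and> y < M \<longrightarrow> (m (cell nb y) > 0 \<longleftrightarrow> y \<in> set ys)) \<and>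
     (\<forall>k. 0 \<le> k \<and> k < Q \<longrightarrow> chain (\<lambda>y. m (cell nb y)) (m (cell hb k)) (filter (\<lambda>y. hash y = k) ys))"

lemma hash_range: "0 \<le> hash x" "hash x < Q"
  using Qpos unfolding hash_def by auto

lemma OFF_M: "2 * OFF < M"
  using M_def OFFpos by auto

lemma tab_empty:
  assumes "\<And>i. i \<in> region hb \<union> region nb \<Longrightarrow> m i = 0" "0 \<le> hb" "0 \<le> nb"
  shows "tab m hb nb []"
  using assms cell_region QM Qpos unfolding tab_def by auto

lemma tab_same:
  assumes "tab m hb nb ys" "same X m m'" "X \<inter> (region hb \<union> region nb) = {}" "0 \<le> hb" "0 \<le> nb"
  shows "tab m' hb nb ys"
proof -
  have e: "m' (cell k z) = m (cell k z)" if "0 \<le> z" "z < M" "k = hb \<or> k = nb" for k z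
    using assms cell_region[of z k] that by (intro sameD[OF assms(2)]) auto
  have "chain (\<lambda>y. m' (cell nb y)) p (filter P ys) = chain (\<lambda>y. m (cell nb y)) p (filter P ys)" for p P
    using assms(1) OFF_M by (intro chain_cong e) (auto simp: tab_def intro: order.strict_trans)
  then show ?thesis using assms(1) e QM Qpos unfolding tab_def by auto
qed

lemma tab_head:
  assumes "tab m hb nb ys" "0 \<le> k" "k < Q"
  shows "0 \<le> m (cell hb k)" "m (cell hb k) < 2 * OFF"
proof -
  have c: "chain (\<lambda>y. m (cell nb y)) (m (cell hb k)) (filter (\<lambda>y. hash y = k) ys)"
    and r: "\<And>y. y \<in> set ys \<Longrightarrow> 0 < y \<and> y < 2 * OFF"
    using assms unfolding tab_def by blast+
  have "0 \<le> m (cell hb k) \<and> m (cell hb k) < 2 * OFF"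
  proof (cases "filter (\<lambda>y. hash y = k) ys")
    case Nil
    then show ?thesis using c OFFpos by simp
  next
    case (Cons y l)
    then have "y \<in> set ys" by (metis filter_is_subset list.set_intros(1) subsetD)
    then show ?thesis using c r Cons by fastforce
  qed
  then show "0 \<le> m (cell hb k)" "m (cell hb k) < 2 * OFF" by auto
qed

lemma tab_insert:
  assumes t: "tab m hb nb ys" and x: "0 < x" "x < 2 * OFF" "x \<notin> set ys"
    and k: "0 \<le> hb" "0 \<le> nb" "hb \<noteq> nb"
    and m': "\<And>y. 0 \<le> y \<Longrightarrow> y < M \<Longrightarrow> m' (cell nb y) = (if y = x then m (cell hb (hash x)) + 1 else m (cell nb y))"
      "\<And>y. 0 \<le> y \<Longrightarrow> y < M \<Longrightarrow> m' (cell hb y) = (if y = hash x then x else m (cell hb y))"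
  shows "tab m' hb nb (x # ys)"
proof -
  have h: "hash x < M" using hash_range[of x] QM by auto
  have ch: "chain (\<lambda>y. m (cell nb y)) (m (cell hb k)) (filter (\<lambda>y. hash y = k) ys)"
    if "0 \<le> k" "k < Q" for k using t that unfolding tab_def by auto
  have "0 \<le> m (cell hb (hash x))" using tab_head(1)[OF t] hash_range[of x] by auto
  moreover have "chain (\<lambda>y. m' (cell nb y)) p (filter P ys) = chain (\<lambda>y. m (cell nb y)) p (filter P ys)" for p P
    using t x OFF_M by (intro chain_cong) (auto simp: tab_def m'(1))
  moreover have "k < M" if "k < Q" for k using that QM Qpos by auto
  ultimately show ?thesis
    using t x OFF_M ch m' hash_range[of x] unfolding tab_def by auto
qed

lemma cell_nat: "nat (k * M + z) = cell k z" "nat (z + k * M) = cell k z"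
  by (simp_all add: cell_def add.commute)

lemma cell_64:
  assumes "1 \<le> k" "0 \<le> z"
  shows "64 \<le> cell k z" "M \<le> int (cell k z)"
proof -
  have "1 * M \<le> k * M" using assms Mpos by (intro mult_right_mono) auto
  then show "64 \<le> cell k z" "M \<le> int (cell k z)" using assms Mpos unfolding cell_def by linarith+
qed

lemma cell_ne_reg [simp]:
  assumes "1 \<le> k" "0 \<le> z" "i < 64"
  shows "cell k z \<noteq> i" "i \<noteq> cell k z"
  using cell_64[OF assms(1,2)] assms(3) by auto

lemma small_reg: "0 \<le> v \<Longrightarrow> v < 16 * M \<Longrightarrow> \<bar>v\<bar> < 2 ^ B"
  using less_2B[of v] by simp

lemma base_bound:
  assumes "0 \<le> k" "k \<le> 14" "0 \<le> z" "z < M"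
  shows "0 \<le> k * M + z" "k * M + z < 16 * M"
proof -
  have "k * M \<le> 14 * M" "0 \<le> k * M" using assms Mpos by (auto intro: mult_right_mono)
  then show "0 \<le> k * M + z" "k * M + z < 16 * M" using assms by linarith+
qed

lemma insert_runs:
  assumes e: "env m" and X: "m rX = x" "0 < x" "x < 2 * OFF"
    and t: "tab m hb nb ys" and k: "1 \<le> hb" "1 \<le> nb" "hb \<noteq> nb" "hb \<le> 14" "nb \<le> 14"
    and b: "m rBH = hb * M" "m rBN = nb * M"
  shows "\<exists>m'. runs B cInsert m (31 * r + 20) m' \<and> env m' \<and>
     tab m' hb nb (if x \<in> set ys then ys else x # ys) \<and>
     same ({rY, rHX, rA, rCnt, rB} \<union> (region hb \<union> region nb)) m m'"
proof -
  let ?X = "{rY, rHX, rA, rCnt, rB}"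
  let ?c = "Add rA rBN rX ;; Load rB rA ;;
      If rB Skip (Add rCnt rBH rHX ;; Load rB rCnt ;; Add rB rB rOne ;; Store rA rB ;; Store rCnt rX)"
  have xM: "x < M" using X OFF_M by simp
  obtain m1 where m1: "runs B cHash m (31 * r + 7) m1" "env m1" "m1 rHX = hash x" "same ?X m m1"
    using hash_runs[OF e X(1)] X xM by auto
  have t1: "tab m1 hb nb ys"
    using t m1(4) k by (rule_tac tab_same) auto
  have reg: "m1 rX = x" "m1 rBH = hb * M" "m1 rBN = nb * M" "m1 rOne = 1"
    using m1(4) X b envD[OF m1(2)] by (auto simp: same_def)
  have hM: "hash x < M" using hash_range[of x] QM by linarith
  have fin: ?thesis if "runs B ?c m1 13 m2" "env m2"
    "tab m2 hb nb (if x \<in> set ys then ys else x # ys)"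
    "same (?X \<union> (region hb \<union> region nb)) m1 m2" for m2
  proof (intro exI conjI)
    show "runs B cInsert m (31 * r + 20) m2"
      unfolding cInsert_def using runs_mono[OF runs_seq[OF m1(1) that(1)]] by simp
    show "same (?X \<union> (region hb \<union> region nb)) m m2"
      by (rule same_trans[OF m1(4) that(4)]) auto
  qed (use that in auto)
  show ?thesis
  proof (cases "x \<in> set ys")
    case True
    then have pos: "m1 (cell nb x) > 0" using t1 X xM unfolding tab_def by auto
    let ?m2 = "m1(rA := 0, rB := m1 (cell nb x))"
    have "env ?m2"
      using m1(2) bndD[OF env_bnd[OF m1(2)]] by (intro env_upd) (auto intro: small_reg)
    moreover have "same ?X m1 ?m2" by (auto simp: same_def)
    moreover have "tab ?m2 hb nb ys"
      using k by (intro tab_same[OF t1 \<open>same ?X m1 ?m2\<close>]) auto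
    moreover have "ev ?c m1 = ?m2"
      using reg pos k X by (auto simp: cell_nat)
    moreover have "same (?X \<union> (region hb \<union> region nb)) m1 ?m2" by (auto simp: same_def)
    ultimately show ?thesis using True
      by (intro fin[of ?m2] runs_lf[OF m1(2)]) simp_all
  next
    case False
    then have npos: "\<not> m1 (cell nb x) > 0" using t1 X xM unfolding tab_def by auto
    define hd0 where "hd0 = m1 (cell hb (hash x))"
    have hd0: "0 \<le> hd0" "hd0 < 2 * OFF" unfolding hd0_def using tab_head[OF t1] hash_range[of x] by auto
    let ?m2 = "m1(rA := nb * M + x, rCnt := hb * M + hash x, rB := hd0 + 1,
       cell nb x := hd0 + 1, cell hb (hash x) := x)"
    have bs: "0 \<le> nb * M + x" "nb * M + x < 16 * M" "0 \<le> hb * M + hash x" "hb * M + hash x < 16 * M"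
      using base_bound k X xM hM hash_range[of x] by auto
    have "env ?m2"
      using m1(2) hd0 OFF_M bs X xM k Mpos hash_range[of x] cell_64[of nb x] cell_64[of hb "hash x"]
      by (intro env_upd small_reg) auto
    moreover have "same (?X \<union> (region hb \<union> region nb)) m1 ?m2"
      using k X xM hM hash_range[of x] cell_region[of x nb] cell_region[of "hash x" hb]
      by (auto simp: same_def)
    moreover have "tab ?m2 hb nb (x # ys)"
      using k X xM hM hash_range[of x] False
      by (intro tab_insert[OF t1]) (auto simp: cell_inj hd0_def)
    moreover have "ev ?c m1 = ?m2"
    proof -
      obtain a1 a2 where a: "a1 = cell nb x" "a2 = cell hb (hash x)" by blast
      have "64 \<le> a1" "64 \<le> a2" "a2 \<noteq> a1"
        using cell_64[of nb x] cell_64[of hb "hash x"] cell_inj[of x "hash x" nb hb]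
          k X xM hM hash_range[of x] unfolding a by auto
      moreover have "nat (nb * M + x) = a1" "nat (hb * M + hash x) = a2" by (simp_all add: a cell_nat)
      ultimately show ?thesis
        using reg npos m1(3) unfolding hd0_def a(1,2)[symmetric] by (simp add: fun_upd_twist)
    qed
    ultimately show ?thesis using False
      by (intro fin[of ?m2] runs_lf[OF m1(2)]) simp_all
  qed
qed

end

section \<open>Enumerating the subset sums of a block\<close>

definition cFill :: com where
  "cFill = Add rA rM rSI ;; Load rA rA ;; Add rA rA rW ;; Add rB rM rD ;; Store rB rA ;;
     Add rD rD rOne ;; Add rSI rSI rOne ;; Sub rCnt rCnt rOne"

lemma ev_fill:
  assumes "m1 rM = M" "m1 rD = d" "m1 rOne = 1" "m1 rCnt = x" "m1 rSI = s" "m1 rW = w" "g + w = v"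
    and "nat (M + d) = a" "nat (M + s) = b" "m1 b = g" "64 \<le> a" "64 \<le> b"
  shows "ev cFill m1 = m1(rA := v, rB := M + d, a := v, rD := d + 1, rSI := s + 1, rCnt := x - 1)"
proof -
  have "a \<noteq> rOne" "a \<noteq> rD" "a \<noteq> rSI" "a \<noteq> rCnt" "a \<noteq> rA" "a \<noteq> rB" "b \<noteq> rA" using assms by auto
  then show ?thesis using assms(1-10) unfolding cFill_def by simp
qed

definition cSel :: com where
  "cSel = If rA Skip (Mov rPW rD ;; Const rSI 0 ;;
       If rRem (Load rW rWP ;; Sub rRem rRem rOne ;; Add rWP rWP rOne) (Const rW 0))"

lemma ev_gen_body: "ev cGenBody m = ev cFill (ev cSel (m(rA := m rPW - m rSI)))"
proof -
  have "cGenBody = Sub rA rPW rSI ;; cSel ;; cFill"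
    by (simp only: cGenBody_def cSel_def cFill_def)
  then have "ev cGenBody m = ev (Sub rA rPW rSI ;; cSel ;; cFill) m" by (rule arg_cong)
  then show ?thesis by (simp only: ev.simps(3,6))
qed

context verifier
begin

text \<open>The binary digits of \<open>i\<close> select integers from position \<open>u\<close> on.
  The shift makes each sum a positive key below \<open>2 * OFF\<close>.\<close>

definition gsum :: "nat \<Rightarrow> nat \<Rightarrow> int" where
  "gsum u i = OFF + (\<Sum>k\<in>set_decode i. wt (u + k))"

lemma gsum_range: "0 < gsum u i" "gsum u i < 2 * OFF"
  using small[OF finite_set_decode, of u i] unfolding gsum_def wt_def by auto

lemma wt_bound: "\<bar>wt i\<bar> < OFF"
  using small[of "{i}" 0] unfolding wt_def by (cases "i < n") auto

lemma gsum_0 [simp]: "gsum u 0 = OFF"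
  by (simp add: gsum_def)

text \<open>Adding \<open>2 ^ p\<close> sets the free bit \<open>p\<close>. Hence one new weight
  doubles a table of \<open>2 ^ p\<close> entries.\<close>

lemma gsum_add:
  assumes "S < 2 ^ p"
  shows "gsum u (2 ^ p + S) = gsum u S + wt (u + p)"
proof -
  have p: "p \<notin> set_decode S" using assms by (simp add: set_decode_def)
  then show ?thesis
    by (simp add: gsum_def set_decode_plus_power_2)
qed

text \<open>\<open>\<kappa>\<close> counts the weights loaded and \<open>D\<close> the entries
  filled. At the start \<open>\<kappa> = 0\<close> and \<open>D = 1\<close>; the division then gives
  \<open>rPW = 0\<close> and \<open>rSI = 1\<close>, so the loop regards a half as complete and
  loads the first weight.\<close>

definition gstate :: "nat \<Rightarrow> nat \<Rightarrow> nat \<Rightarrow> mem \<Rightarrow> bool" where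
  "gstate u \<kappa> D m \<longleftrightarrow> 2 ^ \<kappa> div 2 < D \<and> D \<le> 2 ^ \<kappa> \<and> D \<le> 2 * 2 ^ q \<and> m rD = int D \<and> m rPW = int (2 ^ \<kappa> div 2) \<and>
     m rSI = int D - int (2 ^ \<kappa> div 2) \<and> (0 < \<kappa> \<longrightarrow> m rW = wt (u + \<kappa> - 1)) \<and>
     m rWP = H + 4 + int (min (u + \<kappa>) n) \<and> m rRem = int (n - (u + \<kappa>)) \<and>
     m rCnt = 2 * Q - int D \<and> (\<forall>i<D. m (cell 1 (int i)) = gsum u i)"

abbreviation genX :: "nat set" where
  "genX \<equiv> {rA, rB, rCnt, rWP, rRem, rD, rPW, rSI, rW} \<union> region 1"

text \<open>At \<open>D = 2 ^ \<kappa>\<close> the current half is exhausted and the next weight is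
  loaded; otherwise copying goes on with \<open>\<kappa> = Suc p\<close>. Either way entry
  \<open>D\<close> is obtained from entry \<open>D - 2 ^ p\<close>.\<close>

lemma gen_sel:
  assumes e: "env m" and g: "gstate u \<kappa> D m"
  defines "m1 \<equiv> ev cSel (m(rA := m rPW - m rSI))"
  shows "\<exists>p. (if D = 2 ^ \<kappa> then p = \<kappa> else \<kappa> = Suc p) \<and> 2 ^ p \<le> D \<and> D < 2 * 2 ^ p \<and> m1 rPW = 2 ^ p \<and>
    m1 rSI = int D - 2 ^ p \<and> m1 rW = wt (u + p) \<and> m1 rWP = H + 4 + int (min (u + Suc p) n) \<and>
    m1 rRem = int (n - (u + Suc p)) \<and> same {rA, rPW, rSI, rW, rWP, rRem} m m1"
proof (cases "D = 2 ^ \<kappa>")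
  case True
  have neg: "\<not> m rPW - m rSI > 0"
    using g True unfolding gstate_def by (cases \<kappa>) auto
  show ?thesis
  proof (cases "u + \<kappa> < n")
    case less: True
    have ld: "m (nat (H + 4 + int (u + \<kappa>))) = wt (u + \<kappa>)"
      using e less unfolding env_def wt_def by auto
    have "64 \<le> nat (H + 4 + int (u + \<kappa>))" using H64 by linarith
    then show ?thesis
      using True less neg g envD[OF e] ld unfolding m1_def cSel_def gstate_def
      by (intro exI[of _ \<kappa>]) (auto simp: same_def)
  next
    case False
    then show ?thesis
      using True neg g envD[OF e] unfolding m1_def cSel_def gstate_def
      by (intro exI[of _ \<kappa>]) (auto simp: same_def wt_def)
  qed
next
  case False
  then obtain p where p: "\<kappa> = Suc p" using g unfolding gstate_def by (cases \<kappa>) auto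
  have "D < 2 ^ Suc p" using g False unfolding gstate_def p by auto
  then have "int D < int (2 ^ Suc p)" by (simp only: of_nat_less_iff)
  then have pos: "m rPW - m rSI > 0" using g unfolding gstate_def p by auto
  show ?thesis using g False pos unfolding m1_def cSel_def gstate_def p
    by (intro exI[of _ p]) (auto simp: same_def)
qed

lemma gen_body:
  assumes e: "env m" and g: "gstate u \<kappa> D m" and D: "D < 2 * 2 ^ q"
  shows "\<exists>\<kappa>'. gstate u \<kappa>' (Suc D) (ev cGenBody m) \<and> env (ev cGenBody m) \<and> same genX m (ev cGenBody m)"
proof -
  define m1 where "m1 = ev cSel (m(rA := m rPW - m rSI))"
  obtain p where p: "2 ^ p \<le> D" "D < 2 * 2 ^ p" "m1 rPW = 2 ^ p"
    "m1 rSI = int D - 2 ^ p" "m1 rW = wt (u + p)" "m1 rWP = H + 4 + int (min (u + Suc p) n)"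
    "m1 rRem = int (n - (u + Suc p))" and s1: "same {rA, rPW, rSI, rW, rWP, rRem} m m1"
    using gen_sel[OF e g] unfolding m1_def by auto
  define S where "S = D - 2 ^ p"
  have S: "D = 2 ^ p + S" "S < 2 ^ p" "S < D" using p(1,2) by (auto simp: S_def)
  have DM: "int D < M"
  proof -
    have "int D < int (2 * 2 ^ q)" using D by (simp only: of_nat_less_iff)
    then show ?thesis using QM Q_def by simp
  qed
  have SI: "m1 rSI = int S" using p(4) S by simp
  have reg: "m1 rM = M" "m1 rD = int D" "m1 rOne = 1" "m1 rCnt = 2 * Q - int D"
    using s1 g envD[OF e] by (auto simp: same_def gstate_def)
  have arr: "m1 (cell 1 (int i)) = gsum u i" if "i < D" for i
    using that g s1 unfolding gstate_def same_def by auto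
  define v where "v = gsum u D"
  have v: "gsum u S + wt (u + p) = v" unfolding v_def S(1) using gsum_add S(2) by simp
  have vr: "0 < v" "v < 2 * OFF" unfolding v_def by (rule gsum_range)+
  let ?m2 = "m1(rA := v, rB := M + int D, cell 1 (int D) := v, rD := int D + 1, rSI := int S + 1, rCnt := 2 * Q - int D - 1)"
  have e2: "ev cGenBody m = ?m2"
  proof -
    have c: "nat (M + int i) = cell 1 (int i)" for i using cell_nat(1)[of 1 "int i"] by simp
    have "ev cFill m1 = ?m2"
      using arr[OF S(3)] SI p(5) v cell_64[of 1 "int D"] cell_64[of 1 "int S"]
      by (intro ev_fill[where b="cell 1 (int S)" and g="gsum u S"] reg c) auto
    then show ?thesis unfolding ev_gen_body m1_def .
  qed
  have s2: "same genX m ?m2"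
    using s1 cell_region[of "int D" 1] DM unfolding same_def by auto
  have pD: "2 ^ p \<le> int D" using p(1) by (metis of_nat_le_iff of_nat_numeral of_nat_power)
  have "\<bar>?m2 i\<bar> < 2 ^ B" for i
  proof -
    have "\<bar>m1 i\<bar> < 2 ^ B" if "i \<noteq> rA"
    proof (cases "i \<in> {rPW, rSI, rW, rWP, rRem}")
      case True
      have "m1 rPW \<le> int D" unfolding p(3) by (rule pD)
      moreover have "0 \<le> m1 rPW" unfolding p(3) by simp
      ultimately have "\<bar>m1 rPW\<bar> < M" "\<bar>m1 rSI\<bar> < M" using SI S(3) DM by linarith+
      moreover have "\<bar>m1 rW\<bar> < M" "\<bar>m1 rWP\<bar> < M" "\<bar>m1 rRem\<bar> < M"
        using p(5-7) wt_bound[of "u + p"] OFF_M inpH HM H64 by auto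
      ultimately have "\<bar>m1 rPW\<bar> < M" "\<bar>m1 rSI\<bar> < M" "\<bar>m1 rW\<bar> < M" "\<bar>m1 rWP\<bar> < M" "\<bar>m1 rRem\<bar> < M"
        by blast+
      then have "\<bar>m1 i\<bar> < M" using True by auto
      then show ?thesis using less_2B[of "m1 i"] Mpos by linarith
    next
      case False
      then have "m1 i = m i" using s1 that by (auto simp: same_def)
      then show ?thesis using bndD[OF env_bnd[OF e]] by simp
    qed
    moreover have "\<bar>v\<bar> < 2 ^ B" "\<bar>M + int D\<bar> < 2 ^ B" "\<bar>int D + 1\<bar> < 2 ^ B" "\<bar>int S + 1\<bar> < 2 ^ B"
      "\<bar>2 * Q - int D - 1\<bar> < 2 ^ B"
      using vr OFF_M DM S(3) QM Qpos Mpos by (intro less_2B; linarith)+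
    ultimately show ?thesis by auto
  qed
  then have env2: "env ?m2" using s2 by (intro env_same[OF e s2]) (auto simp: bnd_def)
  have "gstate u (Suc p) (Suc D) ?m2"
  proof -
    have "m1 (cell 1 (int i)) = gsum u i" if "i < Suc D" "i \<noteq> D" for i using arr that by auto
    moreover have "cell 1 (int i) = cell 1 (int D) \<longleftrightarrow> i = D" if "i < Suc D" for i
      using cell_inj[of "int i" "int D" 1 1] that DM by auto
    ultimately have "?m2 (cell 1 (int i)) = gsum u i" if "i < Suc D" for i
      using that by (auto simp: v_def)
    moreover have "int S + 1 = int (Suc D) - 2 ^ p" using S by simp
    ultimately show ?thesis
      using p S D reg unfolding gstate_def by simp
  qed
  then show ?thesis using e2 env2 s2 by auto
qed

lemma loopfree_gen: "loopfree cGenBody" "csz cGenBody \<le> 25"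
  by (simp_all add: cGenBody_def)

lemma gen_runs:
  assumes e: "env m" and w: "m rWP = H + 4 + int (min u n)" "m rRem = int (n - u)"
  shows "\<exists>m'. runs B cGen m (60 * 2 ^ q + 10) m' \<and> env m' \<and> same genX m m' \<and>
     m' rWP = H + 4 + int (min (u + q + 1) n) \<and> m' rRem = int (n - (u + q + 1)) \<and>
     (\<forall>i<2 * 2 ^ q. m' (cell 1 (int i)) = gsum u i)"
proof -
  let ?pre = "Store rM rOff ;; Mov rD rOne ;; Const rPW 0 ;; Mov rSI rOne ;; Add rCnt rQ rQ ;; Sub rCnt rCnt rD"
  let ?m0 = "m(cell 1 0 := OFF, rD := 1, rPW := 0, rSI := 1, rCnt := 2 * Q - 1)"
  have c0: "nat M = cell 1 0" "64 \<le> cell 1 0" "M \<le> int (cell 1 0)"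
    using cell_nat(1)[of 1 0] cell_64[of 1 0] by auto
  obtain a where a: "cell 1 0 = a" by blast
  have r0: "runs B ?pre m 6 ?m0"
    using envD[OF e] c0 unfolding a by (intro runs_lf[OF e]) (auto simp: fun_upd_twist)
  have e0: "env ?m0"
    using e c0 OFF_M OFFpos QM Qpos by (intro env_upd less_2B) auto
  have g0: "gstate u 0 1 ?m0"
    using w c0 Qpos Q_def unfolding gstate_def by auto
  have s0: "same genX m ?m0" using cell_region[of 0 1] Mpos by (auto simp: same_def)
  let ?I = "\<lambda>j m'. env m' \<and> same genX m m' \<and> (\<exists>\<kappa>. gstate u \<kappa> (Suc j) m')"
  have Q2: "2 * Q = int (2 * 2 ^ q)" using Q_def by simp
  have "\<exists>m'. runs B (While rCnt cGenBody) ?m0 ((25 + 1) * (2 * 2 ^ q - 1) + 1) m' \<and> ?I (2 * 2 ^ q - 1) m'"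
  proof (rule runs_count_loop[where I="?I"])
    fix j m1 assume I: "?I j m1" and j: "j < 2 * 2 ^ q - 1"
    then obtain \<kappa> where g: "gstate u \<kappa> (Suc j) m1" and e1: "env m1" by blast
    define m2 where "m2 = ev cGenBody m1"
    obtain \<kappa>' where 2: "gstate u \<kappa>' (Suc (Suc j)) m2" "env m2" "same genX m1 m2"
      using gen_body[OF e1 g] j unfolding m2_def by (auto simp: less_diff_conv)
    have "same genX m m2" using I 2(3) same_trans by blast
    moreover have "runs B cGenBody m1 25 m2"
      using loopfree_gen by (intro runs_lf[OF e1]) (auto simp: m2_def)
    ultimately show "\<exists>m2. runs B cGenBody m1 25 m2 \<and> ?I (Suc j) m2" using 2 by blast
  next
    fix j m' assume I: "?I j m'" and j: "j \<le> 2 * 2 ^ q - 1"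
    then have "m' rCnt = int (2 * 2 ^ q) - int (Suc j)" unfolding Q2[symmetric] gstate_def by auto
    then have "m' rCnt > 0 \<longleftrightarrow> Suc j < 2 * 2 ^ q" by (simp only: diff_gt_0_iff_gt of_nat_less_iff)
    then show "bnd B m' \<and> (m' rCnt > 0 \<longleftrightarrow> j < 2 * 2 ^ q - 1)" using I env_bnd by (auto simp: less_diff_conv)
  next
    show "?I 0 ?m0" using e0 g0 s0 by auto
  qed (use MB in auto)
  then obtain m' \<kappa> where l: "runs B (While rCnt cGenBody) ?m0 ((25 + 1) * (2 * 2 ^ q - 1) + 1) m'" "env m'"
    "same genX m m'" "gstate u \<kappa> (2 * 2 ^ q) m'" by auto
  \<comment> \<open>A full table forces exactly \<open>q + 1\<close> loaded weights, so the next
    call of \<open>cGen\<close> starts at the next block.\<close>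
  have \<kappa>: "\<kappa> = q + 1"
  proof -
    have "(2::nat) ^ (q + 1) \<le> 2 ^ \<kappa>" using l(4) by (simp add: gstate_def)
    then have "q + 1 \<le> \<kappa>" by (rule power_le_imp_le_exp[rotated]) simp
    moreover have "\<kappa> \<le> q + 1"
    proof (rule ccontr)
      assume "\<not> \<kappa> \<le> q + 1"
      then have "(2::nat) ^ (q + 2) \<le> 2 ^ \<kappa>" by (intro power_increasing) auto
      then have "(2::nat) * 2 ^ q \<le> 2 ^ \<kappa> div 2" by simp
      then show False using l(4) by (simp add: gstate_def)
    qed
    ultimately show ?thesis by simp
  qed
  have "runs B cGen m (60 * 2 ^ q + 10) m'"
    unfolding cGen_def using runs_mono[OF runs_seq[OF r0 l(1)]] by simp
  then show ?thesis using l \<kappa> by (intro exI[of _ m']) (auto simp: gstate_def add.assoc)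
qed

lemma forall_insert_runs:
  assumes e: "env m" and arr: "\<And>i. i < 2 * 2 ^ q \<Longrightarrow> m (cell 1 (int i)) = f i"
    and f: "\<And>i. 0 < f i \<and> f i < 2 * OFF"
    and t: "tab m hb nb []" and k: "2 \<le> hb" "2 \<le> nb" "hb \<noteq> nb" "hb \<le> 14" "nb \<le> 14"
    and b: "m rBH = hb * M" "m rBN = nb * M"
  shows "\<exists>m' ys. runs B (cForall cInsert) m ((62 * r + 60) * 2 ^ q + 10) m' \<and> env m' \<and>
     tab m' hb nb ys \<and> set ys = f ` {..<2 * 2 ^ q} \<and>
     same ({rI, rX, rY, rHX, rA, rCnt, rB} \<union> (region hb \<union> region nb)) m m'"
proof -
  let ?X = "{rI, rX, rY, rHX, rA, rCnt, rB} \<union> (region hb \<union> region nb)"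
  let ?N = "2 * 2 ^ q :: nat"
  let ?pre = "Sub rI rI rOne ;; Add rA rM rI ;; Load rX rA"
  have NM: "int ?N < M" using QM Q_def by simp
  let ?m0 = "m(rI := int ?N)"
  have r0: "runs B (Add rI rQ rQ) m 1 ?m0"
    using envD[OF e] Q_def by (intro runs_lf[OF e]) auto
  have e0: "env ?m0" using e NM Mpos by (intro env_upd less_2B) auto
  let ?I = "\<lambda>l m'. env m' \<and> same ?X m m' \<and>
    (\<exists>ys. m' rI = int (?N - l) \<and> tab m' hb nb ys \<and> set ys = f ` {?N - l..<?N})"
  let ?K = "31 * r + 23"
  have "\<exists>m'. runs B (While rI (?pre ;; cInsert)) ?m0 ((?K + 1) * ?N + 1) m' \<and> ?I ?N m'"
  proof (rule runs_count_loop[where I="?I"])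
    fix l m1 assume I: "?I l m1" and l: "l < ?N"
    then obtain ys where i: "m1 rI = int (?N - l)" "tab m1 hb nb ys" "set ys = f ` {?N - l..<?N}"
      and e1: "env m1" and s1: "same ?X m m1" by blast
    obtain j where j: "?N - l = Suc j" "?N - Suc l = j" using l by (metis Suc_diff_Suc)
    have jN: "j < ?N" using j by simp
    then have "int j < int ?N" by (simp only: of_nat_less_iff)
    then have jM: "int j < M" using NM by linarith
    let ?m2 = "m1(rI := int j, rA := M + int j, rX := f j)"
    have "m1 (cell 1 (int j)) = m (cell 1 (int j))"
      using k jM by (intro sameD[OF s1]) (auto simp: cell_in_region_iff)
    then have v: "m1 (nat (M + int j)) = f j"
      using arr[OF jN] cell_nat(1)[of 1 "int j"] by simp
    have c64: "64 \<le> nat (M + int j)" using Mpos by linarith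
    have r2: "runs B ?pre m1 3 ?m2"
      using envD[OF e1] i(1) j v c64 by (intro runs_lf[OF e1]) auto
    have e2: "env ?m2" using e1 jM f[of j] OFF_M Mpos by (intro env_upd small_reg) auto
    have t2: "tab ?m2 hb nb ys"
      using k by (intro tab_same[OF i(2), of "{rI, rA, rX}"]) (auto simp: same_def)
    obtain m3 where m3: "runs B cInsert ?m2 (31 * r + 20) m3" "env m3"
      "tab m3 hb nb (if f j \<in> set ys then ys else f j # ys)"
      "same ({rY, rHX, rA, rCnt, rB} \<union> (region hb \<union> region nb)) ?m2 m3"
      using insert_runs[OF e2 _ _ _ t2, of "f j"] f[of j] k b sameD[OF s1] by auto
    have "set (if f j \<in> set ys then ys else f j # ys) = f ` {j..<?N}"
    proof -
      have "{j..<?N} = insert j {Suc j..<?N}" using jN by auto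
      then show ?thesis using i(3) unfolding j by auto
    qed
    moreover have "m3 rI = int j" using m3(4) k by (auto simp: same_def)
    moreover have "same ?X m m3"
      by (rule same_trans[OF same_trans[OF s1, of "{rI, rA, rX}" ?m2 ?X] m3(4)]) (auto simp: same_def)
    ultimately have "?I (Suc l) m3" using m3(2,3) unfolding j(2)
      by (intro conjI exI[of _ "if f j \<in> set ys then ys else f j # ys"]) auto
    moreover have "runs B (?pre ;; cInsert) m1 ?K m3" using runs_mono[OF runs_seq[OF r2 m3(1)]] by simp
    ultimately show "\<exists>m2. runs B (?pre ;; cInsert) m1 ?K m2 \<and> ?I (Suc l) m2" by blast
  next
    have "tab ?m0 hb nb []" using k by (intro tab_same[OF t, of "{rI}"]) (auto simp: same_def)
    then show "?I 0 ?m0" using e0 by (intro conjI exI[of _ "[]"]) (auto simp: same_def)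
  next
    fix l m' assume I: "?I l m'"
    then have "m' rI = int (?N - l)" by blast
    then have "m' rI > 0 \<longleftrightarrow> l < ?N" by (simp only: of_nat_0_less_iff zero_less_diff)
    then show "bnd B m' \<and> (m' rI > 0 \<longleftrightarrow> l < ?N)" using I env_bnd by blast
  qed (rule MB)
  then obtain m' ys where l: "runs B (While rI (?pre ;; cInsert)) ?m0 ((?K + 1) * ?N + 1) m'" "env m'" "same ?X m m'"
    "tab m' hb nb ys" "set ys = f ` {..<?N}" by (auto simp: atLeast0LessThan)
  have "1 + ((?K + 1) * ?N + 1) \<le> (62 * r + 60) * 2 ^ q + 10" by (simp add: algebra_simps)
  then have "runs B (cForall cInsert) m ((62 * r + 60) * 2 ^ q + 10) m'"
    unfolding cForall_def using runs_mono[OF runs_seq[OF r0 l(1)]] by simp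
  then show ?thesis using l by blast
qed

end

section \<open>Joining two lists of subset sums\<close>

context verifier
begin

definition rd :: "mem \<Rightarrow> int \<Rightarrow> int \<Rightarrow> int" where
  "rd m rb u = m (nat (rb * M + \<tau> - u))"

text \<open>\<open>D\<close> is the set of sums treated between \<open>m\<close> and
  \<open>m'\<close>. The tests are evaluated in the initial memory \<open>m\<close>, which is
  possible because marking never touches a tested cell; this lets effects be composed.\<close>

definition eff :: "int \<Rightarrow> int \<Rightarrow> mem \<Rightarrow> mem \<Rightarrow> int set \<Rightarrow> bool" where
  "eff wb rb m m' D \<longleftrightarrow>
     (\<forall>z. 0 \<le> z \<and> z < M \<longrightarrow> (m' (cell wb z) > 0 \<longleftrightarrow> m (cell wb z) > 0 \<or> z \<in> D)) \<and>
     (m' rFound > 0 \<longleftrightarrow> m rFound > 0 \<or> (\<exists>u\<in>D. rd m rb u > 0))"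

abbreviation joinX :: "int \<Rightarrow> nat set" where
  "joinX wb \<equiv> {rX, rY, rHX, rA, rCnt, rB, rBk, rP, rF, rFound, rI} \<union> region wb"

text \<open>Region \<open>rb - 1\<close> must be kept free as well: the address tested for a sum
  above \<open>\<tau>\<close> lies there.\<close>

definition bases :: "mem \<Rightarrow> int \<Rightarrow> int \<Rightarrow> int \<Rightarrow> int \<Rightarrow> bool" where
  "bases m hb nb wb rb \<longleftrightarrow> m rBH = hb * M \<and> m rBN = nb * M \<and> m rBW = wb * M \<and> m rBR = rb * M \<and>
     2 \<le> hb \<and> 2 \<le> nb \<and> 2 \<le> wb \<and> 2 \<le> rb \<and> hb \<le> 14 \<and> nb \<le> 14 \<and> wb \<le> 14 \<and> rb \<le> 14 \<and>
     hb \<noteq> nb \<and> wb \<noteq> hb \<and> wb \<noteq> nb \<and> wb \<noteq> rb \<and> wb \<noteq> rb - 1 \<and>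
     3 \<le> rb \<and> rb \<noteq> hb \<and> rb \<noteq> nb \<and> rb - 1 \<noteq> hb \<and> rb - 1 \<noteq> nb"

lemma bases_same: "bases m hb nb wb rb \<Longrightarrow> same X m m' \<Longrightarrow> {rBH, rBN, rBW, rBR} \<inter> X = {} \<Longrightarrow> bases m' hb nb wb rb"
  unfolding bases_def same_def by auto

text \<open>As \<open>0 \<le> \<tau> < M\<close> and \<open>0 < u < M\<close>, the address differs
  from \<open>rb * M\<close> by less than \<open>M\<close>, so it lies in region \<open>rb\<close>
  or the one below.\<close>

lemma rd_addr:
  assumes "bases m0 hb nb wb rb" "0 < u" "u < M"
  shows "64 \<le> nat (rb * M + \<tau> - u)" "0 \<le> rb * M + \<tau> - u" "rb * M + \<tau> - u < 16 * M"
    and "k \<noteq> rb \<Longrightarrow> k \<noteq> rb - 1 \<Longrightarrow> nat (rb * M + \<tau> - u) \<notin> region k"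
proof -
  have k: "2 \<le> rb" "rb \<le> 14" using assms unfolding bases_def by auto
  have "2 * M \<le> rb * M" "rb * M \<le> 14 * M" using k Mpos by (auto intro: mult_right_mono)
  then show "64 \<le> nat (rb * M + \<tau> - u)" "0 \<le> rb * M + \<tau> - u" "rb * M + \<tau> - u < 16 * M"
    using assms Mpos tau by linarith+
  then have i: "int (nat (rb * M + \<tau> - u)) = rb * M + \<tau> - u" by simp
  assume ne: "k \<noteq> rb" "k \<noteq> rb - 1"
  show "nat (rb * M + \<tau> - u) \<notin> region k"
  proof
    assume "nat (rb * M + \<tau> - u) \<in> region k"
    then have a: "k * M \<le> rb * M + \<tau> - u" "rb * M + \<tau> - u < (k + 1) * M"
      by (simp_all only: region_def mem_Collect_eq i)
    have "k * M < (rb + 1) * M" using a(1) assms(2) tau by (simp add: algebra_simps)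
    then have "k < rb + 1" using Mpos by (simp add: mult_less_cancel_right)
    moreover have "(rb - 1) * M < (k + 1) * M" using a(2) assms(3) tau by (simp add: algebra_simps)
    then have "rb - 1 < k + 1" using Mpos by (simp add: mult_less_cancel_right)
    ultimately show False using ne by linarith
  qed
qed

lemma rd_same:
  assumes "bases m0 hb nb wb rb" "0 < u" "u < M" "same (joinX wb) m m'"
  shows "rd m' rb u = rd m rb u"
proof -
  have "wb \<noteq> rb" "wb \<noteq> rb - 1" using assms(1) unfolding bases_def by auto
  then show ?thesis
    unfolding rd_def using rd_addr(1,4)[OF assms(1-3)] by (intro sameD[OF assms(4)]) auto
qed

lemma eff_refl: "same X m m' \<Longrightarrow> rFound \<notin> X \<Longrightarrow> X \<inter> region wb = {} \<Longrightarrow> 0 \<le> wb \<Longrightarrow> eff wb rb m m' {}"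
proof -
  assume a: "same X m m'" "rFound \<notin> X" "X \<inter> region wb = {}" "0 \<le> wb"
  have "m' (cell wb z) = m (cell wb z)" if "0 \<le> z" "z < M" for z
    using cell_region[of z wb] that a by (intro sameD[OF a(1)]) auto
  then show "eff wb rb m m' {}" using sameD[OF a(1,2)] unfolding eff_def by simp
qed

lemma eff_trans:
  assumes "eff wb rb m m1 D1" "eff wb rb m1 m2 D2" "same (joinX wb) m m1" "bases m0 hb nb wb rb"
    "\<And>u. u \<in> D2 \<Longrightarrow> 0 < u \<and> u < M"
  shows "eff wb rb m m2 (D1 \<union> D2)"
proof -
  have "rd m1 rb u = rd m rb u" if "u \<in> D2" for u
    using rd_same[OF assms(4) _ _ assms(3)] assms(5)[OF that] by blast
  then show ?thesis using assms(1,2) unfolding eff_def by auto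
qed

lemma sum_range: "0 < x \<Longrightarrow> x < 2 * OFF \<Longrightarrow> 0 < y \<Longrightarrow> y < 2 * OFF \<Longrightarrow> 0 < x + y \<and> x + y < (M::int)"
  using M_def by auto

lemma walk_body:
  assumes e: "env m" and b: "bases m hb nb wb rb" and x: "m rX = x" "0 < x" "x < 2 * OFF"
    and y: "m rP = y" "0 < y" "y < 2 * OFF" and F: "m rF = F" "0 < F" "F < M"
    and nx: "0 < m (cell nb y)"
  shows "\<exists>m1. runs B cWalkBody m 20 m1 \<and> env m1 \<and> same (joinX wb - {rX, rI, rBk}) m m1 \<and> m1 rF = F - 1 \<and>
     m1 rP = m (cell nb y) - 1 \<and> eff wb rb m m1 {x + y}"
proof -
  have k: "2 \<le> hb" "2 \<le> nb" "2 \<le> wb" "2 \<le> rb" "nb \<le> 14" "wb \<le> 14" "rb \<le> 14" "wb \<noteq> nb"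
    and kr: "wb \<noteq> rb" "wb \<noteq> rb - 1"
    and reg: "m rBH = hb * M" "m rBN = nb * M" "m rBW = wb * M" "m rBR = rb * M"
    using b unfolding bases_def by auto
  define u where "u = x + y"
  have u: "0 < u" "u < M" unfolding u_def using sum_range[of x y] x y by auto
  have yM: "y < M" using y OFF_M by simp
  obtain aw where aw: "aw = cell wb u" by blast
  obtain ar where ar: "ar = nat (rb * M + \<tau> - u)" by blast
  obtain an where an: "an = cell nb y" by blast
  have a64: "64 \<le> aw" "64 \<le> ar" "64 \<le> an" "M \<le> int aw"
    using cell_64[of wb u] cell_64[of nb y] rd_addr(1)[OF b u] k u y unfolding aw an ar by auto
  have ne: "ar \<noteq> aw" "an \<noteq> aw"
    using rd_addr(4)[OF b u, of wb] kr cell_region[of u wb] cell_inj[of u y wb nb] k u y yM unfolding aw an ar by auto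
  have na: "nat (wb * M + u) = aw" "nat (rb * M + \<tau> - u) = ar" "nat (nb * M + y) = an"
    unfolding aw an ar by (auto simp: cell_nat)
  have bs: "0 \<le> nb * M + y" "nb * M + y < 16 * M"
    using base_bound[of nb y] k y yM by auto
  define fd where "fd = (if m ar > 0 then 1 else m rFound)"
  let ?m1 = "m(rF := F - 1, rB := u, aw := 1, rFound := fd, rA := nb * M + y, rP := m an - 1)"
  have ev: "ev cWalkBody m = ?m1"
  proof -
    have n: "aw \<noteq> i" "ar \<noteq> i" "an \<noteq> i" if "i < 64" for i using a64 that by auto
    have xy: "m rX + m rP = u" using x y u_def by simp
    show ?thesis
      using F xy y(1) reg na n envD[OF e] ne unfolding cWalkBody_def fd_def
      by (cases "m ar > 0") (simp_all add: fun_upd_idem)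
  qed
  have "\<bar>fd\<bar> < 2 ^ B" using bndD[OF env_bnd[OF e], of rFound] MB Mpos unfolding fd_def by auto
  moreover have "\<bar>m an - 1\<bar> < 2 ^ B" using bndD[OF env_bnd[OF e], of an] nx unfolding an by linarith
  moreover have "\<bar>F - 1\<bar> < 2 ^ B" "\<bar>u\<bar> < 2 ^ B" "\<bar>1\<bar> < (2 ^ B :: int)" "\<bar>nb * M + y\<bar> < 2 ^ B"
    using F u bs Mpos by (intro less_2B; linarith)+
  ultimately have env1: "env ?m1"
    using a64(4) by (intro env_upd e) simp_all
  have s: "same (joinX wb - {rX, rI, rBk}) m ?m1"
    using cell_region[of u wb] u k unfolding aw by (auto simp: same_def)
  have "eff wb rb m ?m1 {x + y}"
  proof -
    have "?m1 (cell wb z) > 0 \<longleftrightarrow> m (cell wb z) > 0 \<or> z = u" if "0 \<le> z" "z < M" for z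
      using that k u cell_inj[of z u wb wb] unfolding aw by auto
    moreover have "m ar = rd m rb u" unfolding rd_def ar ..
    ultimately show ?thesis using a64 unfolding eff_def u_def[symmetric] fd_def by auto
  qed
  moreover have "runs B cWalkBody m 20 ?m1"
    by (rule runs_lf[OF e _ _ ev]) (simp_all add: cWalkBody_def)
  ultimately show ?thesis using env1 s a64 unfolding an
    by (intro exI[of _ ?m1] conjI) (auto simp: an)
qed

lemma walk_runs:
  assumes e: "env m" and b: "bases m hb nb wb rb" and x: "m rX = x" "0 < x" "x < 2 * OFF"
    and c: "chain (\<lambda>y. m (cell nb y)) (m rP) ys" and F: "m rF = int F" "int F < M"
    and ys: "\<And>y. y \<in> set ys \<Longrightarrow> 0 < y \<and> y < 2 * OFF \<and> 0 < m (cell nb y)"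
  shows "\<exists>m' k. runs B (While rP cWalkBody) m k m' \<and> env m' \<and> k + 25 * nat (m' rF) \<le> 25 * F + 30 \<and>
     m' rF = int (F - length ys) \<and> same (joinX wb - {rX, rI, rBk}) m m' \<and>
     eff wb rb m m' ((\<lambda>y. x + y) ` set (take F ys))"
proof -
  let ?X = "joinX wb - {rX, rI, rBk}"
  let ?nx = "\<lambda>y. m (cell nb y)"
  have k: "2 \<le> nb" "2 \<le> wb" "wb \<noteq> nb" using b unfolding bases_def by auto
  have XJ: "?X \<subseteq> joinX wb" by auto
  let ?I = "\<lambda>m'. env m' \<and> same ?X m m' \<and> (\<exists>j. j \<le> length ys \<and> j \<le> F \<and> m' rF = int (F - j) \<and>
     eff wb rb m m' ((\<lambda>y. x + y) ` set (take j ys)) \<and>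
     (chain ?nx (m' rP) (drop j ys) \<or> m' rP = 0 \<and> j = F))"
  \<comment> \<open>A unit of fuel is worth 25 and pays for one round of 20 units and its loop test.
    The 25 attached to \<open>rP\<close> pay for the round that finds the fuel exhausted.\<close>
  let ?\<mu> = "\<lambda>m::mem. 25 * nat (m rF) + (if m rP > 0 then 25 else 0)"
  have "\<exists>k m'. runs B (While rP cWalkBody) m k m' \<and> ?I m' \<and> \<not> m' rP > 0 \<and> k + ?\<mu> m' \<le> ?\<mu> m + 1"
  proof (rule runs_loop[where I="?I" and \<mu>="?\<mu>"])
    fix m1 assume I: "?I m1" and pos: "m1 rP > 0"
    then obtain j where e1: "env m1" and s1: "same ?X m m1" and j: "j \<le> length ys" "j \<le> F" "m1 rF = int (F - j)"
      "eff wb rb m m1 ((\<lambda>y. x + y) ` set (take j ys))" "chain ?nx (m1 rP) (drop j ys)"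
      by fastforce
    have X1: "m1 rX = x" using s1 x by (auto simp: same_def)
    have jl: "j < length ys" using j(1,5) pos by (cases "j = length ys") auto
    define y where "y = ys ! j"
    have dr: "drop j ys = y # drop (Suc j) ys" unfolding y_def using jl by (simp add: Cons_nth_drop_Suc)
    have P: "m1 rP = y" and ch: "chain ?nx (?nx y - 1) (drop (Suc j) ys)" using j(5) dr by auto
    have yr: "0 < y" "y < 2 * OFF" "0 < ?nx y" using ys[of y] jl unfolding y_def by auto
    have b1: "bases m1 hb nb wb rb" by (rule bases_same[OF b s1]) (use k in auto)
    have nx1: "m1 (cell nb y) = ?nx y"
      using yr OFF_M k by (intro sameD[OF s1]) (auto simp: cell_in_region_iff)
    show "\<exists>k m2. runs B cWalkBody m1 k m2 \<and> ?I m2 \<and> ?\<mu> m2 + k + 1 \<le> ?\<mu> m1"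
    proof (cases "j < F")
      case True
      obtain m2 where m2: "runs B cWalkBody m1 20 m2" "env m2" "same ?X m1 m2" "m2 rF = m1 rF - 1"
        "m2 rP = m1 (cell nb y) - 1" "eff wb rb m1 m2 {x + y}"
        using walk_body[OF e1 b1 X1 x(2,3) P yr(1,2), of "m1 rF"] True j(3) F yr nx1 by auto
      have s2: "same ?X m m2" using same_trans[OF s1 m2(3)] by blast
      have "eff wb rb m m2 ((\<lambda>y. x + y) ` set (take j ys) \<union> {x + y})"
        using sum_range[OF x(2,3) yr(1,2)] by (intro eff_trans[OF j(4) m2(6) same_mono[OF s1 XJ] b]) auto
      then have "eff wb rb m m2 ((\<lambda>y. x + y) ` set (take (Suc j) ys))"
        using jl by (simp add: take_Suc_conv_app_nth y_def)
      moreover have "m2 rF = int (F - Suc j)" using m2(4) j(3) True by simp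
      moreover have "chain ?nx (m2 rP) (drop (Suc j) ys)" using ch m2(5) nx1 by simp
      ultimately have "?I m2" using m2(2) s2 jl True by (intro conjI exI[of _ "Suc j"]) auto
      moreover have "F - j = Suc (F - Suc j)" using True by simp
      then have "?\<mu> m2 + 20 + 1 \<le> ?\<mu> m1"
        unfolding \<open>m2 rF = int (F - Suc j)\<close> j(3) nat_int using pos by simp
      ultimately show ?thesis using m2(1) by blast
    next
      case False
      let ?m2 = "m1(rP := 0)"
      have "runs B cWalkBody m1 20 ?m2"
        using False j(3) by (intro runs_lf[OF e1]) (simp_all add: cWalkBody_def)
      moreover have "env ?m2" using e1 by (intro env_upd) auto
      moreover have "same ?X m ?m2" using s1 by (auto simp: same_def)
      moreover have "eff wb rb m ?m2 ((\<lambda>y. x + y) ` set (take j ys))"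
        using j(4) k unfolding eff_def by auto
      ultimately have "?I ?m2" using j False by (intro conjI exI[of _ j]) auto
      moreover have "?\<mu> ?m2 + 20 + 1 \<le> ?\<mu> m1" using pos by simp
      ultimately show ?thesis using \<open>runs B cWalkBody m1 20 ?m2\<close> by blast
    qed
  next
    have "eff wb rb m m {}" unfolding eff_def by auto
    then show "?I m" using e c F by (intro conjI exI[of _ 0]) auto
  qed (use MB in \<open>auto dest: env_bnd\<close>)
  then obtain k' m' where l0: "runs B (While rP cWalkBody) m k' m'" "?I m'" "\<not> m' rP > 0"
    "k' + ?\<mu> m' \<le> ?\<mu> m + 1" by blast
  then obtain j where l: "runs B (While rP cWalkBody) m k' m'" "env m'" "same ?X m m'"
    "j \<le> length ys" "j \<le> F" "m' rF = int (F - j)" "eff wb rb m m' ((\<lambda>y. x + y) ` set (take j ys))"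
    "chain ?nx (m' rP) (drop j ys) \<or> m' rP = 0 \<and> j = F" "\<not> m' rP > 0" "k' + ?\<mu> m' \<le> ?\<mu> m + 1" by blast
  have "j = length ys \<or> j = F"
  proof (rule ccontr)
    assume c: "\<not> ?thesis"
    then have "drop j ys = ys ! j # drop (Suc j) ys" using l(4) by (simp add: Cons_nth_drop_Suc)
    then have "m' rP = ys ! j" using l(8) c by auto
    then show False using ys[of "ys ! j"] l(4,9) c by auto
  qed
  then have "take j ys = take F ys" "F - j = F - length ys" using l(4,5) by auto
  moreover have "k' + 25 * nat (m' rF) \<le> 25 * F + 30" using l(10) F(1) by (auto split: if_splits)
  ultimately show ?thesis using l by (intro exI[of _ m'] exI[of _ k']) auto
qed

section \<open>The four buckets searched for one outer element\<close>

definition blen :: "int list \<Rightarrow> int \<Rightarrow> nat" where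
  "blen ys k = length (filter (\<lambda>y. hash y = k) ys)"

lemma dec_mod:
  assumes "0 \<le> b" "b < Q"
  shows "(if b - 1 < 0 then b - 1 + Q else b - 1) = (b - 1) mod Q"
proof (cases "b = 0")
  case True
  have "(- 1) mod Q = Q - 1" using Qpos by (simp add: zmod_minus1)
  then show ?thesis using True by simp
next
  case False
  then show ?thesis using assms by simp
qed

lemma tab_member:
  assumes "tab m hb nb ys" "y \<in> set ys"
  shows "0 < y \<and> y < 2 * OFF \<and> 0 < m (cell nb y)"
proof -
  have "0 < y" "y < 2 * OFF" using assms unfolding tab_def by blast+
  moreover have "y < M" using calculation OFF_M by linarith
  ultimately show ?thesis using assms unfolding tab_def by auto
qed

text \<open>The inclusion for \<open>D\<close> holds whatever the fuel and serves soundness; the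
  equality requires enough fuel and serves completeness.\<close>

lemma step_runs:
  assumes e: "env m" and b: "bases m hb nb wb rb" and x: "m rX = x" "0 < x" "x < 2 * OFF"
    and t: "tab m hb nb ys" and k: "m rBk = \<beta>" "0 \<le> \<beta>" "\<beta> < Q" and F: "m rF = int F" "int F < M"
  shows "\<exists>m' k D. runs B cStep m k m' \<and> env m' \<and> k + 25 * nat (m' rF) \<le> 25 * F + 50 \<and>
     m' rF = int (F - blen ys \<beta>) \<and> m' rBk = (\<beta> - 1) mod Q \<and> same (joinX wb - {rX, rI}) m m' \<and>
     eff wb rb m m' D \<and> D \<subseteq> (\<lambda>y. x + y) ` {y \<in> set ys. hash y = \<beta>} \<and>
     (blen ys \<beta> \<le> F \<longrightarrow> D = (\<lambda>y. x + y) ` {y \<in> set ys. hash y = \<beta>})"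
proof -
  let ?X = "joinX wb - {rX, rI, rBk}"
  let ?Y = "joinX wb - {rX, rI}"
  let ?l = "filter (\<lambda>y. hash y = \<beta>) ys"
  let ?pre = "Add rA rBH rBk ;; Load rP rA"
  let ?post = "Sub rBk rBk rOne ;; Sub rA rZero rBk ;; If rA (Add rBk rBk rQ) Skip"
  have kb: "2 \<le> hb" "2 \<le> nb" "2 \<le> wb" "hb \<le> 14" "wb \<noteq> hb" "wb \<noteq> nb" "m rBH = hb * M"
    using b unfolding bases_def by auto
  have bM: "\<beta> < M" using k QM Qpos by linarith
  let ?m1 = "m(rA := hb * M + \<beta>, rP := m (cell hb \<beta>))"
  have r1: "runs B ?pre m 2 ?m1"
    using kb k cell_64[of hb \<beta>] by (intro runs_lf[OF e]) (auto simp: cell_nat)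
  have e1: "env ?m1"
    using base_bound[of hb \<beta>] kb k bM by (intro env_upd e small_reg bndD[OF env_bnd[OF e]]) auto
  have s1: "same ?X m ?m1" by (auto simp: same_def)
  have b1: "bases ?m1 hb nb wb rb" by (rule bases_same[OF b s1]) (use kb in auto)
  have t1: "tab ?m1 hb nb ys" using kb by (intro tab_same[OF t, of "{rA, rP}"]) (auto simp: same_def)
  have ch: "chain (\<lambda>y. ?m1 (cell nb y)) (?m1 rP) ?l"
  proof -
    have "chain (\<lambda>y. ?m1 (cell nb y)) (?m1 (cell hb \<beta>)) ?l" using t1 k unfolding tab_def by blast
    moreover have "?m1 (cell hb \<beta>) = ?m1 rP" using kb k by simp
    ultimately show ?thesis by simp
  qed
  have ys: "0 < y \<and> y < 2 * OFF \<and> 0 < ?m1 (cell nb y)" if "y \<in> set ?l" for y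
    by (rule tab_member[OF t1]) (use that in auto)
  have X1: "?m1 rX = x" "?m1 rF = int F" using x(1) F(1) by auto
  obtain m2 k2 where m2: "runs B (While rP cWalkBody) ?m1 k2 m2" "env m2" "k2 + 25 * nat (m2 rF) \<le> 25 * F + 30"
    "m2 rF = int (F - length ?l)" "same ?X ?m1 m2" "eff wb rb ?m1 m2 ((\<lambda>y. x + y) ` set (take F ?l))"
    using walk_runs[OF e1 b1 X1(1) x(2,3) ch X1(2) F(2) ys] by blast
  have m2k: "m2 rBk = \<beta>" using m2(5) k(1) by (auto simp: same_def)
  let ?m3 = "m2(rBk := (\<beta> - 1) mod Q, rA := (if \<beta> - 1 < 0 then 1 - \<beta> else 0))"
  have r3: "runs B ?post m2 5 ?m3"
    using m2k envD[OF m2(2)] dec_mod[OF k(2,3)]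
    by (intro runs_lf[OF m2(2)]) (auto simp: fun_upd_twist)
  have "0 \<le> (\<beta> - 1) mod Q" "(\<beta> - 1) mod Q < Q" using Qpos by auto
  then have "\<bar>(\<beta> - 1) mod Q\<bar> < 2 ^ B" using QM Mpos by (intro less_2B) linarith
  moreover have "\<bar>if \<beta> - 1 < 0 then 1 - \<beta> else 0\<bar> < 2 ^ B" using k QM Mpos by (intro less_2B) auto
  ultimately have e3: "env ?m3" by (intro env_upd m2(2)) auto
  have s3: "same ?Y m ?m3"
    by (rule same_trans[OF same_trans[OF s1 m2(5), of ?Y], of "{rBk, rA}"]) (auto simp: same_def)
  have "eff wb rb m ?m3 ((\<lambda>y. x + y) ` set (take F ?l))"
  proof -
    have "?m1 (cell wb z) = m (cell wb z)" "?m3 (cell wb z) = m2 (cell wb z)" if "0 \<le> z" for z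
      using that kb by auto
    moreover have "rd ?m1 rb u = rd m rb u" if h: "u \<in> (\<lambda>y. x + y) ` set (take F ?l)" for u
    proof -
      obtain y where "u = x + y" "y \<in> set ?l" using h by (auto dest: in_set_takeD)
      then have "0 < u" "u < M" using sum_range[OF x(2,3), of y] ys[of y] by auto
      then show ?thesis by (intro rd_same[OF b] same_mono[OF s1]) auto
    qed
    ultimately show ?thesis using m2(6) unfolding eff_def by auto
  qed
  moreover have "runs B cStep m (2 + (k2 + 5)) ?m3"
    unfolding cStep_def by (rule runs_seq[OF r1 runs_seq[OF m2(1) r3]])
  moreover have "(\<lambda>y. x + y) ` set (take F ?l) \<subseteq> (\<lambda>y. x + y) ` {y \<in> set ys. hash y = \<beta>}"
    by (auto dest: in_set_takeD)
  moreover have "blen ys \<beta> \<le> F \<longrightarrow> (\<lambda>y. x + y) ` set (take F ?l) = (\<lambda>y. x + y) ` {y \<in> set ys. hash y = \<beta>}"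
    unfolding blen_def by auto
  moreover have "2 + (k2 + 5) + 25 * nat (?m3 rF) \<le> 25 * F + 50" using m2(3) by simp
  moreover have "?m3 rF = int (F - blen ys \<beta>)" using m2(4) by (simp add: blen_def)
  ultimately show ?thesis using e3 s3
    by (intro exI[of _ ?m3] exI[of _ "2 + (k2 + 5)"] exI[of _ "(\<lambda>y. x + y) ` set (take F ?l)"] conjI) simp_all
qed

definition msum :: "int \<Rightarrow> int \<Rightarrow> int set \<Rightarrow> int set" where
  "msum \<sigma> x Y = {x + y | y. y \<in> Y \<and> (\<exists>e<4. (hash x + hash y + int e) mod Q = \<sigma>)}"

text \<open>The fuel that the search for \<open>x\<close> demands. It is a sum over the four buckets
  and not the size of their union, because they repeat cyclically when \<open>Q < 4\<close>.\<close>

definition jcost :: "int \<Rightarrow> int \<Rightarrow> int set \<Rightarrow> nat" where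
  "jcost \<sigma> x Y = (\<Sum>e<4. card {y \<in> Y. (hash x + hash y + int e) mod Q = \<sigma>})"

lemma bucket_iff:
  assumes "0 \<le> \<sigma>" "\<sigma> < Q"
  shows "hash y = (\<sigma> - hash x - e) mod Q \<longleftrightarrow> (hash x + hash y + e) mod Q = \<sigma>"
proof
  assume "hash y = (\<sigma> - hash x - e) mod Q"
  then have "(hash x + hash y + e) mod Q = (hash x + (\<sigma> - hash x - e) + e) mod Q"
    by (metis mod_add_left_eq mod_add_right_eq)
  then show "(hash x + hash y + e) mod Q = \<sigma>" using assms by simp
next
  assume "(hash x + hash y + e) mod Q = \<sigma>"
  then have "(\<sigma> - hash x - e) mod Q = ((hash x + hash y + e) - hash x - e) mod Q"
    by (metis mod_diff_left_eq)
  then show "hash y = (\<sigma> - hash x - e) mod Q" using hash_range[of y] by simp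
qed

lemma sum_lessThan_4: "(\<Sum>e<4. f e) = f 0 + f 1 + f 2 + f (3::nat)" for f :: "nat \<Rightarrow> 'a::comm_monoid_add"
  by (simp add: numeral_eq_Suc add.assoc)

lemma ex_less_4: "(\<exists>e<4. P e) \<longleftrightarrow> P 0 \<or> P 1 \<or> P 2 \<or> P (3::nat)"
proof
  assume "\<exists>e<4. P e"
  then obtain e where "e < 4" "P e" by blast
  then show "P 0 \<or> P 1 \<or> P 2 \<or> P 3" by (cases "e = 0"; cases "e = 1"; cases "e = 2"; cases "e = 3") auto
qed (auto intro: exI[of _ 0] exI[of _ 1] exI[of _ 2] exI[of _ 3])

lemma join_runs:
  assumes e: "env m" and b: "bases m hb nb wb rb" and x: "m rX = x" "0 < x" "x < 2 * OFF"
    and t: "tab m hb nb ys" and s: "m rS = \<sigma>" "0 \<le> \<sigma>" "\<sigma> < Q" and F: "m rF = int F" "int F < M"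
  shows "\<exists>m' k D. runs B cJoin m k m' \<and> env m' \<and> k + 25 * nat (m' rF) \<le> 25 * F + 31 * r + 250 \<and>
     m' rF = int (F - jcost \<sigma> x (set ys)) \<and> same (joinX wb - {rX, rI}) m m' \<and>
     eff wb rb m m' D \<and> D \<subseteq> (\<lambda>y. x + y) ` set ys \<and>
     (jcost \<sigma> x (set ys) \<le> F \<longrightarrow> D = msum \<sigma> x (set ys))"
proof -
  let ?Y = "joinX wb - {rX, rI}"
  have kb: "2 \<le> hb" "2 \<le> nb" "2 \<le> wb" "wb \<noteq> hb" "wb \<noteq> nb" using b unfolding bases_def by auto
  have YJ: "?Y \<subseteq> joinX wb" by auto
  have ysr: "0 < y \<and> y < 2 * OFF" if "y \<in> set ys" for y using t that unfolding tab_def by auto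
  define \<beta> where "\<beta> e = (\<sigma> - hash x - int e) mod Q" for e
  have br: "0 \<le> \<beta> e" "\<beta> e < Q" for e unfolding \<beta>_def using Qpos by auto
  have bS: "(\<beta> e - 1) mod Q = \<beta> (Suc e)" for e
    unfolding \<beta>_def by (simp add: mod_diff_left_eq algebra_simps)
  define E where "E e = (\<lambda>y. x + y) ` {y \<in> set ys. hash y = \<beta> e}" for e
  define l where "l e = blen ys (\<beta> e)" for e
  have step: "\<exists>m' k D. runs B cStep m1 k m' \<and> env m' \<and> k + 25 * nat (m' rF) \<le> 25 * F1 + 50 \<and>
     m' rF = int (F1 - l e) \<and> m' rBk = \<beta> (Suc e) \<and> same ?Y m m' \<and>
     eff wb rb m m' (D1 \<union> D) \<and> D \<subseteq> E e \<and> (l e \<le> F1 \<longrightarrow> D = E e)"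
    if h: "env m1" "same ?Y m m1" "m1 rBk = \<beta> e" "m1 rF = int F1" "F1 \<le> F" "eff wb rb m m1 D1" for m1 e F1 D1
  proof -
    have "bases m1 hb nb wb rb" by (rule bases_same[OF b h(2)]) (use kb in auto)
    moreover have "tab m1 hb nb ys" using kb region_disjoint[of hb wb] region_disjoint[of nb wb]
      by (intro tab_same[OF t h(2)]) auto
    moreover have "m1 rX = x" using h(2) x by (auto simp: same_def)
    ultimately obtain m' k D where m': "runs B cStep m1 k m'" "env m'" "k + 25 * nat (m' rF) \<le> 25 * F1 + 50"
      "m' rF = int (F1 - l e)" "m' rBk = \<beta> (Suc e)" "same ?Y m1 m'"
      "eff wb rb m1 m' D" "D \<subseteq> E e" "l e \<le> F1 \<longrightarrow> D = E e"
      using step_runs[OF h(1) _ _ x(2,3) _ h(3) br h(4)] h(5) F(2)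
      unfolding E_def l_def bS by fastforce
    moreover have "same ?Y m m'" by (rule same_trans[OF h(2) m'(6)]) auto
    moreover have "eff wb rb m m' (D1 \<union> D)"
      using m'(8) sum_range[OF x(2,3)] ysr
      by (intro eff_trans[OF h(6) m'(7) same_mono[OF h(2) YJ] b]) (auto simp: E_def)
    ultimately show ?thesis by blast
  qed
  obtain m1 where m1: "runs B cHash m (31 * r + 7) m1" "env m1" "m1 rHX = hash x"
    "same {rY, rHX, rA, rCnt, rB} m m1"
    using hash_runs[OF e x(1)] x OFF_M by auto
  let ?c = "Sub rBk rS rHX ;; Sub rA rZero rBk ;; If rA (Add rBk rBk rQ) Skip"
  let ?m2 = "m1(rBk := \<beta> 0, rA := (if \<sigma> - hash x < 0 then hash x - \<sigma> else 0))"
  have "(if \<sigma> - hash x < 0 then \<sigma> - hash x + Q else \<sigma> - hash x) = \<beta> 0"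
  proof (cases "\<sigma> - hash x < 0")
    case True
    have "(\<sigma> - hash x) mod Q = (\<sigma> - hash x + Q) mod Q" by simp
    also have "\<dots> = \<sigma> - hash x + Q" using True s hash_range[of x] by (intro mod_pos_pos_trivial) auto
    finally show ?thesis using True by (simp add: \<beta>_def)
  next
    case False
    then show ?thesis using s hash_range[of x] by (simp add: \<beta>_def)
  qed
  then have r2: "runs B ?c m1 5 ?m2"
    using m1 s envD[OF m1(2)]
    by (intro runs_lf[OF m1(2)]) (auto simp: same_def fun_upd_twist)
  have "\<bar>\<beta> 0\<bar> < 2 ^ B" using br[of 0] QM Mpos by (intro less_2B) linarith
  moreover have "\<bar>if \<sigma> - hash x < 0 then hash x - \<sigma> else 0\<bar> < 2 ^ B"
    using s hash_range[of x] QM Mpos by (intro less_2B) auto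
  ultimately have e2: "env ?m2" by (intro env_upd m1(2)) auto
  have s2: "same ?Y m ?m2"
    by (rule same_trans[OF m1(4), of "{rBk, rA}"]) (auto simp: same_def)
  have f2: "?m2 rF = int F" using s2 F m1(4) by (auto simp: same_def)
  have "eff wb rb m ?m2 {}"
    using m1(4) kb by (intro eff_refl[of "{rY, rHX, rA, rCnt, rB, rBk}"]) (auto simp: same_def)
  then obtain m3 k3 D3 where m3: "runs B cStep ?m2 k3 m3" "env m3" "k3 + 25 * nat (m3 rF) \<le> 25 * F + 50"
     "m3 rF = int (F - l 0)" "m3 rBk = \<beta> 1" "same ?Y m m3"
     "eff wb rb m m3 D3" "D3 \<subseteq> E 0" "l 0 \<le> F \<longrightarrow> D3 = E 0"
    using step[OF e2 s2 _ f2] by fastforce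
  obtain m4 k4 D4 where m4: "runs B cStep m3 k4 m4" "env m4" "k4 + 25 * nat (m4 rF) \<le> 25 * (F - l 0) + 50"
     "m4 rF = int (F - l 0 - l 1)" "m4 rBk = \<beta> 2" "same ?Y m m4"
     "eff wb rb m m4 (D3 \<union> D4)" "D4 \<subseteq> E 1" "l 1 \<le> F - l 0 \<longrightarrow> D4 = E 1"
    using step[OF m3(2,6,5,4) _ m3(7)] by (fastforce simp: numeral_2_eq_2)
  obtain m5 k5 D5 where m5: "runs B cStep m4 k5 m5" "env m5" "k5 + 25 * nat (m5 rF) \<le> 25 * (F - l 0 - l 1) + 50"
     "m5 rF = int (F - l 0 - l 1 - l 2)" "m5 rBk = \<beta> 3" "same ?Y m m5"
     "eff wb rb m m5 (D3 \<union> D4 \<union> D5)" "D5 \<subseteq> E 2" "l 2 \<le> F - l 0 - l 1 \<longrightarrow> D5 = E 2"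
    using step[OF m4(2,6,5,4) _ m4(7)] by (fastforce simp: numeral_3_eq_3 numeral_2_eq_2)
  obtain m6 k6 D6 where m6: "runs B cStep m5 k6 m6" "env m6" "k6 + 25 * nat (m6 rF) \<le> 25 * (F - l 0 - l 1 - l 2) + 50"
     "m6 rF = int (F - l 0 - l 1 - l 2 - l 3)" "same ?Y m m6"
     "eff wb rb m m6 (D3 \<union> D4 \<union> D5 \<union> D6)" "D6 \<subseteq> E 3" "l 3 \<le> F - l 0 - l 1 - l 2 \<longrightarrow> D6 = E 3"
    using step[OF m5(2,6,5,4) _ m5(7)] by fastforce
  have "distinct ys" using t unfolding tab_def by blast
  then have le: "l e = card {y \<in> set ys. (hash x + hash y + int e) mod Q = \<sigma>}" for e
    unfolding l_def blen_def \<beta>_def bucket_iff[OF s(2,3)]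
    using distinct_card[OF distinct_filter, of ys "\<lambda>y. (hash x + hash y + int e) mod Q = \<sigma>"] by simp
  then have jc: "jcost \<sigma> x (set ys) = l 0 + l 1 + l 2 + l 3"
    unfolding jcost_def sum_lessThan_4 le by simp
  have ms: "msum \<sigma> x (set ys) = E 0 \<union> E 1 \<union> E 2 \<union> E 3"
    unfolding msum_def ex_less_4 E_def \<beta>_def bucket_iff[OF s(2,3)] by auto
  let ?D = "D3 \<union> D4 \<union> D5 \<union> D6"
  have "E e \<subseteq> (\<lambda>y. x + y) ` set ys" for e unfolding E_def by auto
  then have "?D \<subseteq> (\<lambda>y. x + y) ` set ys" using m3(8) m4(8) m5(8) m6(7) by blast
  moreover have "jcost \<sigma> x (set ys) \<le> F \<longrightarrow> ?D = msum \<sigma> x (set ys)"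
    unfolding jc ms using m3(9) m4(9) m5(9) m6(8) by auto
  moreover have "runs B cJoin m ((31 * r + 7) + (5 + (k3 + (k4 + (k5 + k6))))) m6"
    unfolding cJoin_def by (intro runs_seq[OF m1(1)] runs_seq[OF r2] runs_seq[OF m3(1)] runs_seq[OF m4(1)] runs_seq[OF m5(1)] m6(1))
  moreover have "(31 * r + 7) + (5 + (k3 + (k4 + (k5 + k6)))) + 25 * nat (m6 rF) \<le> 25 * F + 31 * r + 250"
    using m3(3,4) m4(3,4) m5(3,4) m6(3,4) by simp
  moreover have "m6 rF = int (F - jcost \<sigma> x (set ys))" unfolding jc using m6(4) by simp
  ultimately show ?thesis using m6(2,5,6) by blast
qed

end

context verifier
begin

lemma forall_join_runs:
  assumes e: "env m" and b: "bases m hb nb wb rb"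
    and arr: "\<And>i. i < 2 * 2 ^ q \<Longrightarrow> m (cell 1 (int i)) = f i" and f: "\<And>i. 0 < f i \<and> f i < 2 * OFF"
    and t: "tab m hb nb ys" and s: "m rS = \<sigma>" "0 \<le> \<sigma>" "\<sigma> < Q" and F: "m rF = int F" "int F < M"
  defines "cost \<equiv> \<Sum>i<2 * 2 ^ q. jcost \<sigma> (f i) (set ys)"
  shows "\<exists>m' k D. runs B (cForall cJoin) m k m' \<and> env m' \<and> k \<le> 25 * F + (62 * r + 600) * 2 ^ q + 10 \<and>
     same (joinX wb) m m' \<and> eff wb rb m m' D \<and> D \<subseteq> {f i + y | i y. i < 2 * 2 ^ q \<and> y \<in> set ys} \<and>
     (cost \<le> F \<longrightarrow> (\<forall>i<2 * 2 ^ q. msum \<sigma> (f i) (set ys) \<subseteq> D))"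
proof -
  let ?X = "joinX wb"
  let ?N = "2 * 2 ^ q :: nat"
  let ?pre = "Sub rI rI rOne ;; Add rA rM rI ;; Load rX rA"
  let ?c = "\<lambda>i. \<Sum>i'\<in>{i..<?N}. jcost \<sigma> (f i') (set ys)"
  have kb: "2 \<le> hb" "2 \<le> nb" "2 \<le> wb" "wb \<noteq> hb" "wb \<noteq> nb" using b unfolding bases_def by auto
  have ysr: "0 < y \<and> y < 2 * OFF" if "y \<in> set ys" for y using t that unfolding tab_def by auto
  have NM: "int ?N < M" using QM Q_def by simp
  let ?m0 = "m(rI := int ?N)"
  have r0: "runs B (Add rI rQ rQ) m 1 ?m0"
    using envD[OF e] Q_def by (intro runs_lf[OF e]) auto
  have e0: "env ?m0" using e NM Mpos by (intro env_upd less_2B) auto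
  let ?I = "\<lambda>m'. env m' \<and> same ?X m m' \<and> (\<exists>i D. i \<le> ?N \<and> m' rI = int i \<and> m' rF = int (F - ?c i) \<and>
     eff wb rb m m' D \<and> D \<subseteq> {f i' + y | i' y. i' < ?N \<and> y \<in> set ys} \<and>
     (?c i \<le> F \<longrightarrow> (\<forall>i'\<in>{i..<?N}. msum \<sigma> (f i') (set ys) \<subseteq> D)))"
  \<comment> \<open>Each outer element pays \<open>31 * r + 250\<close> for its hash and bucket
    accesses, 3 for being fetched and 1 for the loop test; the bucket entries are paid by the
    fuel.\<close>
  let ?\<mu> = "\<lambda>m::mem. (31 * r + 260) * nat (m rI) + 25 * nat (m rF)"
  have "\<exists>k m'. runs B (While rI (?pre ;; cJoin)) ?m0 k m' \<and> ?I m' \<and> \<not> m' rI > 0 \<and>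
       k + ?\<mu> m' \<le> ?\<mu> ?m0 + 1"
  proof (rule runs_loop[where I="?I" and \<mu>="?\<mu>"])
    fix m1 assume I: "?I m1" and pos: "m1 rI > 0"
    have e1: "env m1" and s1: "same ?X m m1" using I by blast+
    obtain i D where i: "i \<le> ?N" "m1 rI = int i" "m1 rF = int (F - ?c i)" "eff wb rb m m1 D"
      "D \<subseteq> {f i' + y | i' y. i' < ?N \<and> y \<in> set ys}"
      "?c i \<le> F \<longrightarrow> (\<forall>i'\<in>{i..<?N}. msum \<sigma> (f i') (set ys) \<subseteq> D)" using I by blast
    obtain j where j: "i = Suc j" using pos i(2) by (cases i) auto
    have jN: "j < ?N" using i(1) j by simp
    then have "int j < int ?N" by (simp only: of_nat_less_iff)
    then have jM: "int j < M" using NM by linarith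
    have cj: "?c j = jcost \<sigma> (f j) (set ys) + ?c i"
      unfolding j using jN by (rule sum.atLeast_Suc_lessThan)
    let ?m2 = "m1(rI := int j, rA := M + int j, rX := f j)"
    have "m1 (cell 1 (int j)) = m (cell 1 (int j))"
      using kb jM by (intro sameD[OF s1]) (auto simp: cell_in_region_iff)
    then have v: "m1 (nat (M + int j)) = f j"
      using arr[OF jN] cell_nat(1)[of 1 "int j"] by simp
    have c64: "64 \<le> nat (M + int j)" using Mpos by linarith
    have r2: "runs B ?pre m1 3 ?m2"
      using envD[OF e1] i(2) j v c64 by (intro runs_lf[OF e1]) auto
    have e2: "env ?m2" using e1 jM f[of j] OFF_M Mpos by (intro env_upd small_reg) auto
    have s2: "same ?X m ?m2" using s1 by (auto simp: same_def)
    have t2: "tab ?m2 hb nb ys" using kb region_disjoint[of hb wb] region_disjoint[of nb wb]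
      by (intro tab_same[OF t s2]) auto
    have b2: "bases ?m2 hb nb wb rb" by (rule bases_same[OF b s2]) (use kb in auto)
    have S2: "?m2 rS = \<sigma>" using s2 s(1) kb by (auto simp: same_def)
    have F2: "?m2 rF = int (F - ?c i)" "int (F - ?c i) < M" using i(3) F(2) by auto
    have X2: "?m2 rX = f j" by simp
    have fj: "0 < f j" "f j < 2 * OFF" using f[of j] by auto
    obtain m3 k3 D3 where m3: "runs B cJoin ?m2 k3 m3" "env m3"
      "k3 + 25 * nat (m3 rF) \<le> 25 * (F - ?c i) + 31 * r + 250"
      "m3 rF = int (F - ?c i - jcost \<sigma> (f j) (set ys))" "same (joinX wb - {rX, rI}) ?m2 m3"
      "eff wb rb ?m2 m3 D3" "D3 \<subseteq> (\<lambda>y. f j + y) ` set ys"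
      "jcost \<sigma> (f j) (set ys) \<le> F - ?c i \<longrightarrow> D3 = msum \<sigma> (f j) (set ys)"
      using join_runs[OF e2 b2 X2 fj t2 S2 s(2,3) F2] by blast
    have I3: "m3 rI = int j" using m3(5) kb by (auto simp: same_def)
    have s3: "same ?X m m3" by (rule same_trans[OF s2 m3(5)]) auto
    have "eff wb rb m ?m2 D"
      using i(4) kb unfolding eff_def by auto
    then have ef: "eff wb rb m m3 (D \<union> D3)"
      using m3(7) ysr f[of j] sum_range[of "f j"] by (intro eff_trans[OF _ m3(6) s2 b]) blast+
    have "\<forall>i'\<in>{j..<?N}. msum \<sigma> (f i') (set ys) \<subseteq> D \<union> D3" if c: "?c j \<le> F"
    proof
      fix i' assume i': "i' \<in> {j..<?N}"
      show "msum \<sigma> (f i') (set ys) \<subseteq> D \<union> D3"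
      proof (cases "i' = j")
        case True
        then show ?thesis using m3(8) c unfolding cj by auto
      next
        case False
        then have "i' \<in> {i..<?N}" using i' j by auto
        moreover have "?c i \<le> F" using c unfolding cj by simp
        ultimately show ?thesis using i(6) by blast
      qed
    qed
    moreover have "D \<union> D3 \<subseteq> {f i' + y | i' y. i' < ?N \<and> y \<in> set ys}"
      using i(5) m3(7) jN by blast
    moreover have "m3 rF = int (F - ?c j)" unfolding m3(4) cj by (simp add: add.commute)
    ultimately have "?I m3" using m3(2) s3 I3 jN ef
      by (intro conjI exI[of _ j] exI[of _ "D \<union> D3"]) auto
    moreover have "?\<mu> m3 + (3 + k3) + 1 \<le> ?\<mu> m1"
      using m3(3) unfolding I3 i(2,3) j nat_int by simp
    ultimately show "\<exists>k m2. runs B (?pre ;; cJoin) m1 k m2 \<and> ?I m2 \<and> ?\<mu> m2 + k + 1 \<le> ?\<mu> m1"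
      using runs_seq[OF r2 m3(1)] by blast
  next
    have "eff wb rb m ?m0 {}" using kb by (intro eff_refl[of "{rI}"]) (auto simp: same_def)
    then show "?I ?m0" using e0 F by (intro conjI exI[of _ ?N] exI[of _ "{}"]) (auto simp: same_def)
  qed (use MB env_bnd in auto)
  then obtain k' m' where l0: "runs B (While rI (?pre ;; cJoin)) ?m0 k' m'" "?I m'" "\<not> m' rI > 0"
    "k' + ?\<mu> m' \<le> ?\<mu> ?m0 + 1" by blast
  then obtain i D where l: "m' rI = int i" "eff wb rb m m' D" "D \<subseteq> {f i' + y | i' y. i' < ?N \<and> y \<in> set ys}"
     "?c i \<le> F \<longrightarrow> (\<forall>i'\<in>{i..<?N}. msum \<sigma> (f i') (set ys) \<subseteq> D)" by blast
  have "i = 0" using l(1) l0(3) by simp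
  then have "cost \<le> F \<longrightarrow> (\<forall>i<?N. msum \<sigma> (f i) (set ys) \<subseteq> D)"
    using l(4) unfolding cost_def by (auto simp: atLeast0LessThan)
  moreover have "nat (?m0 rI) = ?N" "nat (?m0 rF) = F" using F by (simp_all add: nat_eq_iff)
  then have "1 + k' \<le> 25 * F + (62 * r + 600) * 2 ^ q + 10" using l0(4) by (simp add: algebra_simps)
  moreover have "runs B (cForall cJoin) m (1 + k') m'"
    unfolding cForall_def by (rule runs_seq[OF r0 l0(1)])
  ultimately show ?thesis using l l0(2) by blast
qed

text \<open>The first block of the pair enters the dictionary without repetition, the second is
  enumerated with repetition. So an element of the second has at most one partner for a prescribed
  sum, which later limits the collisions that no hash can avoid.\<close>

lemma phase_runs:
  assumes e: "env m" and b: "bases m hb nb wb rb" and w: "m rWP = H + 4 + int (min u n)" "m rRem = int (n - u)"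
    and z: "\<And>i. i \<in> region hb \<union> region nb \<Longrightarrow> m i = 0"
    and s: "m rS = \<sigma>" "0 \<le> \<sigma>" "\<sigma> < Q" and F: "m rF = int F" "int F < M"
  defines "f1 \<equiv> gsum u" and "f2 \<equiv> gsum (u + q + 1)"
  defines "L1 \<equiv> f1 ` {..<2 * 2 ^ q}"
  defines "cost \<equiv> \<Sum>i<2 * 2 ^ q. jcost \<sigma> (f2 i) L1"
  shows "\<exists>m' k D. runs B cPhase m k m' \<and> env m' \<and> k \<le> 25 * F + (124 * r + 1000) * 2 ^ q + 50 \<and>
     m' rWP = H + 4 + int (min (u + 2 * (q + 1)) n) \<and> m' rRem = int (n - (u + 2 * (q + 1))) \<and>
     same (genX \<union> joinX wb \<union> region hb \<union> region nb) m m' \<and> eff wb rb m m' D \<and>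
     D \<subseteq> {f2 i + y | i y. i < 2 * 2 ^ q \<and> y \<in> L1} \<and>
     (cost \<le> F \<longrightarrow> (\<forall>i<2 * 2 ^ q. msum \<sigma> (f2 i) L1 \<subseteq> D))"
proof -
  have kb: "2 \<le> hb" "2 \<le> nb" "2 \<le> wb" "2 \<le> rb" "wb \<noteq> hb" "wb \<noteq> nb" "hb \<noteq> nb" "hb \<le> 14" "nb \<le> 14"
    and reg: "m rBH = hb * M" "m rBN = nb * M"
    using b unfolding bases_def by auto
  let ?insX = "{rI, rX, rY, rHX, rA, rCnt, rB} \<union> (region hb \<union> region nb)"
  obtain m1 where m1: "runs B cGen m (60 * 2 ^ q + 10) m1" "env m1" "same genX m m1"
     "m1 rWP = H + 4 + int (min (u + q + 1) n)" "m1 rRem = int (n - (u + q + 1))"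
     "\<forall>i<2 * 2 ^ q. m1 (cell 1 (int i)) = f1 i"
    using gen_runs[OF e w] unfolding f1_def by blast
  have "tab m hb nb []" using z kb by (intro tab_empty) auto
  then have t1: "tab m1 hb nb []"
    using kb region_disjoint[of hb 1] region_disjoint[of nb 1]
    by (intro tab_same[OF _ m1(3)]) auto
  have g: "0 < gsum v i \<and> gsum v i < 2 * OFF" for v i using gsum_range by blast
  obtain m2 ys where m2: "runs B (cForall cInsert) m1 ((62 * r + 60) * 2 ^ q + 10) m2" "env m2"
    "tab m2 hb nb ys" "set ys = L1" "same ?insX m1 m2"
    using forall_insert_runs[OF m1(2) _ _ t1 kb(1,2,7,8,9), of f1] m1(6) g reg sameD[OF m1(3)]
    unfolding L1_def f1_def by auto
  have w2: "m2 rWP = H + 4 + int (min (u + q + 1) n)" "m2 rRem = int (n - (u + q + 1))"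
    using m1(4,5) m2(5) kb by (auto simp: same_def)
  obtain m3 where m3: "runs B cGen m2 (60 * 2 ^ q + 10) m3" "env m3" "same genX m2 m3"
     "m3 rWP = H + 4 + int (min (u + q + 1 + q + 1) n)" "m3 rRem = int (n - (u + q + 1 + q + 1))"
     "\<forall>i<2 * 2 ^ q. m3 (cell 1 (int i)) = f2 i"
    using gen_runs[OF m2(2) w2] unfolding f2_def by blast
  have t3: "tab m3 hb nb ys"
    using kb region_disjoint[of hb 1] region_disjoint[of nb 1]
    by (intro tab_same[OF m2(3) m3(3)]) auto
  have s3: "same (genX \<union> ?insX) m m3"
    by (rule same_trans[OF same_trans[OF m1(3) m2(5), of "genX \<union> ?insX"] m3(3)]) auto
  have b3: "bases m3 hb nb wb rb" by (rule bases_same[OF b s3]) (use kb in auto)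
  have S3: "m3 rS = \<sigma>" "m3 rF = int F" using s3 s(1) F(1) kb by (auto simp: same_def)
  obtain m4 k D where m4: "runs B (cForall cJoin) m3 k m4" "env m4" "k \<le> 25 * F + (62 * r + 600) * 2 ^ q + 10"
     "same (joinX wb) m3 m4" "eff wb rb m3 m4 D" "D \<subseteq> {f2 i + y | i y. i < 2 * 2 ^ q \<and> y \<in> set ys}"
     "(\<Sum>i<2 * 2 ^ q. jcost \<sigma> (f2 i) (set ys)) \<le> F \<longrightarrow> (\<forall>i<2 * 2 ^ q. msum \<sigma> (f2 i) (set ys) \<subseteq> D)"
    using forall_join_runs[OF m3(2) b3 _ _ t3 S3(1) s(2,3) S3(2) F(2), of f2] m3(6) g unfolding f2_def by blast
  let ?K = "(60 * 2 ^ q + 10) + (((62 * r + 60) * 2 ^ q + 10) + ((60 * 2 ^ q + 10) + k))"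
  have "runs B cPhase m ?K m4"
    unfolding cPhase_def by (intro runs_seq[OF m1(1)] runs_seq[OF m2(1)] runs_seq[OF m3(1)] m4(1))
  moreover have "?K \<le> 25 * F + (124 * r + 1000) * 2 ^ q + 50" using m4(3) by (simp add: algebra_simps)
  moreover have "m4 rWP = H + 4 + int (min (u + 2 * (q + 1)) n)" "m4 rRem = int (n - (u + 2 * (q + 1)))"
    using m3(4,5) m4(4) kb by (auto simp: same_def algebra_simps)
  moreover have "same (genX \<union> joinX wb \<union> region hb \<union> region nb) m m4"
    by (rule same_trans[OF s3 m4(4)]) auto
  moreover have "eff wb rb m m4 D"
  proof -
    have "m3 (cell wb v) = m (cell wb v)" if "0 \<le> v" "v < M" for v
      using that kb by (intro sameD[OF s3]) (auto simp: cell_in_region_iff)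
    moreover have "m3 rFound = m rFound" using kb by (intro sameD[OF s3]) auto
    moreover have "rd m3 rb x = rd m rb x" if h: "x \<in> D" for x
    proof -
      obtain i y where iy: "x = f2 i + y" "y \<in> set ys" using m4(6) h by blast
      then have x: "0 < x" "x < M"
        using sum_range[of "f2 i" y] g m2(4) unfolding f2_def L1_def f1_def by auto
      have "rb \<noteq> 1" "rb - 1 \<noteq> 1" "rb \<noteq> hb" "rb \<noteq> nb" "rb - 1 \<noteq> hb" "rb - 1 \<noteq> nb"
        using b unfolding bases_def by auto
      then have "nat (rb * M + \<tau> - x) \<notin> genX \<union> ?insX"
        using rd_addr(1)[OF b x] rd_addr(4)[OF b x, of 1] rd_addr(4)[OF b x, of hb] rd_addr(4)[OF b x, of nb]
        by auto
      then show ?thesis unfolding rd_def by (rule sameD[OF s3])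
    qed
    ultimately show ?thesis using m4(5) unfolding eff_def by auto
  qed
  ultimately show ?thesis using m4 m2(4) unfolding cost_def by blast
qed

end

section \<open>The prelude\<close>

text \<open>
Only cells 0 to 3 are known to be free at the start, so the input is first copied upwards by
\<open>H = 16 (r + n)\<close>, with \<open>t\<close> saved in cell \<open>H\<close> and \<open>r\<close> in cell \<open>3 H\<close>; then the cells below 64 are registers.
\<close>

definition cPre1 :: com where
  "cPre1 = (Add 3 2 0 ;; Add 3 3 3 ;; Add 3 3 3 ;; Add 3 3 3 ;; Add 3 3 3) ;; Store 3 1 ;;
     Const 1 0 ;; Add 1 1 3 ;; Add 3 3 1 ;; Add 3 3 1 ;; Store 3 2 ;; Const 3 0 ;; Add 2 1 3"

text \<open>Cell \<open>p\<close> goes to cell \<open>H + p\<close>, for \<open>p\<close> from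
  \<open>H\<close> down to 1. Sources are at most \<open>H\<close> and targets above it, so nothing
  is overwritten before it is read. The scratch cells 1 to 3 end up below \<open>H + 4\<close>,
  outside the copied input.\<close>

definition cCopyBody :: com where
  "cCopyBody = Load 3 2 ;; Add 2 2 1 ;; Store 2 3 ;; Sub 2 2 1 ;; Const 3 1 ;; Sub 2 2 3"

definition cPre2 :: com where
  "cPre2 = Const rOne 1 ;; Const rZero 0 ;; Load rT rH ;; Add rA rH rH ;; Add rA rA rH ;; Load rR rA ;;
     Const rQ 1 ;; Const rq 0 ;; Const rA 3 ;; Sub rCnt 0 rA ;; Const rB 4"

definition cQBody :: com where
  "cQBody = Add rQ rQ rQ ;; Add rq rq rOne ;; Sub rCnt rCnt rB"

definition cPre3 :: com where
  "cPre3 = Sub rCnt rR 0 ;; Const rOff 1"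

definition cOffBody :: com where
  "cOffBody = Add rOff rOff rOff ;; Sub rCnt rCnt rOne"

definition cPre4 :: com where
  "cPre4 = Add rM rOff rOff ;; Add rM rM rM ;; Add rM rM rM ;; Add rM rM rM ;;
     Add rA rOff rOff ;; Add rA rA rA ;; Add rT rT rA ;;
     If rT (Sub rA rM rT ;; If rA Skip (Const rT 0)) (Const rT 0)"

definition cPre5 :: com where
  "cPre5 = Add rA rH 0 ;; Add rA rA rR ;; Const rB 4 ;; Add rCnt rA rB ;; Const rS 0 ;; Mov rI rq"

definition cProofBody :: com where
  "cProofBody = Add rS rS rS ;; Load rA rCnt ;; Add rS rS rA ;; Add rCnt rCnt rOne ;; Sub rI rI rOne"

text \<open>
The fuel \<open>2^17 Q\<close> exceeds \<open>8 Q\<close>, a bound for the pairs with the same sum as the solution, plus six times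
\<open>5600 Q\<close>, a bound for the expected number of other colliding pairs.
\<close>

definition cFuel :: com where
  "cFuel = Add rF rQ rQ ;; Add rF rF rF ;; Add rF rF rF ;; Add rF rF rF ;; Add rF rF rF ;; Add rF rF rF ;;
     Add rF rF rF ;; Add rF rF rF ;; Add rF rF rF ;; Add rF rF rF ;; Add rF rF rF ;; Add rF rF rF ;;
     Add rF rF rF ;; Add rF rF rF ;; Add rF rF rF ;; Add rF rF rF ;; Add rF rF rF"

definition cPre6 :: com where
  "cPre6 = Const rB 4 ;; Add rWP rH rB ;; Mov rRem 0 ;; Add rBH rM rM ;; Add rBN rBH rM ;; Add rBW rBH rBH ;;
     Add rBW rBW rBN ;; Add rBR rBW rBH ;; Const rFound 0 ;; cFuel"

definition cPrelude :: com where
  "cPrelude = cPre1 ;; While 2 cCopyBody ;; cPre2 ;; While rCnt cQBody ;; cPre3 ;; While rCnt cOffBody ;;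
     cPre4 ;; cPre5 ;; While rI cProofBody ;; cPre6"

text \<open>The second phase receives the untouched regions 4 and 5 for its buckets. Exchanging
  \<open>rBW\<close> and \<open>rBR\<close> makes it test the marks of the first phase. The hash
  target becomes \<open>hash \<tau> - \<sigma>\<close>, reduced by at most one addition of
  \<open>Q\<close>.\<close>

definition cMid :: com where
  "cMid = Sub rS rHX rS ;; Sub rA rZero rS ;; If rA (Add rS rS rQ) Skip ;; Add rBH rBH rBH ;; Add rBN rBH rM ;;
     Mov rA rBR ;; Mov rBR rBW ;; Mov rBW rA ;; Const rFound 0 ;; cFuel"

definition cVerifier :: com where
  "cVerifier = cPrelude ;; cPhase ;; (Mov rX rT ;; cHash ;; cMid) ;; cPhase ;; Mov 0 rFound"

lemma bval_less: "bval bs < 2 ^ length bs"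
  by (induction bs rule: rev_induct) auto

lemma runs_bnd:
  "bnd B m \<Longrightarrow> 4 \<le> B \<Longrightarrow> loopfree c \<Longrightarrow> csz c \<le> 100 \<Longrightarrow> ev c m = m' \<Longrightarrow> csz c \<le> k \<Longrightarrow> runs B c m k m'"
  using runs_loopfree[of c B m] runs_mono by blast

section \<open>Effect of the prelude\<close>

locale verifier_run = verifier +
  fixes t :: int and pf :: "bool list"
  assumes H_def: "H = 16 * (int r + int n)" and OFF_def: "OFF = 2 ^ (r - n)" and nr: "n \<le> r"
    and q_def: "q = n div 4" and pf_len: "length pf \<le> q"
    and tau_def: "\<tau> = (if 0 < t + 4 * OFF \<and> t + 4 * OFF < M then t + 4 * OFF else 0)"
    and tB: "\<bar>t\<bar> + 16 * M < 2 ^ B" and FB: "131072 * Q < M"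
begin

text \<open>The program always reads \<open>q\<close> cells. A shorter proof is followed by zero
  cells, so it is read as if padded with \<open>False\<close>.\<close>

definition pb :: "bool list" where
  "pb = map (\<lambda>k. k < length pf \<and> pf ! k) [0..<q]"

abbreviation m0 :: mem where
  "m0 \<equiv> init_mem as t rho pf"

lemma m0_simps:
  "m0 0 = int n" "m0 (Suc 0) = t" "m0 2 = int r"
  "i < n \<Longrightarrow> m0 (4 + i) = as ! i"
  "j < r \<Longrightarrow> m0 (4 + n + j) = of_bool (rho ! j)"
  "k < q \<Longrightarrow> m0 (4 + n + r + k) = of_bool (pb ! k)"
  "4 + n + r + q \<le> x \<Longrightarrow> m0 x = 0"
  using n_def r_def pf_len by (auto simp: init_mem_def Let_def pb_def)

lemma m0_bnd: "bnd B m0"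
proof -
  have "\<bar>m0 x\<bar> < 2 ^ B" for x
  proof -
    have a: "\<bar>as ! i\<bar> < 2 ^ B" if "i < n" for i
    proof -
      have "\<bar>as ! i\<bar> < OFF" using wt_bound[of i] that by (simp add: wt_def)
      then show ?thesis using less_2B[of "as ! i"] OFF_M OFFpos by linarith
    qed
    have "\<bar>int n\<bar> < 2 ^ B" "\<bar>int r\<bar> < 2 ^ B" "\<bar>int (length pf)\<bar> < 2 ^ B"
      "\<bar>1\<bar> < (2 ^ B :: int)" "\<bar>0\<bar> < (2 ^ B :: int)"
      using inpH HM H64 pf_len Mpos by (intro less_2B; linarith)+
    moreover have "\<bar>t\<bar> < 2 ^ B" using tB Mpos by linarith
    ultimately show ?thesis using a unfolding init_mem_def Let_def r_def n_def by (auto simp del: abs_of_nat)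
  qed
  then show ?thesis by (simp add: bnd_def)
qed

definition h :: nat where "h = 16 * (r + n)"

lemma h: "H = int h" "64 \<le> h" "4 + n + r + q < h"
  using H_def H64 inpH by (auto simp: h_def)

definition m1 :: mem where
  "m1 = m0(h := t, 3 * h := int r, 1 := int h, 3 := 0, 2 := int h)"

lemma MB2: "2 * M < 2 ^ B" "48 < M"
  using MB Mpos by auto

lemma pre1: "runs B cPre1 m0 13 m1"
proof -
  have n: "h \<noteq> 1" "h \<noteq> 2" "h \<noteq> 3" "3 * h \<noteq> 1" "3 * h \<noteq> 2" "3 * h \<noteq> 3" using h by auto
  have a: "ev (Add 3 2 0 ;; Add 3 3 3 ;; Add 3 3 3 ;; Add 3 3 3 ;; Add 3 3 3) m0 = m0(3 := int h)"
    using m0_simps(1-3) by (simp add: h_def)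
  have "nat (int h + int h + int h) = 3 * h" by simp
  then have "ev cPre1 m0 = m1"
    unfolding cPre1_def m1_def ev.simps(6)[of "Add 3 2 0 ;; Add 3 3 3 ;; Add 3 3 3 ;; Add 3 3 3 ;; Add 3 3 3"] a
    using n m0_simps(1-3) by (simp add: fun_upd_twist)
  then show ?thesis by (intro runs_bnd m0_bnd MB) (simp_all add: cPre1_def)
qed

lemma m1_bnd: "bnd B m1"
proof -
  have "\<bar>int r\<bar> < 2 ^ B" "\<bar>int h\<bar> < 2 ^ B" "\<bar>0\<bar> < (2 ^ B :: int)"
    using inpH HM H64 h(1) by (intro less_2B; linarith)+
  moreover have "\<bar>t\<bar> < 2 ^ B" using tB Mpos by linarith
  ultimately show ?thesis unfolding m1_def by (intro bnd_upd m0_bnd)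
qed

lemma copy_loop:
  "\<exists>k m'. runs B (While 2 cCopyBody) m1 k m' \<and> k \<le> 10 * h + 1 \<and> bnd B m' \<and> m' 0 = int n \<and> m' (Suc 0) = H \<and>
     (\<forall>x. 4 \<le> x \<and> x < h \<longrightarrow> m' (h + x) = m0 x) \<and> m' h = t \<and> m' (3 * h) = int r \<and> (\<forall>x. 3 * h < x \<longrightarrow> m' x = 0)"
proof -
  let ?I = "\<lambda>j m. bnd B m \<and> j \<le> h \<and> m 2 = int (h - j) \<and> m 0 = int n \<and> m (Suc 0) = int h \<and>
     (\<forall>x. 4 \<le> x \<and> (x \<le> h + (h - j) \<or> 2 * h < x) \<longrightarrow> m x = m1 x) \<and>
     (\<forall>x. 4 \<le> x \<and> h - j < x \<and> x < h \<longrightarrow> m (h + x) = m0 x)"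
  have "\<exists>m'. runs B (While 2 cCopyBody) m1 ((6 + 1) * h + 1) m' \<and> ?I h m'"
  proof (rule runs_count_loop[where I="?I"])
    fix j m assume I: "?I j m" and jh: "j < h"
    define p where "p = h - j"
    have bm: "bnd B m" and p: "p \<le> h" "m 2 = int p" "m 0 = int n" "m (Suc 0) = int h"
      "\<And>x. 4 \<le> x \<Longrightarrow> x \<le> h + p \<or> 2 * h < x \<Longrightarrow> m x = m1 x"
      "\<And>x. 4 \<le> x \<Longrightarrow> p < x \<Longrightarrow> x < h \<Longrightarrow> m (h + x) = m0 x"
      using I unfolding p_def by auto
    obtain p' where p': "p = Suc p'" "h - Suc j = p'" using jh unfolding p_def by (metis Suc_diff_Suc)
    define v where "v = m p"
    let ?m = "m(h + p := v, 3 := 1, 2 := int p')"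
    have n: "h + p \<noteq> 1" "h + p \<noteq> 2" "h + p \<noteq> 3" using h by auto
    have "nat (int p + int h) = h + p" "m (nat (int p)) = v" by (simp_all add: v_def)
    then have "ev cCopyBody m = ?m"
      unfolding cCopyBody_def using p(2,4) n p' h(2) by (simp add: fun_upd_twist add.commute)
    then have r: "runs B cCopyBody m 6 ?m"
      by (intro runs_bnd bm MB) (simp_all add: cCopyBody_def)
    have "\<bar>int p'\<bar> < 2 ^ B" using p' p(1) h(1) HM H64 by (intro less_2B) linarith
    moreover have "\<bar>1\<bar> < (2 ^ B :: int)" using MB2 by linarith
    ultimately have "bnd B ?m" by (intro bnd_upd bm) (auto simp: v_def intro: bndD[OF bm])
    moreover have "?m (h + x) = m0 x" if "4 \<le> x" "p' < x" "x < h" for x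
    proof (cases "x = p")
      case True
      then have "v = m0 x" using p(5)[of x] that unfolding v_def m1_def by auto
      then show ?thesis using True h by auto
    next
      case False
      then show ?thesis using p(6)[of x] that p' h by auto
    qed
    moreover have "?m x = m1 x" if "4 \<le> x" "x \<le> h + p' \<or> 2 * h < x" for x
      using p(5)[of x] p(1) p' that by auto
    ultimately have "?I (Suc j) ?m" using p(1-4) p' h jh by auto
    then show "\<exists>m1. runs B cCopyBody m 6 m1 \<and> ?I (Suc j) m1" using r by blast
  next
    have "m1 0 = int n" using m0_simps(1) h by (simp add: m1_def)
    then show "?I 0 m1" using m1_bnd by (auto simp: m1_def)
  qed (use MB in auto)
  then obtain m' where l: "runs B (While 2 cCopyBody) m1 ((6 + 1) * h + 1) m'" "?I h m'" by blast
  have "m1 x = 0" if "3 * h < x" for x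
    using m0_simps(7)[of x] that h by (simp add: m1_def)
  moreover have "m1 h = t" "m1 (3 * h) = int r" using h by (auto simp: m1_def)
  ultimately show ?thesis using l h by (intro exI[of _ "(6 + 1) * h + 1"] exI[of _ m'] conjI) auto
qed

text \<open>Division by 4 through repeated subtraction: \<open>n - 3 - 4 k\<close> is positive
  exactly for \<open>k < n div 4\<close>. \<open>rQ\<close> doubles in the same rounds.\<close>

lemma q_loop:
  assumes "bnd B m" "m rOne = 1" "m rB = 4" "m rQ = 1" "m rq = 0" "m rCnt = int n - 3"
  shows "\<exists>k m'. runs B (While rCnt cQBody) m k m' \<and> k \<le> 10 * n + 1 \<and> bnd B m' \<and> m' rQ = Q \<and> m' rq = int q \<and>
     same {rQ, rq, rCnt} m m'"
proof -
  let ?I = "\<lambda>k m'. bnd B m' \<and> same {rQ, rq, rCnt} m m' \<and>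
    m' rQ = 2 ^ k \<and> m' rq = int k \<and> m' rCnt = int n - 3 - 4 * int k"
  have "\<exists>m'. runs B (While rCnt cQBody) m ((3 + 1) * q + 1) m' \<and> ?I q m'"
  proof (rule runs_count_loop[where I="?I"])
    fix k m' assume I: "?I k m'" and "k < q"
    then have bm: "bnd B m'" and s: "same {rQ, rq, rCnt} m m'" and kq: "Suc k \<le> q"
      and k: "m' rQ = 2 ^ k" "m' rq = int k" "m' rCnt = int n - 3 - 4 * int k" by auto
    define c where "c = int n - 3 - 4 * int (Suc k)"
    have c: "m' rCnt - 4 = c" using k(3) by (simp add: c_def)
    let ?m = "m'(rQ := 2 ^ Suc k, rq := int (Suc k), rCnt := c)"
    have "m' rOne = 1" "m' rB = 4" using s assms by (auto simp: same_def)
    then have "ev cQBody m' = ?m" unfolding cQBody_def using k(1,2) c by (simp add: add.commute)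
    then have r: "runs B cQBody m' 3 ?m" by (intro runs_bnd bm MB) (simp_all add: cQBody_def)
    have "(2::int) ^ Suc k \<le> Q" unfolding Q_def using kq by (intro power_increasing) auto
    then have "\<bar>2 ^ Suc k\<bar> < (2::int) ^ B" using QM Qpos Mpos by (intro less_2B) simp
    moreover have "4 * q \<le> n" by (simp add: q_def)
    then have "4 * Suc k \<le> n" using mult_le_mono2[OF kq, of 4] by (meson order_trans)
    then have "4 * int (Suc k) \<le> int n" by linarith
    then have "- 3 \<le> c" "c \<le> int n" unfolding c_def by linarith+
    then have "\<bar>int (Suc k)\<bar> < 2 ^ B" "\<bar>c\<bar> < 2 ^ B"
      using kq inpH HM H64 by (intro less_2B; linarith)+
    ultimately have "bnd B ?m" by (intro bnd_upd bm)
    moreover have "same {rQ, rq, rCnt} m ?m" using s by (auto simp: same_def)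
    ultimately have "?I (Suc k) ?m" using c_def by auto
    then show "\<exists>m1. runs B cQBody m' 3 m1 \<and> ?I (Suc k) m1" using r by blast
  next
    fix k m' assume I: "?I k m'"
    have "int n - 3 - 4 * int k > 0 \<longleftrightarrow> k < q" unfolding q_def by presburger
    then show "bnd B m' \<and> (m' rCnt > 0 \<longleftrightarrow> k < q)" using I by metis
  qed (use assms MB in auto)
  then obtain m' where "runs B (While rCnt cQBody) m ((3 + 1) * q + 1) m'" "?I q m'" by blast
  moreover have "(3 + 1) * q + 1 \<le> 10 * n + 1" by (simp add: q_def)
  ultimately show ?thesis using Q_def by blast
qed

lemma off_loop:
  assumes "bnd B m" "m rOne = 1" "m rOff = 1" "m rCnt = int (r - n)"
  shows "\<exists>k m'. runs B (While rCnt cOffBody) m k m' \<and> k \<le> 10 * r + 1 \<and> bnd B m' \<and> m' rOff = OFF \<and>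
     same {rOff, rCnt} m m'"
proof -
  let ?I = "\<lambda>k m'. bnd B m' \<and> same {rOff, rCnt} m m' \<and> m' rOff = 2 ^ k \<and> m' rCnt = int (r - n - k)"
  have "\<exists>m'. runs B (While rCnt cOffBody) m ((2 + 1) * (r - n) + 1) m' \<and> ?I (r - n) m'"
  proof (rule runs_count_loop[where I="?I"])
    fix k m' assume I: "?I k m'" and "k < r - n"
    then have bm: "bnd B m'" and s: "same {rOff, rCnt} m m'" and kq: "Suc k \<le> r - n"
      and k: "m' rOff = 2 ^ k" "m' rCnt = int (r - n - k)" by auto
    define c where "c = int (r - n - Suc k)"
    have c: "m' rCnt - 1 = c" using k(2) kq by (simp add: c_def)
    let ?m = "m'(rOff := 2 ^ Suc k, rCnt := c)"
    have "m' rOne = 1" using s assms by (auto simp: same_def)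
    then have "ev cOffBody m' = ?m" unfolding cOffBody_def using k(1) c by simp
    then have r: "runs B cOffBody m' 2 ?m" by (intro runs_bnd bm MB) (simp_all add: cOffBody_def)
    have "(2::int) ^ Suc k \<le> OFF" unfolding OFF_def using kq by (intro power_increasing) auto
    then have "\<bar>2 ^ Suc k\<bar> < (2::int) ^ B" using OFF_M OFFpos by (intro less_2B) simp
    moreover have "\<bar>c\<bar> < 2 ^ B"
      using inpH HM H64 c_def by (intro less_2B) linarith
    ultimately have "bnd B ?m" by (intro bnd_upd bm)
    moreover have "same {rOff, rCnt} m ?m" using s by (auto simp: same_def)
    ultimately have "?I (Suc k) ?m" using c_def by auto
    then show "\<exists>m1. runs B cOffBody m' 2 m1 \<and> ?I (Suc k) m1" using r by blast
  qed (use assms MB in auto)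
  then obtain m' where "runs B (While rCnt cOffBody) m ((2 + 1) * (r - n) + 1) m'" "?I (r - n) m'" by blast
  moreover have "(2 + 1) * (r - n) + 1 \<le> 10 * r + 1" by simp
  ultimately show ?thesis using OFF_def by blast
qed

lemma proof_loop:
  assumes "bnd B m" "m rOne = 1" "m rS = 0" "m rI = int q" "m rCnt = int (h + 4 + n + r)"
    and inp: "\<And>x. 4 \<le> x \<Longrightarrow> x < h \<Longrightarrow> m (h + x) = m0 x"
  shows "\<exists>k m'. runs B (While rI cProofBody) m k m' \<and> k \<le> 10 * n + 1 \<and> bnd B m' \<and> m' rS = bval pb \<and>
     same {rS, rA, rCnt, rI} m m'"
proof -
  let ?X = "{rS, rA, rCnt, rI}"
  let ?I = "\<lambda>k m'. bnd B m' \<and> same ?X m m' \<and> m' rS = bval (take k pb) \<and>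
    m' rCnt = int (h + 4 + n + r + k) \<and> m' rI = int (q - k)"
  have len: "length pb = q" by (simp add: pb_def)
  have "\<exists>m'. runs B (While rI cProofBody) m ((5 + 1) * q + 1) m' \<and> ?I q m'"
  proof (rule runs_count_loop[where I="?I"])
    fix k m' assume I: "?I k m'" and kq: "k < q"
    then have bm: "bnd B m'" and s: "same ?X m m'" and k: "m' rS = bval (take k pb)"
      "m' rCnt = int (h + 4 + n + r + k)" "m' rI = int (q - k)" by auto
    define b where "b = pb ! k"
    have "m' (h + (4 + n + r + k)) = m (h + (4 + n + r + k))" using h by (intro sameD[OF s]) auto
    also have "\<dots> = m0 (4 + n + r + k)" using kq h by (intro inp) auto
    also have "\<dots> = of_bool b" using m0_simps(6)[OF kq] by (simp add: b_def)
    finally have ld: "m' (h + (4 + n + r + k)) = of_bool b" .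
    have a: "nat (m' rCnt) = h + (4 + n + r + k)" using k(2) by simp
    have tk: "bval (take (Suc k) pb) = 2 * bval (take k pb) + of_bool b"
      using kq len by (simp add: take_Suc_conv_app_nth b_def)
    define c1 c2 where "c1 = int (h + 4 + n + r + Suc k)" and "c2 = int (q - Suc k)"
    have c: "m' rCnt + 1 = c1" "m' rI - 1 = c2" using k(2,3) kq by (simp_all add: c1_def c2_def)
    let ?m = "m'(rA := of_bool b, rS := bval (take (Suc k) pb), rCnt := c1, rI := c2)"
    have "h + (4 + n + r + k) \<noteq> rS" using h by auto
    then have "ev cProofBody m' = ?m" unfolding cProofBody_def
      using k(1) a ld tk s assms(2) c by (simp add: same_def)
    then have r: "runs B cProofBody m' 5 ?m" by (intro runs_bnd bm MB) (simp_all add: cProofBody_def)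
    have "bval (take (Suc k) pb) < 2 ^ length (take (Suc k) pb)" by (rule bval_less)
    also have "\<dots> \<le> Q" unfolding Q_def using len by (intro power_increasing) auto
    finally have "\<bar>bval (take (Suc k) pb)\<bar> < 2 ^ B" using bval_nonneg[of "take (Suc k) pb"] QM Mpos by (intro less_2B) linarith
    moreover have "\<bar>of_bool b\<bar> < (2 ^ B :: int)" using MB2 by (cases b) auto
    moreover have "\<bar>c1\<bar> < 2 ^ B" "\<bar>c2\<bar> < 2 ^ B"
      using h kq inpH HM H64 c1_def c2_def by (intro less_2B; linarith)+
    ultimately have "bnd B ?m" by (intro bnd_upd bm)
    moreover have "same ?X m ?m" using s by (auto simp: same_def)
    ultimately have "?I (Suc k) ?m" using c1_def c2_def by auto
    then show "\<exists>m1. runs B cProofBody m' 5 m1 \<and> ?I (Suc k) m1" using r by blast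
  qed (use assms MB in auto)
  then obtain m' where l: "runs B (While rI cProofBody) m ((5 + 1) * q + 1) m'" "?I q m'" by blast
  have "(5 + 1) * q + 1 \<le> 10 * n + 1" by (simp add: q_def)
  then show ?thesis using l len by (intro exI[of _ "(5 + 1) * q + 1"] exI[of _ m']) auto
qed

lemma ev_fuel: "m rQ = Q \<Longrightarrow> ev cFuel m = m(rF := 131072 * Q)"
  unfolding cFuel_def by simp

text \<open>The four shifted sums add up to a number strictly between 0 and
  \<open>8 * OFF < M\<close>. A target outside the range from 0 to \<open>M\<close> is thus hopeless
  and is replaced by 0, which no sum of positive keys attains; this keeps the tested addresses
  bounded.\<close>

lemma clamp_runs:
  assumes "bnd B m" "m rOff = OFF" "m rT = t"
  shows "\<exists>a. runs B cPre4 m 20 (m(rM := M, rT := \<tau>, rA := a)) \<and> bnd B (m(rM := M, rT := \<tau>, rA := a))"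
proof -
  have OM: "OFF + OFF + (OFF + OFF) + (OFF + OFF + (OFF + OFF)) + (OFF + OFF + (OFF + OFF) + (OFF + OFF + (OFF + OFF))) = M"
    using M_def by simp
  define t' where "t' = t + (OFF + OFF + (OFF + OFF))"
  have t': "t' = t + 4 * OFF" by (simp add: t'_def)
  define a where "a = (if t' > 0 then (if M - t' > 0 then 0 else M - t') else OFF + OFF + (OFF + OFF))"
  have 1: "ev (Add rM rOff rOff ;; Add rM rM rM ;; Add rM rM rM ;; Add rM rM rM ;;
     Add rA rOff rOff ;; Add rA rA rA ;; Add rT rT rA) m = m(rM := M, rA := OFF + OFF + (OFF + OFF), rT := t')"
    using assms(2,3) OM unfolding t'_def by simp
  have "\<bar>a\<bar> < 2 ^ B" unfolding a_def using tB t' M_def OFFpos by auto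
  moreover have "\<bar>M\<bar> < 2 ^ B" "\<bar>\<tau>\<bar> < 2 ^ B" using tau Mpos by (intro less_2B; linarith)+
  moreover have "ev cPre4 m = m(rM := M, rT := \<tau>, rA := a)"
  proof -
    have "ev cPre4 m = ev (If rT (Sub rA rM rT ;; If rA Skip (Const rT 0)) (Const rT 0))
       (m(rM := M, rA := OFF + OFF + (OFF + OFF), rT := t'))"
      unfolding 1[symmetric] cPre4_def by (simp only: ev.simps(6))
    also have "\<dots> = m(rM := M, rT := \<tau>, rA := a)"
      unfolding tau_def t'[symmetric] a_def by (simp add: fun_upd_twist)
    finally show ?thesis .
  qed
  moreover have "runs B cPre4 m 20 (ev cPre4 m)"
    using MB by (intro runs_bnd assms(1)) (simp_all add: cPre4_def)
  ultimately show ?thesis using assms(1) by (auto simp del: fun_upd_apply intro!: bnd_upd)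
qed

abbreviation preX :: "nat set" where
  "preX \<equiv> {i. i < 64}"

lemma prelude_runs:
  "\<exists>k m'. runs B cPrelude m0 k m' \<and> k \<le> 200 * h + 200 \<and> env m' \<and> m' rS = bval pb \<and> m' rF = 131072 * Q \<and>
     m' rWP = H + 4 + int (min 0 n) \<and> m' rRem = int (n - 0) \<and> bases m' 2 3 7 9 \<and> m' rFound = 0 \<and>
     (\<forall>i. M \<le> int i \<longrightarrow> m' i = 0)"
proof -
  have nHr: "r + n < h" using h by auto
  obtain k2 m2 where c: "runs B (While 2 cCopyBody) m1 k2 m2" "k2 \<le> 10 * h + 1" "bnd B m2" "m2 0 = int n" "m2 (Suc 0) = H"
    "\<And>x. 4 \<le> x \<Longrightarrow> x < h \<Longrightarrow> m2 (h + x) = m0 x" "m2 h = t" "m2 (3 * h) = int r" "\<And>x. 3 * h < x \<Longrightarrow> m2 x = 0"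
    using copy_loop by blast
  let ?m3 = "m2(rOne := 1, rZero := 0, rT := t, rA := 3, rR := int r, rQ := 1, rq := 0, rCnt := int n - 3, rB := 4)"
  have n: "h \<noteq> i" "3 * h \<noteq> i" if "i < 64" for i using h(2) that by auto
  have "ev cPre2 m2 = ?m3"
  proof -
    have "nat H = h" "nat (H + H + H) = 3 * h" using h(1) by auto
    then show ?thesis unfolding cPre2_def using c(4,5,7,8) n by (simp add: fun_upd_twist)
  qed
  then have r3: "runs B cPre2 m2 20 ?m3" by (intro runs_bnd c(3) MB) (simp_all add: cPre2_def)
  have bs: "\<bar>int r\<bar> < 2 ^ B" "\<bar>int n - 3\<bar> < 2 ^ B" "\<bar>0\<bar> < (2 ^ B :: int)" "\<bar>1\<bar> < (2 ^ B :: int)" "\<bar>3\<bar> < (2 ^ B :: int)"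
    "\<bar>4\<bar> < (2 ^ B :: int)" "\<bar>int n\<bar> < 2 ^ B" "\<bar>int (r - n)\<bar> < 2 ^ B" "\<bar>H + int n + int r\<bar> < 2 ^ B"
    "\<bar>int (h + 4 + n + r)\<bar> < 2 ^ B" "\<bar>int q\<bar> < 2 ^ B" "\<bar>H + 4\<bar> < 2 ^ B"
    using inpH HM H64 h(1) by (intro less_2B; linarith)+
  have bt: "\<bar>t\<bar> < 2 ^ B" using tB Mpos by linarith
  have b3: "bnd B ?m3" by (intro bnd_upd c(3) bs bt)
  obtain k4 m4 where l4: "runs B (While rCnt cQBody) ?m3 k4 m4" "k4 \<le> 10 * n + 1" "bnd B m4" "m4 rQ = Q" "m4 rq = int q"
     "same {rQ, rq, rCnt} ?m3 m4"
    using q_loop[OF b3] by auto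
  have m4: "m4 0 = int n" "m4 rH = H" "m4 rR = int r" "m4 rOne = 1" "m4 rZero = 0" "m4 rT = t"
    using l4(6) c(4,5) by (auto simp: same_def)
  define d0 where "d0 = int (r - n)"
  let ?m5 = "m4(rCnt := d0, rOff := 1)"
  have "int r - int n = d0" using nr by (simp add: d0_def)
  then have "ev cPre3 m4 = ?m5" unfolding cPre3_def using m4 by simp
  then have r5: "runs B cPre3 m4 2 ?m5" by (intro runs_bnd l4(3) MB) (simp_all add: cPre3_def)
  have b5: "bnd B ?m5" by (intro bnd_upd l4(3) bs bs[folded d0_def])
  obtain k6 m6 where l6: "runs B (While rCnt cOffBody) ?m5 k6 m6" "k6 \<le> 10 * r + 1" "bnd B m6" "m6 rOff = OFF"
     "same {rOff, rCnt} ?m5 m6"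
    using off_loop[OF b5] m4(4) d0_def by auto
  have s6: "same {rOff, rCnt} m4 m6" using l6(5) by (auto simp: same_def)
  have m6: "m6 0 = int n" "m6 rH = H" "m6 rR = int r" "m6 rOne = 1" "m6 rZero = 0" "m6 rT = t" "m6 rQ = Q" "m6 rq = int q"
    using s6 m4 l4(4,5) by (auto simp: same_def)
  obtain a where r7: "runs B cPre4 m6 20 (m6(rM := M, rT := \<tau>, rA := a))" and b7: "bnd B (m6(rM := M, rT := \<tau>, rA := a))"
    using clamp_runs[OF l6(3,4) m6(6)] by blast
  let ?m7 = "m6(rM := M, rT := \<tau>, rA := a)"
  define d where "d = int (h + 4 + n + r)"
  let ?m8 = "?m7(rA := H + int n + int r, rB := 4, rCnt := d, rS := 0, rI := int q)"
  have d: "H + int n + int r + 4 = d" using h(1) by (simp add: d_def)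
  have "ev cPre5 ?m7 = ?m8" unfolding cPre5_def using m6 d by simp
  then have r8: "runs B cPre5 ?m7 10 ?m8" by (intro runs_bnd b7 MB) (simp_all add: cPre5_def)
  have b8: "bnd B ?m8" by (intro bnd_upd b7 bs bs[folded d_def])
  have s8: "same preX m2 ?m8" using l4(6) s6 by (auto simp: same_def)
  have inp8: "?m8 (h + x) = m0 x" if "4 \<le> x" "x < h" for x
    using sameD[OF s8, of "h + x"] c(6)[OF that] h(2) by simp
  have x8: "?m8 rOne = 1" "?m8 rS = 0" "?m8 rI = int q" "?m8 rCnt = int (h + 4 + n + r)"
    using m6(4) by (simp_all add: d_def)
  obtain k9 m9 where l9: "runs B (While rI cProofBody) ?m8 k9 m9" "k9 \<le> 10 * n + 1" "bnd B m9" "m9 rS = bval pb"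
     "same {rS, rA, rCnt, rI} ?m8 m9"
    using proof_loop[OF b8 x8 inp8] by blast
  have m9: "m9 0 = int n" "m9 rH = H" "m9 rR = int r" "m9 rOne = 1" "m9 rZero = 0" "m9 rT = \<tau>" "m9 rQ = Q" "m9 rM = M" "m9 rOff = OFF"
    using l9(5) m6 l6(4) by (auto simp: same_def)
  let ?m10 = "m9(rB := 4, rWP := H + 4, rRem := int n, rBH := 2 * M, rBN := 3 * M, rBW := 7 * M, rBR := 9 * M,
     rFound := 0, rF := 131072 * Q)"
  have r10: "runs B cPre6 m9 40 ?m10"
  proof -
    have "M + M = 2 * M" "2 * M + M = 3 * M" "2 * M + 2 * M = 4 * M" "4 * M + 3 * M = 7 * M" "7 * M + 2 * M = 9 * M" by auto
    then have "ev cPre6 m9 = ?m10" unfolding cPre6_def using m9 by (simp add: ev_fuel)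
    then show ?thesis using l9(3) MB by (intro runs_bnd) (simp_all add: cPre6_def cFuel_def)
  qed
  have "\<bar>2 * M\<bar> < 2 ^ B" "\<bar>3 * M\<bar> < 2 ^ B" "\<bar>7 * M\<bar> < 2 ^ B" "\<bar>9 * M\<bar> < 2 ^ B" "\<bar>131072 * Q\<bar> < 2 ^ B"
    using FB Qpos Mpos by (intro less_2B; linarith)+
  then have b10: "bnd B ?m10" by (intro bnd_upd l9(3) bs)
  have s10: "same preX m2 ?m10" using s8 l9(5) by (auto simp: same_def)
  have big: "?m10 x = m2 x" if "64 \<le> x" for x using sameD[OF s10] that by auto
  have "?m10 (nat (H + 4 + int i)) = as ! i" if "i < n" for i
  proof -
    have "nat (H + 4 + int i) = h + (4 + i)" using h(1) by auto
    moreover have "?m10 (h + (4 + i)) = m0 (4 + i)" using big[of "h + (4 + i)"] c(6)[of "4 + i"] that h by simp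
    ultimately show ?thesis using m0_simps(4)[OF that] by simp
  qed
  moreover have "?m10 (nat (H + 4 + int n + int j)) = of_bool (rho ! j)" if "j < r" for j
  proof -
    have "nat (H + 4 + int n + int j) = h + (4 + n + j)" using h(1) by auto
    moreover have "?m10 (h + (4 + n + j)) = m0 (4 + n + j)" using big[of "h + (4 + n + j)"] c(6)[of "4 + n + j"] that h by simp
    ultimately show ?thesis using m0_simps(5)[OF that] by simp
  qed
  ultimately have e10: "env ?m10" using b10 m9 unfolding env_def by simp
  have z10: "?m10 i = 0" if "M \<le> int i" for i
    using big[of i] c(9)[of i] that HM h(1,2) by simp
  let ?K = "13 + (k2 + (20 + (k4 + (2 + (k6 + (20 + (10 + (k9 + 40))))))))"
  have "runs B cPrelude m0 ?K ?m10"
    unfolding cPrelude_def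
    by (intro runs_seq[OF pre1] runs_seq[OF c(1)] runs_seq[OF r3] runs_seq[OF l4(1)] runs_seq[OF r5]
        runs_seq[OF l6(1)] runs_seq[OF r7] runs_seq[OF r8] runs_seq[OF l9(1)] r10)
  moreover have "?K \<le> 200 * h + 200" using c(2) l4(2) l6(2) l9(2) nHr by simp
  \<comment> \<open>Region 1 is the table of block sums, regions 2, 3 and later 4, 5 hold the
    buckets, 7 and 9 the marks. Regions 6 and 8 are left blank below the marks for the tests that
    miss them.\<close>
  moreover have "bases ?m10 2 3 7 9" by (simp add: bases_def)
  ultimately show ?thesis using e10 z10 l9(4) by (intro exI[of _ ?K] exI[of _ ?m10] conjI) auto
qed

end

section \<open>The whole run\<close>

lemma set_decode_subset:
  assumes "i < 2 * 2 ^ q"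
  shows "set_decode i \<subseteq> {..<q + 1}"
proof
  fix k assume "k \<in> set_decode i"
  then have "i div 2 ^ k \<noteq> 0" by (auto simp: set_decode_def intro!: Nat.gr0I)
  then have "2 ^ k \<le> i" by (meson div_less not_less)
  then have "(2::nat) ^ k < 2 ^ (q + 1)" using assms by simp
  then show "k \<in> {..<q + 1}" using power_less_imp_less_exp[of "2::nat" k "q + 1"] by simp
qed

lemma set_encode_less:
  assumes "A \<subseteq> {..<N}"
  shows "set_encode A < 2 ^ N"
proof -
  have "set_encode A \<le> (\<Sum>a\<in>{0..<N}. 2 ^ a)"
    unfolding set_encode_def using assms by (intro sum_mono2) auto
  also have "\<dots> < 2 ^ N" by (simp add: sum_power2)
  finally show ?thesis .
qed

text \<open>The hash with \<open>A\<close> as an argument, needed for counting over all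
  \<open>A\<close>: inside the locale \<open>rho\<close> is fixed.\<close>

definition hashf :: "int \<Rightarrow> int \<Rightarrow> int \<Rightarrow> int \<Rightarrow> int" where
  "hashf Q M A x = (A * x div M) mod Q"

text \<open>The four residues modulo \<open>M\<close> add up to less than \<open>4 * M\<close>, so
  the carry \<open>e\<close> that the separate quotients lose is below 4.\<close>

lemma hashf_sum4:
  fixes M Q :: int
  assumes M: "0 < M" and s: "x1 + x2 + x3 + x4 = s"
  obtains e :: nat where "e < 4" "(hashf Q M A x1 + hashf Q M A x2 + (hashf Q M A x3 + hashf Q M A x4 + int e)) mod Q = hashf Q M A s"
proof -
  define d where "d x = A * x div M" for x
  define p where "p x = A * x mod M" for x
  have dp: "A * x = d x * M + p x" "0 \<le> p x" "p x < M" for x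
    using M by (simp_all add: d_def p_def)
  define P where "P = p x1 + p x2 + p x3 + p x4"
  have P: "0 \<le> P" "P < 4 * M" unfolding P_def using dp(2,3)[of x1] dp(2,3)[of x2] dp(2,3)[of x3] dp(2,3)[of x4] by linarith+
  have "A * s = A * x1 + A * x2 + A * x3 + A * x4" unfolding s[symmetric] by (simp add: algebra_simps)
  also have "\<dots> = P + (d x1 + d x2 + d x3 + d x4) * M" unfolding P_def dp(1) by (simp add: algebra_simps)
  finally have "d s = (P + (d x1 + d x2 + d x3 + d x4) * M) div M" unfolding d_def by simp
  then have ds: "d s = d x1 + d x2 + (d x3 + d x4 + P div M)" using M by simp
  have "P div M * M \<le> P" using M mod_div_mult_eq[of P M] pos_mod_sign[of M P] by linarith
  then have "P div M * M < 4 * M" using P by linarith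
  then have "P div M < 4" using M by (simp add: mult_less_cancel_right)
  moreover have "0 \<le> P div M" using P M by (simp add: pos_imp_zdiv_nonneg_iff)
  ultimately have e: "P div M = int (nat (P div M))" "nat (P div M) < 4" by auto
  have hs: "hashf Q M A x = d x mod Q" for x unfolding hashf_def d_def ..
  have "(hashf Q M A x1 + hashf Q M A x2 + (hashf Q M A x3 + hashf Q M A x4 + P div M)) mod Q = hashf Q M A s"
    unfolding hs ds by (intro mod_add_cong refl) simp_all
  then have "(hashf Q M A x1 + hashf Q M A x2 + (hashf Q M A x3 + hashf Q M A x4 + int (nat (P div M)))) mod Q = hashf Q M A s"
    unfolding e(1)[symmetric] .
  then show ?thesis using e(2) that by blast
qed

section \<open>Solutions as quadruples of block sums\<close>

context verifier
begin

text \<open>Positions of block \<open>j\<close> have quotient \<open>j\<close> on division by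
  \<open>q + 1\<close>, so the four index sets are disjoint and their union is a solution once the
  positions beyond \<open>n\<close>, of weight 0, are dropped.\<close>

lemma gsum_sum4:
  assumes "i1 < 2 * 2 ^ q" "i2 < 2 * 2 ^ q" "i3 < 2 * 2 ^ q" "i4 < 2 * 2 ^ q"
    and "gsum 0 i1 + gsum (q + 1) i2 + (gsum (2 * (q + 1)) i3 + gsum (3 * (q + 1)) i4) = t + 4 * OFF"
  shows "subset_sum_yes as t"
proof -
  define K where "K j i = (\<lambda>k. j * (q + 1) + k) ` set_decode i" for j i
  have g: "gsum (j * (q + 1)) i = OFF + (\<Sum>k\<in>K j i. wt k)" for j i
    unfolding gsum_def K_def by (subst sum.reindex) auto
  have div: "k div (q + 1) = j" if "k \<in> K j i" "i < 2 * 2 ^ q" for k j i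
  proof -
    obtain l where "k = j * (q + 1) + l" "l < q + 1"
      using \<open>k \<in> K j i\<close> set_decode_subset[OF \<open>i < 2 * 2 ^ q\<close>] unfolding K_def by blast
    then show ?thesis by (metis add.right_neutral add_gr_0 div_less div_mult_self3 less_one zero_less_iff_neq_zero)
  qed
  have fin: "finite (K j i)" for j i unfolding K_def by simp
  have dis: "K j i \<inter> K j' i' = {}" if "j \<noteq> j'" "i < 2 * 2 ^ q" "i' < 2 * 2 ^ q" for j j' i i'
    using div that by blast
  have 0: "K 0 i1 \<inter> K 1 i2 = {}" "(K 0 i1 \<union> K 1 i2) \<inter> K 2 i3 = {}" "(K 0 i1 \<union> K 1 i2 \<union> K 2 i3) \<inter> K 3 i4 = {}"
    using dis[of 0 1 i1 i2] dis[of 0 2 i1 i3] dis[of 1 2 i2 i3] dis[of 0 3 i1 i4] dis[of 1 3 i2 i4] dis[of 2 3 i3 i4] assms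
    by auto
  let ?K = "K 0 i1 \<union> K 1 i2 \<union> K 2 i3 \<union> K 3 i4"
  have "(\<Sum>k\<in>?K. wt k) = (\<Sum>k\<in>K 0 i1. wt k) + (\<Sum>k\<in>K 1 i2. wt k) + (\<Sum>k\<in>K 2 i3. wt k) + (\<Sum>k\<in>K 3 i4. wt k)"
    using 0 fin by (simp add: sum.union_disjoint)
  also have "\<dots> = t" using assms(5) g[of 0 i1] g[of 1 i2] g[of 2 i3] g[of 3 i4] by simp
  finally have t: "(\<Sum>k\<in>?K. wt k) = t" .
  have "(\<Sum>k\<in>?K \<inter> {..<n}. as ! k) = (\<Sum>k\<in>?K \<inter> {..<n}. wt k)"
    by (intro sum.cong) (auto simp: wt_def)
  also have "\<dots> = (\<Sum>k\<in>?K. wt k)"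
    using fin by (intro sum.mono_neutral_left) (auto simp: wt_def)
  finally show ?thesis using t unfolding subset_sum_yes_def n_def by (intro exI[of _ "?K \<inter> {..<n}"]) (auto simp: n_def)
qed

text \<open>The solution is cut into classes by the quotient on division by \<open>q + 1\<close>;
  the remainders of each class are the binary digits of the wanted index.\<close>

lemma subset_sum_gsums:
  assumes "subset_sum_yes as t" "n \<le> 4 * (q + 1)"
  obtains i1 i2 i3 i4 where "i1 < 2 * 2 ^ q" "i2 < 2 * 2 ^ q" "i3 < 2 * 2 ^ q" "i4 < 2 * 2 ^ q"
    "gsum 0 i1 + gsum (q + 1) i2 + (gsum (2 * (q + 1)) i3 + gsum (3 * (q + 1)) i4) = t + 4 * OFF"
proof -
  obtain S where S: "S \<subseteq> {..<n}" "(\<Sum>i\<in>S. as ! i) = t"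
    using assms(1) unfolding subset_sum_yes_def n_def by blast
  define T where "T j = {k. k < q + 1 \<and> j * (q + 1) + k \<in> S}" for j
  define i where "i j = set_encode (T j)" for j
  have T: "T j \<subseteq> {..<q + 1}" for j unfolding T_def by auto
  then have fT: "finite (T j)" for j by (rule finite_subset) simp
  have il: "i j < 2 * 2 ^ q" for j unfolding i_def using set_encode_less[OF T] by simp
  have fS: "finite S" using S(1) by (rule finite_subset) simp
  have g: "gsum (j * (q + 1)) (i j) = OFF + (\<Sum>k\<in>{k\<in>S. k div (q + 1) = j}. as ! k)" for j
  proof -
    have e: "{k\<in>S. k div (q + 1) = j} = (\<lambda>k. j * (q + 1) + k) ` T j"
    proof
      show "{k\<in>S. k div (q + 1) = j} \<subseteq> (\<lambda>k. j * (q + 1) + k) ` T j"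
      proof
        fix k assume k: "k \<in> {k\<in>S. k div (q + 1) = j}"
        then have "k = j * (q + 1) + k mod (q + 1)" by (metis (mono_tags, lifting) div_mult_mod_eq mem_Collect_eq)
        moreover have "k mod (q + 1) < q + 1" by (rule mod_less_divisor) simp
        ultimately show "k \<in> (\<lambda>k. j * (q + 1) + k) ` T j" using k unfolding T_def by (metis (mono_tags, lifting) imageI mem_Collect_eq)
      qed
      have "(j * (q + 1) + k) div (q + 1) = j" if "k < q + 1" for k
        using that by (metis add.right_neutral add_gr_0 div_less div_mult_self3 less_one zero_less_iff_neq_zero)
      then show "(\<lambda>k. j * (q + 1) + k) ` T j \<subseteq> {k\<in>S. k div (q + 1) = j}" unfolding T_def by auto
    qed
    have "(\<Sum>k\<in>T j. wt (j * (q + 1) + k)) = (\<Sum>k\<in>{k\<in>S. k div (q + 1) = j}. wt k)"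
      unfolding e by (subst sum.reindex) auto
    also have "\<dots> = (\<Sum>k\<in>{k\<in>S. k div (q + 1) = j}. as ! k)"
      using S(1) by (intro sum.cong) (auto simp: wt_def)
    finally show ?thesis unfolding gsum_def i_def using fT by (simp add: set_encode_inverse)
  qed
  have "k div (q + 1) < 4" if "k \<in> S" for k
  proof -
    have "k < 4 * (q + 1)" using that S(1) assms(2) by auto
    then show ?thesis by (rule less_mult_imp_div_less)
  qed
  then have "(\<Sum>j<4. \<Sum>k\<in>{k\<in>S. k div (q + 1) = j}. as ! k) = (\<Sum>k\<in>S. as ! k)"
    using fS by (intro sum.group) auto
  moreover have "(\<Sum>j<4. \<Sum>k\<in>{k\<in>S. k div (q + 1) = j}. as ! k) =
     (\<Sum>k\<in>{k\<in>S. k div (q + 1) = 0}. as ! k) + (\<Sum>k\<in>{k\<in>S. k div (q + 1) = 1}. as ! k) +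
     (\<Sum>k\<in>{k\<in>S. k div (q + 1) = 2}. as ! k) + (\<Sum>k\<in>{k\<in>S. k div (q + 1) = 3}. as ! k)"
    by (rule sum_lessThan_4)
  ultimately have "gsum 0 (i 0) + gsum (q + 1) (i 1) + (gsum (2 * (q + 1)) (i 2) + gsum (3 * (q + 1)) (i 3)) = t + 4 * OFF"
    using g[of 0] g[of 1] g[of 2] g[of 3] S(2) by simp
  then show ?thesis using that il by blast
qed

lemma hash_eq_hashf: "hash x = hashf Q M (bval rho) x"
  by (simp add: hash_def hashf_def)

end

section \<open>The two phases combined\<close>

context verifier_run
begin

definition \<sigma>1 :: int where "\<sigma>1 = bval pb"
definition \<sigma>2 :: int where "\<sigma>2 = (hash \<tau> - \<sigma>1) mod Q"
definition blk :: "nat \<Rightarrow> int set" where "blk j = gsum (j * (q + 1)) ` {..<2 * 2 ^ q}"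
definition cost1 :: nat where "cost1 = (\<Sum>i<2 * 2 ^ q. jcost \<sigma>1 (gsum (q + 1) i) (blk 0))"
definition cost2 :: nat where "cost2 = (\<Sum>i<2 * 2 ^ q. jcost \<sigma>2 (gsum (3 * (q + 1)) i) (blk 2))"

lemma mid_runs:
  assumes e: "env m" and b: "bases m 2 3 7 9" and s: "m rS = \<sigma>1"
  shows "\<exists>k m'. runs B (Mov rX rT ;; cHash ;; cMid) m k m' \<and> k \<le> 31 * r + 100 \<and> env m' \<and> bases m' 4 5 9 7 \<and>
     m' rS = \<sigma>2 \<and> m' rF = 131072 * Q \<and> m' rFound = 0 \<and>
     same {rX, rHX, rY, rA, rCnt, rB, rS, rBH, rBN, rBR, rBW, rFound, rF} m m'"
proof -
  let ?m1 = "m(rX := \<tau>)"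
  have r1: "runs B (Mov rX rT) m 1 ?m1" using envD[OF e] by (intro runs_lf[OF e]) auto
  have e1: "env ?m1" using tau Mpos by (intro env_upd e less_2B) auto
  obtain m2 where m2: "runs B cHash ?m1 (31 * r + 7) m2" "env m2" "m2 rHX = hash \<tau>" "same {rY, rHX, rA, rCnt, rB} ?m1 m2"
    using hash_runs[OF e1, of \<tau>] tau by auto
  have reg: "m2 rS = \<sigma>1" "m2 rBH = 2 * M" "m2 rBW = 7 * M" "m2 rBR = 9 * M"
    using m2(4) b s by (auto simp: same_def bases_def)
  have sr: "0 \<le> \<sigma>1" "\<sigma>1 < Q"
    unfolding \<sigma>1_def using bval_nonneg bval_less[of pb] Q_def by (auto simp: pb_def)
  let ?m3 = "m2(rS := \<sigma>2, rBH := 4 * M, rBN := 5 * M, rA := 9 * M, rBR := 7 * M, rBW := 9 * M, rFound := 0, rF := 131072 * Q)"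
  have s2: "(if hash \<tau> - \<sigma>1 < 0 then hash \<tau> - \<sigma>1 + Q else hash \<tau> - \<sigma>1) = \<sigma>2"
  proof (cases "hash \<tau> - \<sigma>1 < 0")
    case True
    have "(hash \<tau> - \<sigma>1) mod Q = (hash \<tau> - \<sigma>1 + Q) mod Q" by simp
    also have "\<dots> = hash \<tau> - \<sigma>1 + Q" using True sr hash_range[of \<tau>] by (intro mod_pos_pos_trivial) auto
    finally show ?thesis using True by (simp add: \<sigma>2_def)
  next
    case False
    then show ?thesis using sr hash_range[of \<tau>] by (simp add: \<sigma>2_def)
  qed
  have "ev cMid m2 = ?m3"
  proof -
    have "2 * M + 2 * M = 4 * M" "4 * M + M = 5 * M" by auto
    then show ?thesis unfolding cMid_def using reg m2(3) envD[OF m2(2)] s2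
      by (cases "hash \<tau> - \<sigma>1 < 0") (simp_all add: ev_fuel)
  qed
  then have r3: "runs B cMid m2 40 ?m3" by (intro runs_lf[OF m2(2)]) (simp_all add: cMid_def cFuel_def)
  have "0 \<le> \<sigma>2" "\<sigma>2 < Q" unfolding \<sigma>2_def using Qpos by auto
  then have e3: "env ?m3" using FB QM Qpos Mpos by (intro env_upd m2(2) less_2B) auto
  have "runs B (Mov rX rT ;; cHash ;; cMid) m (1 + ((31 * r + 7) + 40)) ?m3"
    by (rule runs_seq[OF r1 runs_seq[OF m2(1) r3]])
  moreover have "bases ?m3 4 5 9 7" unfolding bases_def by simp
  moreover have "same {rX, rHX, rY, rA, rCnt, rB, rS, rBH, rBN, rBR, rBW, rFound, rF} m ?m3"
    using m2(4) by (auto simp: same_def)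
  ultimately show ?thesis using e3
    by (intro exI[of _ "1 + ((31 * r + 7) + 40)"] exI[of _ ?m3] conjI) simp_all
qed

lemma verifier_runs:
  "\<exists>k m'. runs B cVerifier m0 k m' \<and> k \<le> (10000000 + 1000 * h) * 2 ^ q \<and>
     (m' 0 > 0 \<longrightarrow> subset_sum_yes as t) \<and>
     (cost1 \<le> 131072 * 2 ^ q \<and> cost2 \<le> 131072 * 2 ^ q \<and>
      (\<exists>x1\<in>blk 0. \<exists>i2<2 * 2 ^ q. \<exists>x3\<in>blk 2. \<exists>i4<2 * 2 ^ q.
         x1 + gsum (q + 1) i2 + (x3 + gsum (3 * (q + 1)) i4) = \<tau> \<and> (hash x1 + hash (gsum (q + 1) i2)) mod Q = \<sigma>1)
      \<longrightarrow> m' 0 > 0)"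
proof -
  let ?F = "131072 * 2 ^ q :: nat"
  let ?N = "2 * 2 ^ q :: nat"
  have FQ: "131072 * Q = int ?F" "int ?F < M" using FB Q_def by auto
  have sr: "0 \<le> \<sigma>1" "\<sigma>1 < Q" "0 \<le> \<sigma>2" "\<sigma>2 < Q"
    unfolding \<sigma>1_def \<sigma>2_def using bval_nonneg bval_less[of pb] Q_def Qpos by (auto simp: pb_def)
  have gr: "0 < gsum u i" "gsum u i < 2 * OFF" for u i by (rule gsum_range)+
  obtain k1 m1 where p1: "runs B cPrelude m0 k1 m1" "k1 \<le> 200 * h + 200" "env m1" "m1 rS = \<sigma>1" "m1 rF = int ?F"
     "m1 rWP = H + 4 + int (min 0 n)" "m1 rRem = int (n - 0)" "bases m1 2 3 7 9" "m1 rFound = 0"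
     "\<And>i. M \<le> int i \<Longrightarrow> m1 i = 0"
    using prelude_runs unfolding FQ(1) \<sigma>1_def by blast
  have z1: "m1 i = 0" if "i \<in> region k" "1 \<le> k" for i k using p1(10) region_ge that by blast
  have z23: "m1 i = 0" if "i \<in> region 2 \<union> region 3" for i using z1[of i 2] z1[of i 3] that by auto
  let ?X1 = "genX \<union> joinX 7 \<union> region 2 \<union> region 3"
  obtain m2 k2 D1 where p2: "runs B cPhase m1 k2 m2" "env m2" "k2 \<le> 25 * ?F + (124 * r + 1000) * 2 ^ q + 50"
     "m2 rWP = H + 4 + int (min (0 + 2 * (q + 1)) n)" "m2 rRem = int (n - (0 + 2 * (q + 1)))"
     "same ?X1 m1 m2" "eff 7 9 m1 m2 D1"
     "D1 \<subseteq> {gsum (0 + q + 1) i + y | i y. i < ?N \<and> y \<in> gsum 0 ` {..<?N}}"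
     "(\<Sum>i<?N. jcost \<sigma>1 (gsum (0 + q + 1) i) (gsum 0 ` {..<?N})) \<le> ?F \<longrightarrow>
       (\<forall>i<?N. msum \<sigma>1 (gsum (0 + q + 1) i) (gsum 0 ` {..<?N}) \<subseteq> D1)"
    using phase_runs[OF p1(3,8,6,7) z23 p1(4) sr(1,2) p1(5) FQ(2)] by blast
  have S2: "m2 rS = \<sigma>1" using p2(6) p1(4) by (auto simp: same_def)
  have b2: "bases m2 2 3 7 9" by (rule bases_same[OF p1(8) p2(6)]) auto
  obtain k3 m3 where p3: "runs B (Mov rX rT ;; cHash ;; cMid) m2 k3 m3" "k3 \<le> 31 * r + 100" "env m3" "bases m3 4 5 9 7"
     "m3 rS = \<sigma>2" "m3 rF = int ?F" "m3 rFound = 0"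
     "same {rX, rHX, rY, rA, rCnt, rB, rS, rBH, rBN, rBR, rBW, rFound, rF} m2 m3"
    using mid_runs[OF p2(2) b2 S2] unfolding FQ(1) by blast
  have s3: "m3 i = m2 i" if "64 \<le> i" for i using that by (intro sameD[OF p3(8)]) auto
  have keep: "m3 i = 0" if "i \<in> region k" "4 \<le> k" "k \<noteq> 7" for i k
  proof -
    have "64 \<le> i" using region_ge[OF that(1)] that(2) Mpos by linarith
    moreover have "m2 i = m1 i"
      using \<open>64 \<le> i\<close> that region_disjoint[OF _ _ _ that(1), of 1] region_disjoint[OF _ _ _ that(1), of 2]
        region_disjoint[OF _ _ _ that(1), of 3] region_disjoint[OF _ _ _ that(1), of 7]
      by (intro sameD[OF p2(6)]) auto
    ultimately show ?thesis using s3 z1[OF that(1)] that(2) by simp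
  qed
  have z45: "m3 i = 0" if "i \<in> region 4 \<union> region 5" for i using keep[of i 4] keep[of i 5] that by auto
  have w3: "m3 rWP = H + 4 + int (min (2 * (q + 1)) n)" "m3 rRem = int (n - 2 * (q + 1))"
    using p2(4,5) p3(8) by (auto simp: same_def)
  let ?X3 = "genX \<union> joinX 9 \<union> region 4 \<union> region 5"
  let ?u = "2 * (q + 1)"
  obtain m4 k4 D2 where p4: "runs B cPhase m3 k4 m4" "env m4" "k4 \<le> 25 * ?F + (124 * r + 1000) * 2 ^ q + 50"
     "same ?X3 m3 m4" "eff 9 7 m3 m4 D2"
     "D2 \<subseteq> {gsum (?u + q + 1) i + y | i y. i < ?N \<and> y \<in> gsum ?u ` {..<?N}}"
     "(\<Sum>i<?N. jcost \<sigma>2 (gsum (?u + q + 1) i) (gsum ?u ` {..<?N})) \<le> ?F \<longrightarrow>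
       (\<forall>i<?N. msum \<sigma>2 (gsum (?u + q + 1) i) (gsum ?u ` {..<?N}) \<subseteq> D2)"
    using phase_runs[OF p3(3,4) w3 z45 p3(5) sr(3,4) p3(6) FQ(2)] by blast
  let ?m5 = "m4(0 := m4 rFound)"
  have r5: "runs B (Mov 0 rFound) m4 1 ?m5" using envD[OF p4(2)] by (intro runs_lf[OF p4(2)]) auto
  have u3: "?u + q + 1 = 3 * (q + 1)" by simp
  have D1: "D1 \<subseteq> {gsum (q + 1) i + y | i y. i < ?N \<and> y \<in> blk 0}" using p2(8) by (simp add: blk_def)
  have D2: "D2 \<subseteq> {gsum (3 * (q + 1)) i + y | i y. i < ?N \<and> y \<in> blk 2}" using p4(6) unfolding u3 by (simp add: blk_def)
  have blk_r: "0 < y \<and> y < 2 * OFF" if "y \<in> blk j" for y j using that gr unfolding blk_def by auto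
  have D1r: "0 < z \<and> z < M" if "z \<in> D1" for z using D1 that sum_range gr blk_r by blast
  have D2r: "0 < z \<and> z < M" if "z \<in> D2" for z using D2 that sum_range gr blk_r by blast
  have mark: "m3 (cell 7 z) > 0 \<longleftrightarrow> z \<in> D1" if z: "0 \<le> z" "z < M" for z
  proof -
    have "m1 (cell 7 z) = 0" using z1[OF cell_region[OF z]] by simp
    then show ?thesis using p2(7) z s3[of "cell 7 z"] cell_64[of 7 z] unfolding eff_def by auto
  qed
  have rd: "rd m3 7 u > 0 \<longleftrightarrow> \<tau> - u \<in> D1" if u: "0 < u" "u < M" for u
  proof (cases "0 \<le> \<tau> - u")
    case True
    have "nat (7 * M + \<tau> - u) = cell 7 (\<tau> - u)" unfolding cell_def by (simp add: algebra_simps)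
    then show ?thesis unfolding rd_def using mark[of "\<tau> - u"] True tau u by auto
  next
    case False
    \<comment> \<open>A sum exceeding \<open>\<tau>\<close> is looked up in region 6, which is still
      zero, so the test fails as it should.\<close>
    have "nat (7 * M + \<tau> - u) = cell 6 (M + \<tau> - u)" unfolding cell_def by (simp add: algebra_simps)
    then have "rd m3 7 u = 0"
      unfolding rd_def using keep[OF cell_region[of "M + \<tau> - u" 6]] False tau u by auto
    then show ?thesis using D1r[of "\<tau> - u"] False by auto
  qed
  have found: "m4 rFound > 0 \<longleftrightarrow> (\<exists>u\<in>D2. \<tau> - u \<in> D1)"
    using p4(5) p3(7) rd D2r unfolding eff_def by auto
  have sound: "subset_sum_yes as t" if pos: "?m5 0 > 0"
  proof -
    obtain u where u: "u \<in> D2" "\<tau> - u \<in> D1" using pos found by auto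
    obtain i4 i3 where 1: "u = gsum (3 * (q + 1)) i4 + gsum (2 * (q + 1)) i3" "i4 < ?N" "i3 < ?N"
      using D2 u(1) unfolding blk_def by blast
    obtain i2 i1 where 2: "\<tau> - u = gsum (q + 1) i2 + gsum (0 * (q + 1)) i1" "i2 < ?N" "i1 < ?N"
      using D1 u(2) unfolding blk_def by blast
    \<comment> \<open>\<open>\<tau>\<close> is here a sum of two positive numbers, so it is not the
      substitute value 0.\<close>
    have "0 < \<tau>" using D1r[OF u(2)] D2r[OF u(1)] by auto
    then have "\<tau> = t + 4 * OFF" unfolding tau_def by (auto split: if_splits)
    then show ?thesis using 1 2 by (intro gsum_sum4[of i1 i2 i3 i4]) auto
  qed
  have complete: "?m5 0 > 0" if c: "cost1 \<le> ?F" "cost2 \<le> ?F"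
      and x1: "x1 \<in> blk 0" and i2: "i2 < ?N" and x3: "x3 \<in> blk 2" and i4: "i4 < ?N"
      and sum: "x1 + gsum (q + 1) i2 + (x3 + gsum (3 * (q + 1)) i4) = \<tau>"
      and h: "(hash x1 + hash (gsum (q + 1) i2)) mod Q = \<sigma>1" for x1 i2 x3 i4
  proof -
    let ?x2 = "gsum (q + 1) i2" and ?x4 = "gsum (3 * (q + 1)) i4"
    \<comment> \<open>The error is 0 here: the message is exactly the hash sum of the first pair
      modulo \<open>Q\<close>. The whole rounding error of the four summands falls on the second
      pair.\<close>
    have "?x2 + x1 \<in> msum \<sigma>1 ?x2 (blk 0)"
      unfolding msum_def using x1 h by (auto simp: add.commute intro!: exI[of _ x1] exI[of _ 0])
    moreover have "msum \<sigma>1 ?x2 (blk 0) \<subseteq> D1" using p2(9) c(1) i2 unfolding cost1_def blk_def by simp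
    ultimately have 1: "?x2 + x1 \<in> D1" by blast
    have "x1 + ?x2 + x3 + ?x4 = \<tau>" "0 < M" using sum Mpos by simp_all
    then obtain e :: nat where e: "e < 4" "(hash x1 + hash ?x2 + (hash x3 + hash ?x4 + int e)) mod Q = hash \<tau>"
      unfolding hash_eq_hashf using hashf_sum4 by metis
    have "(hash \<tau> - \<sigma>1) mod Q = ((hash x1 + hash ?x2 + (hash x3 + hash ?x4 + int e)) - (hash x1 + hash ?x2)) mod Q"
      unfolding e(2)[symmetric] h[symmetric] by (rule mod_diff_eq)
    then have "(hash ?x4 + hash x3 + int e) mod Q = \<sigma>2" unfolding \<sigma>2_def by (simp add: algebra_simps)
    then have "?x4 + x3 \<in> msum \<sigma>2 ?x4 (blk 2)"
      unfolding msum_def using x3 e(1) by blast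
    moreover have "msum \<sigma>2 ?x4 (blk 2) \<subseteq> D2" using p4(7) c(2) i4 unfolding cost2_def blk_def u3 by simp
    ultimately have 2: "?x4 + x3 \<in> D2" by blast
    have "\<tau> - (?x4 + x3) = ?x2 + x1" using sum by simp
    then show ?thesis using found 1 2 by (metis fun_upd_same)
  qed
  let ?K = "k1 + (k2 + (k3 + (k4 + 1)))"
  have "runs B cVerifier m0 ?K ?m5"
    unfolding cVerifier_def by (intro runs_seq[OF p1(1)] runs_seq[OF p2(1)] runs_seq[OF p3(1)] runs_seq[OF p4(1)] r5)
  moreover have "?K \<le> (10000000 + 1000 * h) * 2 ^ q"
  proof -
    define P where "P = (2::nat) ^ q"
    have rh: "r \<le> h" using h by simp
    then have "r * P \<le> h * P" by (rule mult_le_mono1)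
    moreover have "h \<le> h * P" "1 \<le> P" unfolding P_def by simp_all
    ultimately show ?thesis using p1(2) p2(3) p3(2) p4(3) rh
      unfolding P_def[symmetric] add_mult_distrib mult.assoc by linarith
  qed
  ultimately show ?thesis using sound complete by (intro exI[of _ ?K] exI[of _ ?m5] conjI) blast+
qed

end

section \<open>Collisions\<close>

text \<open>Modulo \<open>Q * M\<close> only residues and errors survive in \<open>A\<close> times
  the difference of the pair sums. After the shift by \<open>5 * M\<close> the errors contribute
  between \<open>2 * M\<close> and \<open>8 * M\<close>, the residues strictly between
  \<open>-2 * M\<close> and \<open>2 * M\<close>, so the window begins at 0.\<close>

lemma hash_collision:
  fixes M Q :: int
  assumes M: "0 < M" and Q: "0 < Q"
    and e: "(hashf Q M A x + hashf Q M A y + int e) mod Q = (hashf Q M A x' + hashf Q M A y' + int e') mod Q"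
    and e4: "e < 4" "e' < 4"
  shows "(A * (x + y - (x' + y')) + 5 * M) mod (Q * M) < 10 * M"
proof -
  define d where "d x = A * x div M" for x
  define p where "p x = A * x mod M" for x
  have dp: "A * x = d x * M + p x" "0 \<le> p x" "p x < M" for x
    using M by (simp_all add: d_def p_def)
  have h: "hashf Q M A x = d x mod Q" for x by (simp add: hashf_def d_def)
  have "(d x + d y + int e) mod Q = (d x' + d y' + int e') mod Q"
  proof -
    have "(d u mod Q + d v mod Q + w) mod Q = (d u + d v + w) mod Q" for u v w
      by (intro mod_add_cong refl) simp_all
    then show ?thesis using e unfolding h by simp
  qed
  then obtain k where k: "d x + d y + int e - (d x' + d y' + int e') = Q * k"
    by (meson dvdE mod_eq_dvd_iff)
  define \<delta> where "\<delta> = (int e' - int e + 5) * M + (p x + p y - p x' - p y')"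
  have "A * (x + y - (x' + y')) + 5 * M = (A * x + A * y) - (A * x' + A * y') + 5 * M"
    by (simp add: algebra_simps)
  also have "\<dots> = (d x + d y + int e - (d x' + d y' + int e')) * M + \<delta>"
    unfolding dp(1) \<delta>_def by (simp add: algebra_simps)
  also have "\<dots> = \<delta> + k * (Q * M)" unfolding k by (simp add: algebra_simps)
  finally have eq: "(A * (x + y - (x' + y')) + 5 * M) mod (Q * M) = \<delta> mod (Q * M)" by simp
  have "2 * M \<le> (int e' - int e + 5) * M" "(int e' - int e + 5) * M \<le> 8 * M"
    using e4 M by (intro mult_right_mono; simp)+
  then have "0 \<le> \<delta>" "\<delta> < 10 * M"
    unfolding \<delta>_def using dp(2,3)[of x] dp(2,3)[of y] dp(2,3)[of x'] dp(2,3)[of y'] by linarith+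
  moreover have "\<delta> mod (Q * M) \<le> \<delta>"
    using \<open>0 \<le> \<delta>\<close> M Q by (intro zmod_le_nonneg_dividend) auto
  ultimately show ?thesis unfolding eq by linarith
qed

lemma card_window:
  fixes d s a L :: int
  assumes "0 < d" "0 \<le> L"
  shows "finite {A. a \<le> A * d + s \<and> A * d + s < a + L}"
    and "int (card {A. a \<le> A * d + s \<and> A * d + s < a + L}) \<le> L div d + 1"
proof -
  let ?c = "(s - a) div d"
  have sub: "{A. a \<le> A * d + s \<and> A * d + s < a + L} \<subseteq> {- ?c .. L div d - ?c}"
  proof
    fix A assume "A \<in> {A. a \<le> A * d + s \<and> A * d + s < a + L}"
    then have "0 \<le> (s - a) + A * d" "(s - a) + A * d \<le> L" by auto
    then have "0 div d \<le> ((s - a) + A * d) div d" "((s - a) + A * d) div d \<le> L div d"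
      using assms(1) by (intro zdiv_mono1; simp)+
    moreover have "((s - a) + A * d) div d = A + ?c" using assms(1) by simp
    ultimately show "A \<in> {- ?c .. L div d - ?c}" by auto
  qed
  show "finite {A. a \<le> A * d + s \<and> A * d + s < a + L}" by (rule finite_subset[OF sub]) simp
  have "card {A. a \<le> A * d + s \<and> A * d + s < a + L} \<le> card {- ?c .. L div d - ?c}"
    by (rule card_mono[OF _ sub]) simp
  moreover have "int (card {- ?c .. L div d - ?c}) = L div d + 1"
    using pos_imp_zdiv_nonneg_iff[OF assms(1), of L] assms(2) by simp
  ultimately show "int (card {A. a \<le> A * d + s \<and> A * d + s < a + L}) \<le> L div d + 1" by linarith
qed

text \<open>While \<open>A\<close> runs through \<open>N\<close> consecutive values, \<open>A * d + s\<close> winds around the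
  residues modulo \<open>R\<close> about \<open>N * d / R\<close> times and meets the window \<open>L / d + 1\<close> times per round.\<close>

lemma card_progression_mod:
  fixes d s L R N :: int
  assumes d: "0 < d" and L: "0 \<le> L" and R: "0 < R" and N: "0 \<le> N"
  shows "int (card {A \<in> {0..<N}. (A * d + s) mod R < L}) \<le> (N * d div R + 2) * (L div d + 1)"
proof -
  let ?W = "\<lambda>k. {A. k * R \<le> A * d + s \<and> A * d + s < k * R + L}"
  let ?k0 = "s div R"
  let ?K = "{?k0 .. ?k0 + (N * d div R + 1)}"
  have sub: "{A \<in> {0..<N}. (A * d + s) mod R < L} \<subseteq> (\<Union>k\<in>?K. ?W k)"
  proof
    fix A assume A: "A \<in> {A \<in> {0..<N}. (A * d + s) mod R < L}"
    define k where "k = (A * d + s) div R"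
    have e: "A * d + s = k * R + (A * d + s) mod R" unfolding k_def by simp
    have r: "0 \<le> (A * d + s) mod R" using R by simp
    have "0 \<le> A * d" "A * d \<le> N * d" using A d by (auto intro: mult_right_mono)
    then have "?k0 \<le> k" "k \<le> (N * d + s) div R" unfolding k_def using R by (intro zdiv_mono1; simp)+
    moreover have "(N * d + s) div R \<le> N * d div R + ?k0 + 1"
    proof -
      have "N * d + s < (N * d div R) * R + R + (?k0 * R + R)"
        using mod_div_mult_eq[of "N * d" R] mod_div_mult_eq[of s R] pos_mod_bound[OF R, of "N * d"] pos_mod_bound[OF R, of s]
        by linarith
      moreover have "(N * d + s) div R * R \<le> N * d + s"
        using mod_div_mult_eq[of "N * d + s" R] pos_mod_sign[OF R, of "N * d + s"] by linarith
      ultimately have "(N * d + s) div R * R < (N * d div R + ?k0 + 2) * R" by (simp add: algebra_simps)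
      then have "(N * d + s) div R < N * d div R + ?k0 + 2" using R by (simp add: mult_less_cancel_right)
      then show ?thesis by simp
    qed
    ultimately have "k \<in> ?K" by auto
    moreover have "A \<in> ?W k" using A e r by auto
    ultimately show "A \<in> (\<Union>k\<in>?K. ?W k)" by blast
  qed
  have fin: "finite (\<Union>k\<in>?K. ?W k)" using card_window(1)[OF d L] by auto
  have "card {A \<in> {0..<N}. (A * d + s) mod R < L} \<le> card (\<Union>k\<in>?K. ?W k)"
    by (rule card_mono[OF fin sub])
  also have "\<dots> \<le> (\<Sum>k\<in>?K. card (?W k))" by (rule card_UN_le) simp
  finally have "int (card {A \<in> {0..<N}. (A * d + s) mod R < L}) \<le> (\<Sum>k\<in>?K. int (card (?W k)))"
    by (simp flip: of_nat_sum)
  also have "\<dots> \<le> (\<Sum>k\<in>?K. L div d + 1)" by (intro sum_mono card_window(2)[OF d L])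
  also have "\<dots> = (N * d div R + 2) * (L div d + 1)"
    using pos_imp_zdiv_nonneg_iff[OF R, of "N * d"] N d by simp
  finally show ?thesis .
qed

text \<open>Running through the values backwards, \<open>A \<mapsto> N - 1 - A\<close>, turns step
  \<open>d\<close> into step \<open>-d\<close>.\<close>

lemma card_progression_mod_neg:
  fixes d s L R N :: int
  assumes d: "d \<noteq> 0" and L: "0 \<le> L" and R: "0 < R" and N: "0 \<le> N"
  shows "int (card {A \<in> {0..<N}. (A * d + s) mod R < L}) \<le> (N * \<bar>d\<bar> div R + 2) * (L div \<bar>d\<bar> + 1)"
proof (cases "0 < d")
  case True
  then show ?thesis using card_progression_mod[OF True L R N] by simp
next
  case False
  define s' where "s' = s + (N - 1) * d"
  let ?f = "\<lambda>A. N - 1 - A"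
  have eq: "?f A * d + s = A * (- d) + s'" "?f A * (- d) + s' = A * d + s" for A
    by (simp_all add: s'_def algebra_simps)
  have "bij_betw ?f {A \<in> {0..<N}. (A * d + s) mod R < L} {A \<in> {0..<N}. (A * (- d) + s') mod R < L}"
  proof (rule bij_betw_byWitness[where f'="?f"])
    show "?f ` {A \<in> {0..<N}. (A * d + s) mod R < L} \<subseteq> {A \<in> {0..<N}. (A * (- d) + s') mod R < L}"
    proof
      fix x assume "x \<in> ?f ` {A \<in> {0..<N}. (A * d + s) mod R < L}"
      then obtain A where "x = ?f A" "A \<in> {0..<N}" "(A * d + s) mod R < L" by blast
      then show "x \<in> {A \<in> {0..<N}. (A * (- d) + s') mod R < L}" using eq(2)[of A] by auto
    qed
    show "?f ` {A \<in> {0..<N}. (A * (- d) + s') mod R < L} \<subseteq> {A \<in> {0..<N}. (A * d + s) mod R < L}"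
    proof
      fix x assume "x \<in> ?f ` {A \<in> {0..<N}. (A * (- d) + s') mod R < L}"
      then obtain A where "x = ?f A" "A \<in> {0..<N}" "(A * (- d) + s') mod R < L" by blast
      then show "x \<in> {A \<in> {0..<N}. (A * d + s) mod R < L}" using eq(1)[of A] by auto
    qed
  qed auto
  then have "card {A \<in> {0..<N}. (A * d + s) mod R < L} =
       card {A \<in> {0..<N}. (A * (- d) + s') mod R < L}"
    by (rule bij_betw_same_card)
  then show ?thesis using card_progression_mod[of "- d" L R N s'] False d L R N by simp
qed

text \<open>For \<open>(a + 2) * (b + 1)\<close>: in \<open>a * b\<close> the difference cancels,
  giving at most \<open>10 * p\<close>; \<open>a \<le> p\<close> follows from
  \<open>\<bar>D\<bar> < M\<close>, and \<open>b \<le> 160 * p\<close> from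
  \<open>M \<le> 16 * p\<close> and \<open>\<bar>D\<bar> \<ge> 1\<close>. The total is at most
  \<open>10 * p + p + 320 * p + p\<close>, below \<open>350 * p\<close>: a collision probability of
  at most \<open>350 / Q\<close>.\<close>

lemma collision_count:
  fixes M Q D N p :: int
  assumes D: "D \<noteq> 0" "\<bar>D\<bar> < M" and Q: "0 < Q" and N: "N = p * Q" "M \<le> 16 * p" "2 \<le> p"
  shows "int (card {A \<in> {0..<N}. (A * D + 5 * M) mod (Q * M) < 10 * M}) \<le> 350 * p"
proof -
  have M: "0 < M" using D by linarith
  let ?d = "\<bar>D\<bar>"
  define a where "a = N * ?d div (Q * M)"
  define b where "b = 10 * M div ?d"
  have d: "0 < ?d" using D by simp
  have R: "0 < Q * M" using Q M by simp
  have N0: "0 \<le> N" using N Q by simp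
  have a0: "0 \<le> a" "a * (Q * M) \<le> N * ?d"
    unfolding a_def using R N0 d pos_imp_zdiv_nonneg_iff[OF R, of "N * ?d"] pos_mod_sign[OF R, of "N * ?d"]
      mod_div_mult_eq[of "N * ?d" "Q * M"] by (auto, linarith)
  have b0: "0 \<le> b" "b * ?d \<le> 10 * M"
    unfolding b_def using M d pos_imp_zdiv_nonneg_iff[OF d, of "10 * M"] pos_mod_sign[OF d, of "10 * M"]
      mod_div_mult_eq[of "10 * M" "?d"] by (auto, linarith)
  have "a * (Q * M) \<le> p * Q * ?d" using a0 N by simp
  then have "(a * M) * Q \<le> (p * ?d) * Q" by (simp add: algebra_simps)
  then have aM: "a * M \<le> p * ?d" using Q by (simp add: mult_le_cancel_right)
  also have "\<dots> \<le> p * M" using D(2) N(3) by (intro mult_left_mono) auto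
  finally have ap: "a \<le> p" using M by (simp add: mult_le_cancel_right)
  have "(a * b) * M = (a * M) * b" by simp
  also have "\<dots> \<le> (p * ?d) * b" using aM b0 by (intro mult_right_mono) auto
  also have "\<dots> = p * (b * ?d)" by simp
  also have "\<dots> \<le> p * (10 * M)" using b0 N(3) by (intro mult_left_mono) auto
  finally have "(a * b) * M \<le> (10 * p) * M" by simp
  then have ab: "a * b \<le> 10 * p" using M by (simp add: mult_le_cancel_right)
  have "b * 1 \<le> b * ?d" using b0 d by (intro mult_left_mono) auto
  then have b1: "b \<le> 160 * p" using b0(2) N(2) by linarith
  have "int (card {A \<in> {0..<N}. (A * D + 5 * M) mod (Q * M) < 10 * M}) \<le> (a + 2) * (b + 1)"
    unfolding a_def b_def using D M R N0 by (intro card_progression_mod_neg) auto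
  also have "\<dots> = a * b + a + 2 * b + 2" by (simp add: algebra_simps)
  also have "\<dots> \<le> 350 * p" using ab ap b1 N(3) by linarith
  finally show ?thesis .
qed

section \<open>Random strings as numbers\<close>

lemma bval_inj: "length a = length b \<Longrightarrow> bval a = bval b \<Longrightarrow> a = b"
proof (induction a b rule: rev_induct2)
  case (4 x xs y ys)
  have "2 * bval xs + of_bool x = 2 * bval ys + of_bool y" using 4 by simp
  then have "x = y \<and> bval xs = bval ys" by (cases x; cases y) (auto, presburger+)
  then show ?case using 4 by simp
qed auto

lemma bval_bij: "bij_betw bval {rho. length rho = r} {0..<2 ^ r}"
proof -
  have inj: "inj_on bval {rho. length rho = r}" by (auto intro!: inj_onI bval_inj)
  have sub: "bval ` {rho. length rho = r} \<subseteq> {0..<2 ^ r}" using bval_nonneg bval_less by auto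
  have c: "card {rho :: bool list. length rho = r} = 2 ^ r"
    using card_lists_length_eq[of "UNIV :: bool set" r] by simp
  have "bval ` {rho. length rho = r} = {0..<2 ^ r}"
  proof (rule card_subset_eq[OF _ sub])
    show "card (bval ` {rho. length rho = r}) = card {0..<2 ^ r :: int}"
      using card_image[OF inj] c by (simp add: nat_power_eq)
  qed simp
  then show ?thesis using inj unfolding bij_betw_def by simp
qed

lemma card_bval: "card {rho. length rho = r \<and> P (bval rho)} = card {A \<in> {0..<2 ^ r}. P A}"
proof -
  have "bij_betw bval {rho. length rho = r \<and> P (bval rho)} {A \<in> {0..<2 ^ r}. P A}"
    using bval_bij[of r] unfolding bij_betw_def by (auto intro: inj_on_subset)
  then show ?thesis by (rule bij_betw_same_card)
qed

section \<open>Markov's inequality for the join cost\<close>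

lemma card_filter_sum: "finite S \<Longrightarrow> card {x \<in> S. P x} = (\<Sum>x\<in>S. of_bool (P x))"
  by (simp add: sum.If_cases of_bool_def Int_def)

text \<open>For each \<open>i\<close> and \<open>e\<close> only the key \<open>v - f i\<close>
  yields the sum \<open>v\<close>, so at most \<open>8 * 2 ^ q\<close> entries escape the collision
  bound. The others, counted by \<open>X\<close>, have mean at most
  \<open>2 * 4 * 2 * 350 = 5600\<close> times \<open>2 ^ q\<close>. Exceeding the fuel means that
  \<open>X\<close> is more than six times as large, which Markov's inequality limits to probability
  \<open>1/6\<close>.\<close>

lemma cost_exceeds_rarely:
  fixes f :: "nat \<Rightarrow> int" and Y :: "int set" and C :: "int \<Rightarrow> nat \<Rightarrow> nat \<Rightarrow> int \<Rightarrow> bool"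
  assumes Y: "finite Y" "card Y \<le> 2 * 2 ^ q" and qr: "q \<le> r"
    and coll: "\<And>i e y. i < 2 * 2 ^ q \<Longrightarrow> e < 4 \<Longrightarrow> y \<in> Y \<Longrightarrow> f i + y \<noteq> v \<Longrightarrow>
       card {A \<in> {0..<2 ^ r}. C A i e y} \<le> 350 * 2 ^ (r - q)"
  defines "cost \<equiv> \<lambda>A. \<Sum>i<2 * 2 ^ q. \<Sum>e<4. card {y \<in> Y. C A i e y}"
  shows "6 * card {A \<in> {0..<2 ^ r}. cost A > 131072 * 2 ^ q} \<le> 2 ^ r"
proof -
  let ?N = "2 * 2 ^ q :: nat"
  let ?O = "{0..<2 ^ r} :: int set"
  define X where "X A = (\<Sum>i<?N. \<Sum>e<4. card {y \<in> Y. f i + y \<noteq> v \<and> C A i e y})" for A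
  have cost: "cost A \<le> 8 * 2 ^ q + X A" for A
  proof -
    have "card {y \<in> Y. C A i e y} \<le> 1 + card {y \<in> Y. f i + y \<noteq> v \<and> C A i e y}" for i e
    proof -
      have "{y \<in> Y. C A i e y} \<subseteq> {v - f i} \<union> {y \<in> Y. f i + y \<noteq> v \<and> C A i e y}" by auto
      then have "card {y \<in> Y. C A i e y} \<le> card ({v - f i} \<union> {y \<in> Y. f i + y \<noteq> v \<and> C A i e y})"
        using Y by (intro card_mono) auto
      also have "\<dots> \<le> card {v - f i} + card {y \<in> Y. f i + y \<noteq> v \<and> C A i e y}" by (rule card_Un_le)
      finally show ?thesis by simp
    qed
    then have "cost A \<le> (\<Sum>i<?N. \<Sum>e<4::nat. 1 + card {y \<in> Y. f i + y \<noteq> v \<and> C A i e y})"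
      unfolding cost_def by (intro sum_mono)
    also have "\<dots> = 8 * 2 ^ q + X A" unfolding X_def by (simp only: sum.distrib sum_constant card_lessThan) simp
    finally show ?thesis .
  qed
  have "(\<Sum>A\<in>?O. X A) = (\<Sum>A\<in>?O. \<Sum>i<?N. \<Sum>e<4. \<Sum>y\<in>Y. of_bool (f i + y \<noteq> v \<and> C A i e y))"
    unfolding X_def using Y(1) by (simp add: card_filter_sum)
  also have "\<dots> = (\<Sum>i<?N. \<Sum>e<4. \<Sum>y\<in>Y. \<Sum>A\<in>?O. of_bool (f i + y \<noteq> v \<and> C A i e y))"
    by (simp only: sum.swap[of _ _ ?O])
  also have "\<dots> \<le> (\<Sum>i<?N. \<Sum>e<4::nat. \<Sum>y\<in>Y. 350 * 2 ^ (r - q))"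
  proof (intro sum_mono)
    fix i e y assume a: "i \<in> {..<?N}" "e \<in> {..<4::nat}" "y \<in> Y"
    show "(\<Sum>A\<in>?O. of_bool (f i + y \<noteq> v \<and> C A i e y)) \<le> (350 * 2 ^ (r - q) :: nat)"
    proof (cases "f i + y = v")
      case False
      then have "(\<Sum>A\<in>?O. of_bool (f i + y \<noteq> v \<and> C A i e y)) = (\<Sum>A\<in>?O. of_bool (C A i e y) :: nat)"
        by simp
      also have "\<dots> = card {A \<in> ?O. C A i e y}" by (rule card_filter_sum[symmetric]) simp
      also have "\<dots> \<le> 350 * 2 ^ (r - q)" using coll[of i e y] a False by simp
      finally show ?thesis .
    qed simp
  qed
  also have "\<dots> = ?N * (4 * (card Y * (350 * 2 ^ (r - q))))" by simp
  also have "\<dots> \<le> ?N * (4 * (?N * (350 * 2 ^ (r - q))))" using Y(2) by (intro mult_le_mono) auto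
  also have "\<dots> = 5600 * 2 ^ q * (2 ^ q * 2 ^ (r - q))" by simp
  also have "2 ^ q * 2 ^ (r - q) = (2::nat) ^ r" using qr by (simp flip: power_add)
  finally have tot: "(\<Sum>A\<in>?O. X A) \<le> 5600 * 2 ^ q * 2 ^ r" .
  let ?Bad = "{A \<in> ?O. cost A > 131072 * 2 ^ q}"
  have "33600 * 2 ^ q * card ?Bad = (\<Sum>A\<in>?Bad. 33600 * 2 ^ q)" by simp
  also have "\<dots> \<le> (\<Sum>A\<in>?Bad. X A)"
  proof (intro sum_mono)
    fix A assume "A \<in> ?Bad"
    then have "131072 * 2 ^ q < 8 * 2 ^ q + X A" using cost[of A] by simp
    then show "33600 * 2 ^ q \<le> X A" by simp
  qed
  also have "\<dots> \<le> (\<Sum>A\<in>?O. X A)" by (intro sum_mono2) auto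
  finally have "33600 * 2 ^ q * card ?Bad \<le> 5600 * 2 ^ q * 2 ^ r" using tot by linarith
  then have "(5600 * 2 ^ q) * (6 * card ?Bad) \<le> (5600 * 2 ^ q) * 2 ^ r" by simp
  then show ?thesis by (simp only: mult_le_cancel1) simp
qed

section \<open>Completeness\<close>

text \<open>Used with \<open>z = (c + 1) * n\<close>: the left side bounds \<open>3 * H\<close>, the
  right side is \<open>M\<close>.\<close>

lemma linear_le_power: "144 * z + 768 < 1048576 * (2::nat) ^ z"
proof -
  have "z + 1 \<le> 2 ^ z" by (induction z) auto
  then show ?thesis by linarith
qed

section \<open>Choice of the parameters\<close>

locale params =
  fixes c :: nat and as :: "int list"
  assumes bound: "\<And>a. a \<in> set as \<Longrightarrow> \<bar>a\<bar> \<le> 2 ^ (c * length as)"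
begin

definition n :: nat where "n = length as"
definition q :: nat where "q = n div 4"
text \<open>\<open>r - n = (c + 1) * n + 16\<close> makes \<open>OFF\<close> exceed
  \<open>n * 2^(c n)\<close>, a bound for all subset sums. The summand 16 ensures that
  \<open>3 * H\<close> and the fuel stay below \<open>M\<close> even for small
  \<open>n\<close>.\<close>

definition r :: nat where "r = (c + 2) * n + 16"
definition OFF :: int where "OFF = 2 ^ (r - n)"
definition M :: int where "M = 16 * OFF"
definition Q :: int where "Q = 2 ^ q"
definition H :: int where "H = 16 * (int r + int n)"

lemma rn: "r - n = (c + 1) * n + 16" "n \<le> r"
  by (simp_all add: r_def algebra_simps)

lemma OFF_eq: "OFF = 65536 * 2 ^ ((c + 1) * n)"
  unfolding OFF_def rn(1) power_add by simp

lemma M_big: "1048576 * 2 ^ ((c + 1) * n) = M"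
  unfolding M_def OFF_eq by simp

lemma small:
  assumes "finite I"
  shows "\<bar>\<Sum>k\<in>I. (if u + k < n then as ! (u + k) else 0)\<bar> < OFF"
proof -
  let ?w = "\<lambda>k. if u + k < n then as ! (u + k) else 0"
  have "(\<Sum>k\<in>I. \<bar>?w k\<bar>) = (\<Sum>k\<in>I \<inter> {..<n}. \<bar>?w k\<bar>)"
    using assms by (intro sum.mono_neutral_right) auto
  also have "\<dots> \<le> (\<Sum>k\<in>I \<inter> {..<n}. 2 ^ (c * n))"
    using bound by (intro sum_mono) (auto simp: n_def)
  also have "\<dots> \<le> int n * 2 ^ (c * n)"
  proof -
    have "card (I \<inter> {..<n}) \<le> n" using card_mono[of "{..<n}" "I \<inter> {..<n}"] by simp
    then show ?thesis by simp
  qed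
  also have "\<dots> \<le> 2 ^ n * 2 ^ (c * n)"
  proof (rule mult_right_mono)
    have "n \<le> 2 ^ n" by (simp add: less_imp_le)
    then show "int n \<le> 2 ^ n" by (metis of_nat_le_iff of_nat_numeral of_nat_power)
  qed simp
  also have "\<dots> = 2 ^ ((c + 1) * n)" by (simp flip: power_add)
  also have "\<dots> < OFF" unfolding OFF_eq by simp
  finally show ?thesis using sum_abs[of ?w I] by linarith
qed

lemma q_le: "4 * q \<le> n" "q \<le> n" "n \<le> 4 * (q + 1)" "q \<le> r"
  using rn(2) by (auto simp: q_def)

lemma Q_le: "Q \<le> 2 ^ ((c + 1) * n)"
  unfolding Q_def using q_le(2) by (intro power_increasing) auto

lemma HM: "3 * H < M" "64 \<le> H" "4 + int n + int r + int q < H"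
proof -
  let ?z = "(c + 1) * n"
  have "(c + 3) * n \<le> 3 * ?z" by (simp add: algebra_simps)
  moreover have h: "3 * H = 48 * int ((c + 3) * n) + 768" unfolding H_def r_def by (simp add: algebra_simps)
  ultimately have "3 * H \<le> int (144 * ?z + 768)" by linarith
  also have "\<dots> < int (1048576 * 2 ^ ?z)" using linear_le_power[of ?z] by (simp only: of_nat_less_iff)
  also have "\<dots> = M" using M_big by simp
  finally show "3 * H < M" .
  have r16: "16 \<le> r" by (simp add: r_def)
  show "64 \<le> H" "4 + int n + int r + int q < H" unfolding H_def using q_le(2) rn(2) r16 by simp_all
qed

definition \<tau> :: "int \<Rightarrow> int" where
  "\<tau> t = (if 0 < t + 4 * OFF \<and> t + 4 * OFF < M then t + 4 * OFF else 0)"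

definition B :: "int \<Rightarrow> nat" where
  "B t = r - n + bitlen t + 10"

lemma B_bound: "\<bar>t\<bar> + 16 * M < 2 ^ B t"
proof -
  let ?b = "2 ^ bitlen t :: int"
  have e: "2 ^ B t = 1024 * (OFF * ?b)" unfolding B_def OFF_def power_add by simp
  have "1 \<le> OFF" "1 \<le> ?b" unfolding OFF_def by simp_all
  then have "1 * ?b \<le> OFF * ?b" "OFF * 1 \<le> OFF * ?b" by (intro mult_right_mono mult_left_mono; simp)+
  then show ?thesis using less_two_power_bitlen[of t] \<open>1 \<le> ?b\<close> unfolding e M_def by linarith
qed

lemma verifier_run:
  assumes "length rho = r" "length pf \<le> q"
  shows "verifier_run as n r q (B t) M Q OFF H (\<tau> t) rho t pf"
proof
  show "2 * Q < M" "131072 * Q < M" using Q_le M_big by (smt (verit) zero_less_power)+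
  show "0 \<le> \<tau> t" "\<tau> t < M" unfolding \<tau>_def M_def OFF_def by auto
  show "16 * M \<le> 2 ^ B t" "\<bar>t\<bar> + 16 * M < 2 ^ B t" using B_bound[of t] by linarith+
  show "4 \<le> B t" by (simp add: B_def)
  show "\<bar>\<Sum>k\<in>I. if u + k < n then as ! (u + k) else 0\<bar> < OFF" if "finite I" for u I
    using small[OF that] .
qed (use assms HM rn(2) in \<open>auto simp: n_def Q_def M_def OFF_def H_def q_def \<tau>_def\<close>)

abbreviation G :: "nat \<Rightarrow> nat \<Rightarrow> int" where "G \<equiv> verifier.gsum as n OFF"
abbreviation L :: "nat \<Rightarrow> int set" where "L j \<equiv> verifier_run.blk as n q OFF j"

text \<open>The target \<open>\<sigma>\<close> is a function of \<open>A\<close>, because the honest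
  proof is chosen after the random string.\<close>

definition cost :: "(int \<Rightarrow> int) \<Rightarrow> nat \<Rightarrow> int set \<Rightarrow> int \<Rightarrow> nat" where
  "cost \<sigma> u Y A = (\<Sum>i<2 * 2 ^ q. \<Sum>e<4.
     card {y \<in> Y. (hashf Q M A (G u i) + hashf Q M A y + int e) mod Q = \<sigma> A})"

lemma run:
  assumes "length rho = r" "length pf \<le> q"
  shows "\<exists>T m'. exec cVerifier (init_mem as t rho pf) T m' \<and>
     T \<le> (10000000 + 16000 * (r + n)) * 2 ^ q * (1 + 3 * (B t + 100)) \<and>
     (m' 0 > 0 \<longrightarrow> subset_sum_yes as t) \<and>
     (length pf = q \<and> cost (\<lambda>A. bval pf) (q + 1) (L 0) (bval rho) \<le> 131072 * 2 ^ q \<and>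
      cost (\<lambda>A. (hashf Q M A (\<tau> t) - bval pf) mod Q) (3 * (q + 1)) (L 2) (bval rho) \<le> 131072 * 2 ^ q \<and>
      (\<exists>x1\<in>L 0. \<exists>i2<2 * 2 ^ q. \<exists>x3\<in>L 2. \<exists>i4<2 * 2 ^ q.
         x1 + G (q + 1) i2 + (x3 + G (3 * (q + 1)) i4) = \<tau> t \<and>
         (hashf Q M (bval rho) x1 + hashf Q M (bval rho) (G (q + 1) i2)) mod Q = bval pf)
      \<longrightarrow> m' 0 > 0)"
proof -
  interpret V: verifier_run as n r q "B t" M Q OFF H "\<tau> t" rho t pf by (rule verifier_run[OF assms])
  have pb: "V.pb = pf" if "length pf = q"
    unfolding V.pb_def using that by (intro nth_equalityI) auto
  have c: "V.cost1 = cost (\<lambda>A. bval pf) (q + 1) (L 0) (bval rho)"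
    "V.cost2 = cost (\<lambda>A. (hashf Q M A (\<tau> t) - bval pf) mod Q) (3 * (q + 1)) (L 2) (bval rho)"
    if "length pf = q"
    unfolding V.cost1_def V.cost2_def V.jcost_def cost_def V.\<sigma>1_def V.\<sigma>2_def V.hash_eq_hashf pb[OF that] by simp_all
  obtain k m' where m': "runs (B t) cVerifier (init_mem as t rho pf) k m'" "k \<le> (10000000 + 1000 * V.h) * 2 ^ q"
    "m' 0 > 0 \<longrightarrow> subset_sum_yes as t"
    "V.cost1 \<le> 131072 * 2 ^ q \<and> V.cost2 \<le> 131072 * 2 ^ q \<and>
      (\<exists>x1\<in>L 0. \<exists>i2<2 * 2 ^ q. \<exists>x3\<in>L 2. \<exists>i4<2 * 2 ^ q.
         x1 + G (q + 1) i2 + (x3 + G (3 * (q + 1)) i4) = \<tau> t \<and> (V.hash x1 + V.hash (G (q + 1) i2)) mod Q = V.\<sigma>1)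
      \<longrightarrow> m' 0 > 0"
    using V.verifier_runs by blast
  obtain T where T: "exec cVerifier (init_mem as t rho pf) T m'" "T \<le> k * (1 + 3 * (B t + 100))"
    using m'(1) unfolding runs_def by blast
  have "k \<le> (10000000 + 16000 * (r + n)) * 2 ^ q" using m'(2) by (simp add: V.h_def)
  then have "T \<le> (10000000 + 16000 * (r + n)) * 2 ^ q * (1 + 3 * (B t + 100))"
    using T(2) by (meson mult_le_mono1 order_trans)
  moreover note 4 = m'(4)[unfolded V.\<sigma>1_def V.hash_eq_hashf]
  ultimately show ?thesis
  proof (intro exI[of _ T] exI[of _ m'] conjI T(1) m'(3), goal_cases)
    case 2
    show ?case
    proof (intro impI, elim conjE)
      assume l: "length pf = q"
      show "m' 0 > 0"
        if "cost (\<lambda>A. bval pf) (q + 1) (L 0) (bval rho) \<le> 131072 * 2 ^ q"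
          "cost (\<lambda>A. (hashf Q M A (\<tau> t) - bval pf) mod Q) (3 * (q + 1)) (L 2) (bval rho) \<le> 131072 * 2 ^ q"
          "\<exists>x1\<in>L 0. \<exists>i2<2 * 2 ^ q. \<exists>x3\<in>L 2. \<exists>i4<2 * 2 ^ q.
             x1 + G (q + 1) i2 + (x3 + G (3 * (q + 1)) i4) = \<tau> t \<and>
             (hashf Q M (bval rho) x1 + hashf Q M (bval rho) (G (q + 1) i2)) mod Q = bval pf"
        by (rule 4[unfolded c[OF l] pb[OF l], THEN mp, OF conjI, OF that(1) conjI, OF that(2,3)])
    qed
  qed
qed

text \<open>One factor of the size comes from the loops over the random string, the other from the
  length of the numbers in one instruction; \<open>q \<le> n / 4\<close> gives the exponential
  factor.\<close>

lemma time_bound: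
  assumes "T \<le> (10000000 + 16000 * (r + n)) * 2 ^ q * (1 + 3 * (B t + 100))"
  shows "real T \<le> real ((10256000 + 16000 * (c + 3)) * (3 * (c + 1) + 382)) * real (inst_size as t + 1) ^ 2 * 2 powr (real n / 4)"
proof -
  define s where "s = inst_size as t + 1"
  have s: "n \<le> s" "bitlen t \<le> s" "1 \<le> s" unfolding s_def inst_size_def n_def by auto
  have cs: "(c + 3) * n \<le> (c + 3) * s" "(c + 1) * n \<le> (c + 1) * s" using s by (intro mult_le_mono; simp)+
  have lin: "10000000 + 16000 * (x + 16) \<le> 10256000 * s + 16000 * y" "1 + 3 * (x + 26 + z + 100) \<le> 3 * y + 382 * s"
    if "x \<le> y" "z \<le> s" "1 \<le> s" for x y z s :: nat using that by simp_all
  have "r + n = (c + 3) * n + 16" unfolding r_def by (simp add: algebra_simps)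
  then have "10000000 + 16000 * (r + n) \<le> 10256000 * s + 16000 * ((c + 3) * s)" using lin(1)[OF cs(1) s(2,3)] by metis
  then have 1: "10000000 + 16000 * (r + n) \<le> (10256000 + 16000 * (c + 3)) * s" by (simp add: algebra_simps)
  have "B t = (c + 1) * n + 26 + bitlen t" unfolding B_def rn(1) by simp
  then have "1 + 3 * (B t + 100) \<le> 3 * ((c + 1) * s) + 382 * s" using lin(2)[OF cs(2) s(2,3)] by metis
  then have 2: "1 + 3 * (B t + 100) \<le> (3 * (c + 1) + 382) * s" by (simp add: algebra_simps)
  have "T \<le> ((10256000 + 16000 * (c + 3)) * s) * 2 ^ q * ((3 * (c + 1) + 382) * s)"
    by (rule order_trans[OF assms]) (intro mult_le_mono 1 2 le_refl)
  also have "\<dots> = ((10256000 + 16000 * (c + 3)) * (3 * (c + 1) + 382)) * s ^ 2 * 2 ^ q"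
    by (simp add: power2_eq_square)
  finally have "real T \<le> real (((10256000 + 16000 * (c + 3)) * (3 * (c + 1) + 382)) * s ^ 2 * 2 ^ q)"
    by (simp only: of_nat_le_iff)
  also have "\<dots> = real ((10256000 + 16000 * (c + 3)) * (3 * (c + 1) + 382)) * real s ^ 2 * 2 ^ q" by simp
  also have "\<dots> \<le> real ((10256000 + 16000 * (c + 3)) * (3 * (c + 1) + 382)) * real s ^ 2 * 2 powr (real n / 4)"
  proof (rule mult_left_mono)
    have "4 * real q \<le> real n" using q_le(1) by linarith
    then have "2 powr real q \<le> 2 powr (real n / 4)" by (intro powr_mono) auto
    then show "2 ^ q \<le> 2 powr (real n / 4)" by (simp add: powr_realpow)
  qed simp
  finally show ?thesis unfolding s_def .
qed

lemma L_range:
  fixes rho :: "bool list"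
  assumes "length rho = r"
  shows "finite (L j)" "card (L j) \<le> 2 * 2 ^ q" "\<And>y. y \<in> L j \<Longrightarrow> 0 < y \<and> y < 2 * OFF" "\<And>u i. 0 < G u i \<and> G u i < 2 * OFF"
proof -
  interpret V: verifier_run as n r q "B 0" M Q OFF H "\<tau> 0" rho 0 "[]" by (rule verifier_run) (use assms in auto)
  show "finite (L j)" unfolding V.blk_def by simp
  show "card (L j) \<le> 2 * 2 ^ q" unfolding V.blk_def using card_image_le[of "{..<2 * 2 ^ q}" "V.gsum (j * (q + 1))"] by simp
  show "0 < G u i \<and> G u i < 2 * OFF" for u i using V.gsum_range by blast
  then show "0 < y \<and> y < 2 * OFF" if "y \<in> L j" for y using that unfolding V.blk_def by auto
qed

text \<open>\<open>\<sigma>\<close> is the hash of the pair in the fixed solution, up to the rounding error \<open>\<epsilon>\<close>.\<close>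

lemma cost_rare:
  fixes rho :: "bool list"
  assumes rho: "length rho = r" and x: "0 < x" "x < 2 * OFF" "0 < x'" "x' < 2 * OFF"
    and \<sigma>: "\<And>A. \<exists>\<epsilon><4::nat. \<sigma> A = (hashf Q M A x + hashf Q M A x' + int \<epsilon>) mod Q"
  shows "6 * card {A \<in> {0..<2 ^ r}. cost \<sigma> u (L j) A > 131072 * 2 ^ q} \<le> 2 ^ r"
  unfolding cost_def
proof (rule cost_exceeds_rarely[where v="x + x'" and f="G u"])
  note L = L_range[OF rho]
  fix i e y assume a: "i < (2 * 2 ^ q :: nat)" "e < (4::nat)" "y \<in> L j" "G u i + y \<noteq> x + x'"
  define D where "D = G u i + y - (x + x')"
  have M: "0 < M" "8 * OFF < M" unfolding M_def OFF_def by simp_all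
  have Q: "0 < Q" unfolding Q_def by simp
  have "{A \<in> {0..<2 ^ r}. (hashf Q M A (G u i) + hashf Q M A y + int e) mod Q = \<sigma> A} \<subseteq>
     {A \<in> {0..<2 ^ r}. (A * D + 5 * M) mod (Q * M) < 10 * M}"
  proof safe
    fix A assume "(hashf Q M A (G u i) + hashf Q M A y + int e) mod Q = \<sigma> A"
    then show "(A * D + 5 * M) mod (Q * M) < 10 * M"
      using \<sigma>[of A] hash_collision[OF M(1) Q _ a(2)] unfolding D_def by metis
  qed
  then have "card {A \<in> {0..<2 ^ r}. (hashf Q M A (G u i) + hashf Q M A y + int e) mod Q = \<sigma> A} \<le>
     card {A \<in> {0..<2 ^ r :: int}. (A * D + 5 * M) mod (Q * M) < 10 * M}"
    by (intro card_mono) (auto intro: finite_subset[of _ "{0..<2 ^ r}"])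
  also have "int \<dots> \<le> 350 * 2 ^ (r - q)"
  proof (rule collision_count)
    show "D \<noteq> 0" using a(4) by (simp add: D_def)
    show "\<bar>D\<bar> < M" unfolding D_def using L(3)[OF a(3)] L(4)[of u i] x M by linarith
    show "(2::int) ^ r = 2 ^ (r - q) * Q" unfolding Q_def using q_le(4) by (simp flip: power_add)
    have "r - n \<le> r - q" using q_le(2) by simp
    then have "OFF \<le> 2 ^ (r - q)" unfolding OFF_def by (intro power_increasing) auto
    then show "M \<le> 16 * 2 ^ (r - q)" unfolding M_def by simp
    have "1 \<le> r - q" using q_le(2) by (simp add: r_def)
    then have "(2::int) ^ 1 \<le> 2 ^ (r - q)" by (intro power_increasing) auto
    then show "(2::int) \<le> 2 ^ (r - q)" by simp
  qed (rule Q)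
  finally show "card {A \<in> {0..<2 ^ r}. (hashf Q M A (G u i) + hashf Q M A y + int e) mod Q = \<sigma> A} \<le> 350 * 2 ^ (r - q)"
    by (metis (mono_tags, lifting) of_nat_le_iff of_nat_mult of_nat_numeral of_nat_power)
qed (use L_range[OF rho] q_le(4) in auto)

text \<open>With a fixed solution, each phase runs out of fuel for at most a sixth of the random
  strings. For all others the hash sum of the first pair, written with \<open>q\<close> bits, is an
  accepted proof.\<close>

lemma completeness:
  assumes yes: "subset_sum_yes as t"
  shows "2 * 2 ^ r \<le> 3 * card {rho. length rho = r \<and> (\<exists>pf. length pf \<le> q \<and>
     (\<exists>T m'. exec cVerifier (init_mem as t rho pf) T m' \<and> m' 0 > 0))}"
    (is "_ \<le> 3 * card ?Acc")
proof -
  \<comment> \<open>The block sums do not depend on the random string, so any string gives access to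
    the facts about them.\<close>
  obtain rho0 :: "bool list" where rho0: "length rho0 = r" using Ex_list_of_length by blast
  interpret V: verifier_run as n r q "B t" M Q OFF H "\<tau> t" rho0 t "[]" by (rule verifier_run) (use rho0 in auto)
  obtain i1 i2 i3 i4 where i: "i1 < 2 * 2 ^ q" "i2 < 2 * 2 ^ q" "i3 < 2 * 2 ^ q" "i4 < 2 * 2 ^ q"
    and sum: "G 0 i1 + G (q + 1) i2 + (G (2 * (q + 1)) i3 + G (3 * (q + 1)) i4) = t + 4 * OFF"
    using V.subset_sum_gsums[OF yes q_le(3)] by blast
  define x1 x2 x3 x4 where "x1 = G 0 i1" and "x2 = G (q + 1) i2" and "x3 = G (2 * (q + 1)) i3" and "x4 = G (3 * (q + 1)) i4"
  note xd = x1_def x2_def x3_def x4_def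
  have xr: "0 < x1" "x1 < 2 * OFF" "0 < x2" "x2 < 2 * OFF" "0 < x3" "x3 < 2 * OFF" "0 < x4" "x4 < 2 * OFF"
    unfolding xd using V.gsum_range by blast+
  have M: "0 < M" "8 * OFF < M" unfolding M_def OFF_def by simp_all
  have Q: "0 < Q" unfolding Q_def by simp
  have tau: "x1 + x2 + x3 + x4 = \<tau> t" using sum xr M unfolding xd[symmetric] \<tau>_def by auto
  have x13: "x1 \<in> L 0" "x3 \<in> L 2" unfolding xd V.blk_def using i by auto
  define s where "s A = (hashf Q M A x1 + hashf Q M A x2) mod Q" for A
  define s' where "s' A = (hashf Q M A (\<tau> t) - s A) mod Q" for A
  have "\<exists>\<epsilon><4::nat. s A = (hashf Q M A x1 + hashf Q M A x2 + int \<epsilon>) mod Q" for A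
    unfolding s_def by (intro exI[of _ 0]) simp
  then have rare1: "6 * card {A \<in> {0..<2 ^ r}. cost s (q + 1) (L 0) A > 131072 * 2 ^ q} \<le> 2 ^ r"
    by (rule cost_rare[OF rho0 xr(1-4)])
  have "\<exists>\<epsilon><4::nat. s' A = (hashf Q M A x3 + hashf Q M A x4 + int \<epsilon>) mod Q" for A
  proof -
    obtain e :: nat where e: "e < 4"
      "(hashf Q M A x1 + hashf Q M A x2 + (hashf Q M A x3 + hashf Q M A x4 + int e)) mod Q = hashf Q M A (\<tau> t)"
      using hashf_sum4[OF M(1) tau] by metis
    have "s' A = ((hashf Q M A x1 + hashf Q M A x2 + (hashf Q M A x3 + hashf Q M A x4 + int e)) -
        (hashf Q M A x1 + hashf Q M A x2)) mod Q"
      unfolding s'_def s_def e(2)[symmetric] by (rule mod_diff_eq)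
    then show ?thesis using e(1) by (intro exI[of _ e]) simp
  qed
  then have rare2: "6 * card {A \<in> {0..<2 ^ r}. cost s' (3 * (q + 1)) (L 2) A > 131072 * 2 ^ q} \<le> 2 ^ r"
    by (rule cost_rare[OF rho0 xr(5-8)])
  let ?B1 = "{rho. length rho = r \<and> cost s (q + 1) (L 0) (bval rho) > 131072 * 2 ^ q}"
  let ?B2 = "{rho. length rho = r \<and> cost s' (3 * (q + 1)) (L 2) (bval rho) > 131072 * 2 ^ q}"
  have acc: "rho \<in> ?Acc" if rho: "length rho = r" "rho \<notin> ?B1" "rho \<notin> ?B2" for rho
  proof -
    let ?A = "bval rho"
    have "s ?A \<in> {0..<2 ^ q}" unfolding s_def using Q by (simp add: Q_def)
    then obtain pf where pf: "length pf = q" "bval pf = s ?A"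
      using bval_bij[of q] unfolding bij_betw_def by (metis (mono_tags, lifting) imageE mem_Collect_eq)
    have c: "cost (\<lambda>A. bval pf) (q + 1) (L 0) ?A \<le> 131072 * 2 ^ q"
      "cost (\<lambda>A. (hashf Q M A (\<tau> t) - bval pf) mod Q) (3 * (q + 1)) (L 2) ?A \<le> 131072 * 2 ^ q"
      using rho unfolding cost_def pf(2) s'_def by auto
    have "\<exists>x1\<in>L 0. \<exists>i2<2 * 2 ^ q. \<exists>x3\<in>L 2. \<exists>i4<2 * 2 ^ q.
         x1 + G (q + 1) i2 + (x3 + G (3 * (q + 1)) i4) = \<tau> t \<and>
         (hashf Q M ?A x1 + hashf Q M ?A (G (q + 1) i2)) mod Q = bval pf"
      using x13 i(2,4) tau unfolding pf(2) s_def x2_def x4_def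
      by (intro bexI[of _ x1] exI[of _ i2] bexI[of _ x3] exI[of _ i4] conjI) auto
    then obtain T m' where "exec cVerifier (init_mem as t rho pf) T m'" "m' 0 > 0"
      using run[OF rho(1), of pf t] pf(1) c by auto
    then show ?thesis using rho(1) eq_refl[OF pf(1)] by blast
  qed
  have fin: "finite {rho :: bool list. length rho = r}"
    using finite_lists_length_eq[of "UNIV :: bool set" r] by simp
  have "2 ^ r = card {rho :: bool list. length rho = r}"
    using card_lists_length_eq[of "UNIV :: bool set" r] by simp
  also have "\<dots> \<le> card (?Acc \<union> (?B1 \<union> ?B2))"
    using acc by (intro card_mono finite_subset[OF _ fin]) auto
  also have "\<dots> \<le> card ?Acc + (card ?B1 + card ?B2)"
    by (meson add_left_mono card_Un_le order_trans)
  finally have "2 ^ r \<le> card ?Acc + (card ?B1 + card ?B2)" .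
  moreover have "6 * card ?B1 \<le> 2 ^ r"
    using rare1 card_bval[of r "\<lambda>A. 131072 * 2 ^ q < cost s (q + 1) (L 0) A"] by simp
  moreover have "6 * card ?B2 \<le> 2 ^ r"
    using rare2 card_bval[of r "\<lambda>A. 131072 * 2 ^ q < cost s' (3 * (q + 1)) (L 2) A"] by simp
  ultimately show ?thesis by linarith
qed

end

theorem mainTheorem2:
  shows "\<forall>c::nat. \<exists>(V::com) (r::nat \<Rightarrow> nat) (C::real) (k::nat).
    \<forall>(as::int list) (t::int).
      distinct as \<and> (\<forall>a\<in>set as. \<bar>a\<bar> \<le> 2 ^ (c * length as)) \<longrightarrow>
      (let n = length as in
         \<comment> \<open>verification time O*(2^(n/4)) on every random string and every admissible proof\<close>
         (\<forall>rho prf. length rho = r n \<and> real (length prf) \<le> real n / 4 \<longrightarrow>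
            (\<exists>T m'. exec V (init_mem as t rho prf) T m' \<and>
                    real T \<le> C * real (inst_size as t + 1) ^ k * 2 powr (real n / 4)))
         \<and> \<comment> \<open>completeness: probability at least 2/3\<close>
         (subset_sum_yes as t \<longrightarrow>
            3 * card {rho. length rho = r n \<and>
                 (\<exists>prf. real (length prf) \<le> real n / 4 \<and>
                    (\<exists>T m'. exec V (init_mem as t rho prf) T m' \<and> m' 0 > 0))}
            \<ge> 2 * 2 ^ r n)
         \<and> \<comment> \<open>perfect soundness\<close>
         (\<not> subset_sum_yes as t \<longrightarrow>
            (\<forall>rho prf T m'. length rho = r n \<and> real (length prf) \<le> real n / 4 \<and>
                exec V (init_mem as t rho prf) T m' \<longrightarrow> \<not> m' 0 > 0)))"
proof (rule allI, goal_cases)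
  case (1 c)
  show ?case
  proof (rule exI[of _ cVerifier], rule exI[of _ "\<lambda>n. (c + 2) * n + 16"],
      rule exI[of _ "real ((10256000 + 16000 * (c + 3)) * (3 * (c + 1) + 382))"], rule exI[of _ 2],
      intro allI impI, goal_cases)
    case (1 as t)
    then interpret params c as by unfold_locales auto
    have r: "(c + 2) * length as + 16 = r" by (simp add: r_def n_def)
    have len: "real (length pf) \<le> real (length as) / 4 \<longleftrightarrow> length pf \<le> q" for pf :: "bool list"
      unfolding q_def n_def by (auto simp: field_simps)
    have time: "\<exists>T m'. exec cVerifier (init_mem as t rho pf) T m' \<and> real T \<le>
        real ((10256000 + 16000 * (c + 3)) * (3 * (c + 1) + 382)) * real (inst_size as t + 1) ^ 2 *
        2 powr (real (length as) / 4)"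
      if "length rho = r" "length pf \<le> q" for rho pf
      using run[OF that, of t] time_bound[unfolded n_def] unfolding n_def by blast
    have sound: "\<not> m' 0 > 0" if "\<not> subset_sum_yes as t" "length rho = r" "length pf \<le> q"
        "exec cVerifier (init_mem as t rho pf) T m'" for rho pf T m'
      using run[OF that(2,3), of t] exec_deterministic[OF that(4)] that(1) by blast
    show ?case
      unfolding Let_def r len using time completeness sound by blast
  qed
qed

end
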